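(* There are decreasing, convex and continuous mappings $\gamma_n:\mathbb R_+\to\mathbb R_+$, $n\in\mathbb N$, and $\gamma:\mathbb R_+\to\mathbb R_+$ such that $$\Gamma_n=\{(\phi_0,\phi_1)\in\mathbb R_+^2:\phi_1\ge\gamma_n(\phi_0)\},\ n\in\mathbb N,\qquad \Gamma=\{(\phi_0,\phi_1)\in\mathbb R_+^2:\phi_1\ge\gamma(\phi_0)\}.$$ The sequence $\{\gamma_n(\phi_0)\}_{n\in\mathbb N}$ is increasing and $\gamma(\phi_0)=\lim_n\uparrow\gamma_n(\phi_0)$ for every $\phi_0\in\mathbb R_+$. There are numbers $$\frac{\lambda}{c}\sqrt2\le\xi_1\le\cdots\le\xi_{n-1}\le\xi_n\le\cdots\le\xi<\xi^*<\infty$$ such that $\gamma_n(\cdot)$, $n\in\mathbb N$ [resp. $\gamma(\cdot)$] is strictly decreasing on $[0,\xi_n]$ (resp. $[0,\xi]$) and vanishes on $[\xi_n,\infty)$ (resp. $[\xi,\infty)$). Moreover, $$\frac{\lambda}{c}\sqrt2\le\gamma_1(0)\le\cdots\le\gamma_{n-1}(0)\le\gamma_n(0)\le\cdots\le\gamma(0)<\xi^*<\infty.$$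
   Context: Fix constants $\lambda>0$, $\mu>1$, $c>0$, $m\in(-1,1)$; $\mathbb R_+=[0,\infty)$, $\mathbb N=\{1,2,\dots\}$. On a probability space $(\Omega,\mathcal H,\mathbb P_0)$ let $N$ be a homogeneous Poisson process with rate $\mu$ and jump times $0=\sigma_0<\sigma_1<\sigma_2<\cdots$; $\mathbb F$ is the right-continuous enlargement with $\mathbb P_0$-null sets of its natural filtration, and $\mathcal S$ is the collection of all $\mathbb F$-stopping times. For $\phi_0,\phi_1\in\mathbb R$ let $x(t,\phi_0)$, $y(t,\phi_1)$, $t\in\mathbb R$, be the solutions of $$\frac{d}{dt}x(t,\phi_0)=(\lambda+1)x(t,\phi_0)+\frac{\lambda(1-m)}{\sqrt2},\ x(0,\phi_0)=\phi_0;\qquad \frac{d}{dt}y(t,\phi_1)=(\lambda-1)y(t,\phi_1)+\frac{\lambda(1+m)}{\sqrt2},\ y(0,\phi_1)=\phi_1,$$ and let $S(\phi_0,\phi_1)=\big((1-\frac1\mu)\phi_0,(1+\frac1\mu)\phi_1\big)$. The process $\widetilde\Phi=(\widetilde\Phi^{(0)},\widetilde\Phi^{(1)})$ in $\mathbb R_+^2$ started at $(\phi_0,\phi_1)$ satisfies $\widetilde\Phi_0=(\phi_0,\phi_1)$, $\widetilde\Phi_t=\big(x(t-\sigma_n,\widetilde\Phi^{(0)}_{\sigma_n}),y(t-\sigma_n,\widetilde\Phi^{(1)}_{\sigma_n})\big)$ for $\sigma_n\le t<\sigma_{n+1}$, $n\ge0$, and $\widetilde\Phi_{\sigma_n}=S(\widetilde\Phi_{\sigma_n-})$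 for $n\ge1$. $\mathbb E_0^{\phi_0,\phi_1}$ is the $\mathbb P_0$-expectation when $\widetilde\Phi_0=(\phi_0,\phi_1)$. With $g(\phi_0,\phi_1)=\phi_0+\phi_1-\frac{\lambda}{c}\sqrt2$, the value function is $$V(\phi_0,\phi_1)=\inf_{\tau\in\mathcal S}\mathbb E_0^{\phi_0,\phi_1}\Big[\int_0^\tau e^{-\lambda t}g(\widetilde\Phi_t)\,dt\Big],\qquad(\phi_0,\phi_1)\in\mathbb R_+^2.$$ For bounded Borel $w:\mathbb R_+^2\to\mathbb R$ and $t\in[0,\infty]$ put $$Jw(t,\phi_0,\phi_1)=\mathbb E_0^{\phi_0,\phi_1}\Big[\int_0^{t\wedge\sigma_1}e^{-\lambda u}g(\widetilde\Phi_u)\,du+1_{\{t\ge\sigma_1\}}e^{-\lambda\sigma_1}w(\widetilde\Phi_{\sigma_1})\Big],\qquad J_tw(\phi_0,\phi_1)=\inf_{u\in[t,\infty]}Jw(u,\phi_0,\phi_1),$$ and $v_0\equiv0$, $v_n=J_0v_{n-1}$ for $n\ge1$ (the limit of the $v_n$ is $V$). The stopping regions are $\Gamma_n=\{v_n=0\}$, $n\in\mathbb N$, and $\Gamma=\{V=0\}$ (subsets of $\mathbb R_+^2$). The number $\xi^*$ is defined as follows. If $\lambda\ge1$, or if $0<\lambda<1$ and $\frac{\lambda}{1-\lambda}\ge\frac{\lambda+\mu}{c}$, then $\xi^*=\frac{\lambda+\mu}{c}\sqrt2$. If $0<\lambda<1$ and $\frac{\lambda}{1-\lambda}<\frac{\lambda+\mu}{c}$,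 let $(\phi_0^*,\phi_1^* )$ be the intersection of the lines $(\lambda+1)x+(\lambda-1)y+\lambda\sqrt2=0$ and $x+y=\frac{\lambda+\mu}{c}\sqrt2$, let $t^*\ge0$ solve $x(-t^*,\phi_0^* )=0$, and put $\xi^*=y(-t^*,\phi_1^* )$. *)

theory Defs
  imports "HOL-Probability.Probability"
begin

definition natural_sigma ::
  "'a measure \<Rightarrow> (real \<Rightarrow> 'a \<Rightarrow> nat) \<Rightarrow> real \<Rightarrow> 'a measure" where
  "natural_sigma M N t = sigma (space M) {N s -` A \<inter> space M | s A. 0 \<le> s \<and> s \<le> t}"

text \<open>A homogeneous Poisson process of rate \<open>\<mu>\<close>, together with the enumeration \<open>\<sigma>\<close> of its
  jump times; the last four conditions say that every path is a simple counting path which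
  jumps exactly at \<open>\<sigma> 1 < \<sigma> 2 < \<dots>\<close>, so that \<open>\<sigma>\<close> is determined by \<open>N\<close>. Divergence of \<open>\<sigma>\<close>
  keeps the set whose cardinality is taken finite.\<close>

definition poisson_process ::
  "'a measure \<Rightarrow> real \<Rightarrow> (real \<Rightarrow> 'a \<Rightarrow> nat) \<Rightarrow> (nat \<Rightarrow> 'a \<Rightarrow> real) \<Rightarrow> bool" where
  "poisson_process M \<mu> N \<sigma> \<longleftrightarrow>
     prob_space M \<and>
     (\<forall>t\<ge>0. N t \<in> measurable M (count_space UNIV)) \<and>
     (\<forall>s t. 0 \<le> s \<longrightarrow> s < t \<longrightarrow>
        prob_space.indep_set M (sets (natural_sigma M N s))
          {(\<lambda>\<omega>. N t \<omega> - N s \<omega>) -` A \<inter> space M | A. True} \<and>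
        distr M (count_space UNIV) (\<lambda>\<omega>. N t \<omega> - N s \<omega>)
          = measure_pmf (poisson_pmf (\<mu> * (t - s)))) \<and>
     (\<forall>\<omega>\<in>space M.
        \<sigma> 0 \<omega> = 0 \<and>
        strict_mono (\<lambda>n. \<sigma> n \<omega>) \<and>
        filterlim (\<lambda>n. \<sigma> n \<omega>) at_top sequentially \<and>
        (\<forall>t\<ge>0. N t \<omega> = card {n. 1 \<le> n \<and> \<sigma> n \<omega> \<le> t}))"

text \<open>The right-continuous enlargement, with the null sets, of the natural filtration. The
  null sets are the measurable ones; they are all null sets if \<open>M\<close> is complete, which is not
  required here.\<close>

definition augmented_filtration ::
  "'a measure \<Rightarrow> (real \<Rightarrow> 'a \<Rightarrow> nat) \<Rightarrow> real \<Rightarrow> 'a set set" where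
  "augmented_filtration M N t =
     (\<Inter>u\<in>{t<..}. sigma_sets (space M) (sets (natural_sigma M N u) \<union> null_sets M))"

text \<open>Stopping times may take the value \<open>\<infinity>\<close>, whereas the filtration is indexed by real times;
  this is why the predicate \<open>stopping_time\<close> of the library, in which both have the same type,
  is not used.\<close>

definition stopping_times ::
  "'a measure \<Rightarrow> (real \<Rightarrow> 'a \<Rightarrow> nat) \<Rightarrow> ('a \<Rightarrow> ennreal) set" where
  "stopping_times M N =
     {\<tau>. \<forall>t\<ge>0. {\<omega> \<in> space M. \<tau> \<omega> \<le> ennreal t} \<in> augmented_filtration M N t}"

definition affine_ode_sol :: "real \<Rightarrow> real \<Rightarrow> real \<Rightarrow> real \<Rightarrow> real" where
  "affine_ode_sol a b z =
     (THE f. f 0 = z \<and> (\<forall>t. (f has_real_derivative a * f t + b) (at t)))"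

lemma affine_ode_ex1:
  "\<exists>!f. f 0 = z \<and> (\<forall>t::real. (f has_real_derivative a * f t + b) (at t))"
proof -
  define g where "g = (\<lambda>t. if a = 0 then z + b * t else (z + b / a) * exp (a * t) - b / a)"
  have g: "g 0 = z \<and> (\<forall>t. (g has_real_derivative a * g t + b) (at t))"
  proof (cases "a = 0")
    case True
    then show ?thesis by (auto simp: g_def intro!: derivative_eq_intros)
  next
    case False
    then show ?thesis
      by (auto simp: g_def field_simps intro!: derivative_eq_intros)
  qed
  have "f = g" if f: "f 0 = z" "\<And>t. (f has_real_derivative a * f t + b) (at t)" for f
  proof
    fix t
    have "((\<lambda>t. (f t - g t) * exp (- (a * t))) has_real_derivative 0) (at s)" for s
      using g f(2)
      by (auto intro!: derivative_eq_intros f(2) g[THEN conjunct2, rule_format]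
               simp: algebra_simps)
    then have "(f t - g t) * exp (- (a * t)) = (f 0 - g 0) * exp (- (a * 0))"
      by (rule DERIV_isconst_all[rule_format, of "\<lambda>t. (f t - g t) * exp (- (a * t))"])
    then show "f t = g t" using f(1) g by simp
  qed
  with g show ?thesis by blast
qed

definition x_path :: "real \<Rightarrow> real \<Rightarrow> real \<Rightarrow> real \<Rightarrow> real" where
  "x_path lam m t \<phi>0 = affine_ode_sol (lam + 1) (lam * (1 - m) / sqrt 2) \<phi>0 t"

definition y_path :: "real \<Rightarrow> real \<Rightarrow> real \<Rightarrow> real \<Rightarrow> real" where
  "y_path lam m t \<phi>1 = affine_ode_sol (lam - 1) (lam * (1 + m) / sqrt 2) \<phi>1 t"

definition flow :: "real \<Rightarrow> real \<Rightarrow> real \<Rightarrow> real \<times> real \<Rightarrow> real \<times> real" where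
  "flow lam m t \<phi> = (x_path lam m t (fst \<phi>), y_path lam m t (snd \<phi>))"

definition jump_map :: "real \<Rightarrow> real \<times> real \<Rightarrow> real \<times> real" where
  "jump_map \<mu> \<phi> = ((1 - 1 / \<mu>) * fst \<phi>, (1 + 1 / \<mu>) * snd \<phi>)"

text \<open>The value of the process at \<open>\<sigma> n\<close>. Since \<open>flow\<close> is continuous in time, the left limit at
  \<open>\<sigma> (Suc n)\<close> is obtained by running the flow for the time \<open>\<sigma> (Suc n) - \<sigma> n\<close>.\<close>

primrec Phi_at_jump ::
  "real \<Rightarrow> real \<Rightarrow> real \<Rightarrow> (nat \<Rightarrow> 'a \<Rightarrow> real) \<Rightarrow> real \<times> real \<Rightarrow> nat \<Rightarrow> 'a \<Rightarrow> real \<times> real" where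
  "Phi_at_jump lam \<mu> m \<sigma> \<phi> 0 \<omega> = \<phi>"
| "Phi_at_jump lam \<mu> m \<sigma> \<phi> (Suc n) \<omega> =
     jump_map \<mu> (flow lam m (\<sigma> (Suc n) \<omega> - \<sigma> n \<omega>) (Phi_at_jump lam \<mu> m \<sigma> \<phi> n \<omega>))"

text \<open>For \<open>t \<ge> 0\<close>, \<open>N t \<omega>\<close> is the index \<open>n\<close> with \<open>\<sigma> n \<omega> \<le> t < \<sigma> (Suc n) \<omega>\<close>.\<close>

definition Phi ::
  "real \<Rightarrow> real \<Rightarrow> real \<Rightarrow> (real \<Rightarrow> 'a \<Rightarrow> nat) \<Rightarrow> (nat \<Rightarrow> 'a \<Rightarrow> real) \<Rightarrow> real \<times> real \<Rightarrow>
   real \<Rightarrow> 'a \<Rightarrow> real \<times> real" where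
  "Phi lam \<mu> m N \<sigma> \<phi> t \<omega> =
     (let n = N t \<omega> in flow lam m (t - \<sigma> n \<omega>) (Phi_at_jump lam \<mu> m \<sigma> \<phi> n \<omega>))"

definition running_cost :: "real \<Rightarrow> real \<Rightarrow> real \<times> real \<Rightarrow> real" where
  "running_cost lam c \<phi> = fst \<phi> + snd \<phi> - lam / c * sqrt 2"

text \<open>The integral of an extended real function as the difference of the integrals of its
  positive and its negative part. It is needed in the value function, where the integral up
  to \<open>\<tau>\<close> and its expectation can be \<open>+\<infinity>\<close> (for instance, for \<open>\<tau> = \<infinity>\<close>), and the Bochner integral
  would then be \<open>0\<close>. The negative part of \<open>exp (- lam * t) * running_cost lam c (\<dots>)\<close> has a
  finite integral over \<open>[0, \<infinity>)\<close>, hence no difference \<open>\<infinity> - \<infinity>\<close> occurs.\<close>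

definition ext_integral :: "'a measure \<Rightarrow> ('a \<Rightarrow> ereal) \<Rightarrow> ereal" where
  "ext_integral M f =
     enn2ereal (\<integral>\<^sup>+x. e2ennreal (f x) \<partial>M) - enn2ereal (\<integral>\<^sup>+x. e2ennreal (- f x) \<partial>M)"

definition expected_cost ::
  "real \<Rightarrow> real \<Rightarrow> real \<Rightarrow> real \<Rightarrow> 'a measure \<Rightarrow> (real \<Rightarrow> 'a \<Rightarrow> nat) \<Rightarrow> (nat \<Rightarrow> 'a \<Rightarrow> real) \<Rightarrow>
   ('a \<Rightarrow> ennreal) \<Rightarrow> real \<times> real \<Rightarrow> ereal" where
  "expected_cost lam \<mu> c m M N \<sigma> \<tau> \<phi> =
     ext_integral M (\<lambda>\<omega>. ext_integral lborel (\<lambda>t.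
       ereal (indicator {t. 0 \<le> t \<and> ennreal t \<le> \<tau> \<omega>} t
              * (exp (- lam * t) * running_cost lam c (Phi lam \<mu> m N \<sigma> \<phi> t \<omega>)))))"

definition value_fun ::
  "real \<Rightarrow> real \<Rightarrow> real \<Rightarrow> real \<Rightarrow> 'a measure \<Rightarrow> (real \<Rightarrow> 'a \<Rightarrow> nat) \<Rightarrow> (nat \<Rightarrow> 'a \<Rightarrow> real) \<Rightarrow>
   real \<times> real \<Rightarrow> ereal" where
  "value_fun lam \<mu> c m M N \<sigma> \<phi> =
     (INF \<tau>\<in>stopping_times M N. expected_cost lam \<mu> c m M N \<sigma> \<tau> \<phi>)"

text \<open>In contrast to the value function, the integrals below are finite, because for \<open>\<mu> > 1\<close>
  the time integral over \<open>[0, \<sigma> 1]\<close> has a finite expectation; so the Bochner integral applies.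
  For bounded \<open>w\<close>, the real infimum is over a nonempty set which is bounded below.\<close>

definition J_op ::
  "real \<Rightarrow> real \<Rightarrow> real \<Rightarrow> real \<Rightarrow> 'a measure \<Rightarrow> (real \<Rightarrow> 'a \<Rightarrow> nat) \<Rightarrow> (nat \<Rightarrow> 'a \<Rightarrow> real) \<Rightarrow>
   (real \<times> real \<Rightarrow> real) \<Rightarrow> ennreal \<Rightarrow> real \<times> real \<Rightarrow> real" where
  "J_op lam \<mu> c m M N \<sigma> w t \<phi> =
     (\<integral>\<omega>. (LINT u:{u. 0 \<le> u \<and> ennreal u \<le> min t (ennreal (\<sigma> 1 \<omega>))}|lborel.
              exp (- lam * u) * running_cost lam c (Phi lam \<mu> m N \<sigma> \<phi> u \<omega>))
          + (if ennreal (\<sigma> 1 \<omega>) \<le> t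
             then exp (- lam * \<sigma> 1 \<omega>) * w (Phi lam \<mu> m N \<sigma> \<phi> (\<sigma> 1 \<omega>) \<omega>) else 0) \<partial>M)"

definition J_inf ::
  "real \<Rightarrow> real \<Rightarrow> real \<Rightarrow> real \<Rightarrow> 'a measure \<Rightarrow> (real \<Rightarrow> 'a \<Rightarrow> nat) \<Rightarrow> (nat \<Rightarrow> 'a \<Rightarrow> real) \<Rightarrow>
   ennreal \<Rightarrow> (real \<times> real \<Rightarrow> real) \<Rightarrow> real \<times> real \<Rightarrow> real" where
  "J_inf lam \<mu> c m M N \<sigma> t w \<phi> = (INF u\<in>{t..}. J_op lam \<mu> c m M N \<sigma> w u \<phi>)"

primrec v_seq ::
  "real \<Rightarrow> real \<Rightarrow> real \<Rightarrow> real \<Rightarrow> 'a measure \<Rightarrow> (real \<Rightarrow> 'a \<Rightarrow> nat) \<Rightarrow> (nat \<Rightarrow> 'a \<Rightarrow> real) \<Rightarrow>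
   nat \<Rightarrow> real \<times> real \<Rightarrow> real" where
  "v_seq lam \<mu> c m M N \<sigma> 0 = (\<lambda>\<phi>. 0)"
| "v_seq lam \<mu> c m M N \<sigma> (Suc n) = J_inf lam \<mu> c m M N \<sigma> 0 (v_seq lam \<mu> c m M N \<sigma> n)"

definition stopping_region_n ::
  "real \<Rightarrow> real \<Rightarrow> real \<Rightarrow> real \<Rightarrow> 'a measure \<Rightarrow> (real \<Rightarrow> 'a \<Rightarrow> nat) \<Rightarrow> (nat \<Rightarrow> 'a \<Rightarrow> real) \<Rightarrow>
   nat \<Rightarrow> (real \<times> real) set" where
  "stopping_region_n lam \<mu> c m M N \<sigma> n =
     {\<phi> \<in> {0..} \<times> {0..}. v_seq lam \<mu> c m M N \<sigma> n \<phi> = 0}"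

definition stopping_region ::
  "real \<Rightarrow> real \<Rightarrow> real \<Rightarrow> real \<Rightarrow> 'a measure \<Rightarrow> (real \<Rightarrow> 'a \<Rightarrow> nat) \<Rightarrow> (nat \<Rightarrow> 'a \<Rightarrow> real) \<Rightarrow>
   (real \<times> real) set" where
  "stopping_region lam \<mu> c m M N \<sigma> =
     {\<phi> \<in> {0..} \<times> {0..}. value_fun lam \<mu> c m M N \<sigma> \<phi> = 0}"

definition phi_star :: "real \<Rightarrow> real \<Rightarrow> real \<Rightarrow> real \<times> real" where
  "phi_star lam \<mu> c = (THE p. (lam + 1) * fst p + (lam - 1) * snd p + lam * sqrt 2 = 0 \<and>
                            fst p + snd p = (lam + \<mu>) / c * sqrt 2)"

definition t_star :: "real \<Rightarrow> real \<Rightarrow> real \<Rightarrow> real \<Rightarrow> real" where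
  "t_star lam \<mu> c m = (THE t. 0 \<le> t \<and> x_path lam m (- t) (fst (phi_star lam \<mu> c)) = 0)"

definition xi_star :: "real \<Rightarrow> real \<Rightarrow> real \<Rightarrow> real \<Rightarrow> real" where
  "xi_star lam \<mu> c m =
     (if lam \<ge> 1 \<or> lam / (1 - lam) \<ge> (lam + \<mu>) / c then (lam + \<mu>) / c * sqrt 2
      else y_path lam m (- t_star lam \<mu> c m) (snd (phi_star lam \<mu> c)))"

lemma affine_ode_sol_eq:
  assumes "a \<noteq> 0"
  shows "affine_ode_sol a b z t = (z + b / a) * exp (a * t) - b / a"
proof -
  have "affine_ode_sol a b z = (\<lambda>t. (z + b / a) * exp (a * t) - b / a)"
    unfolding affine_ode_sol_def
    by (rule the1_equality[OF affine_ode_ex1])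
       (use assms in \<open>auto simp: field_simps intro!: derivative_eq_intros\<close>)
  then show ?thesis by simp
qed

lemma phi_star_eq:
  "phi_star lam \<mu> c =
     (((1 - lam) * ((lam + \<mu>) / c) - lam) / sqrt 2,
      ((1 + lam) * ((lam + \<mu>) / c) + lam) / sqrt 2)"
proof -
  define k r where "k = (lam + \<mu>) / c" and "r = sqrt 2"
  have r: "r * r = 2" "r > 0" by (auto simp: r_def)
  have r2: "z / r = z * r / 2" for z using r by (simp add: field_simps)
  show ?thesis
    unfolding phi_star_def k_def[symmetric] r_def[symmetric] r2
  proof (rule the_equality)
    show "(lam + 1) * fst (((1 - lam) * k - lam) * r / 2, ((1 + lam) * k + lam) * r / 2) +
        (lam - 1) * snd (((1 - lam) * k - lam) * r / 2, ((1 + lam) * k + lam) * r / 2) + lam * r = 0 \<and>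
        fst (((1 - lam) * k - lam) * r / 2, ((1 + lam) * k + lam) * r / 2) +
        snd (((1 - lam) * k - lam) * r / 2, ((1 + lam) * k + lam) * r / 2) = k * r"
      by (simp add: field_simps)
  next
    fix p :: "real \<times> real"
    assume p: "(lam + 1) * fst p + (lam - 1) * snd p + lam * r = 0 \<and> fst p + snd p = k * r"
    then have q: "snd p = k * r - fst p" by simp
    from p have "2 * fst p = ((1 - lam) * k - lam) * r"
      unfolding q by (simp add: algebra_simps)
    with q show "p = (((1 - lam) * k - lam) * r / 2, ((1 + lam) * k + lam) * r / 2)"
      by (auto simp: prod_eq_iff algebra_simps)
  qed
qed

lemma t_star_ex1:
  assumes "0 < lam" "lam < 1" "m < 1" "lam / (1 - lam) < (lam + \<mu>) / c"
  shows "\<exists>!t. 0 \<le> t \<and> x_path lam m (- t) (fst (phi_star lam \<mu> c)) = 0"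
proof -
  define d where "d = lam * (1 - m) / sqrt 2 / (lam + 1)"
  define z where "z = fst (phi_star lam \<mu> c)"
  have d: "d > 0" using assms by (simp add: d_def)
  have "lam < (1 - lam) * ((lam + \<mu>) / c)"
    using assms by (simp add: pos_divide_less_eq mult.commute)
  then have z: "z > 0" by (simp add: z_def phi_star_eq)
  have eq: "x_path lam m (- t) z = (z + d) * exp (- ((lam + 1) * t)) - d" for t
    using assms by (simp add: x_path_def affine_ode_sol_eq d_def)
  have "x_path lam m (- t) z = 0 \<longleftrightarrow> t = ln ((z + d) / d) / (lam + 1)" for t
  proof -
    have "x_path lam m (- t) z = 0 \<longleftrightarrow> exp ((lam + 1) * t) = (z + d) / d"
    proof -
      define X where "X = (lam + 1) * t"
      have "(z + d) * exp (- X) - d = 0 \<longleftrightarrow> exp X = (z + d) / d"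
        unfolding exp_minus using d exp_gt_zero[of X]
        by (simp add: field_simps del: exp_gt_zero) auto
      then show ?thesis unfolding eq X_def .
    qed
    also have "\<dots> \<longleftrightarrow> (lam + 1) * t = ln ((z + d) / d)"
      using d z by (metis add_pos_pos divide_pos_pos exp_ln ln_exp)
    finally show ?thesis using assms by (auto simp: field_simps)
  qed
  moreover have "0 \<le> ln ((z + d) / d) / (lam + 1)"
    using d z assms by (simp add: field_simps)
  ultimately show ?thesis unfolding z_def[symmetric] by auto
qed

end

theory Submission
  imports Defs
begin

text \<open>
  Adding \<open>b = sqrt 2 / c\<close> to all value functions turns the problem into one with nonnegative
  running cost \<open>\<phi>0 + \<phi>1\<close> and discounted stopping cost \<open>b\<close>, so that every expectation is an
  integral with values in \<open>[0, \<infinity>]\<close> and stopping is optimal where the value equals \<open>b\<close>. The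
  iterates \<open>v n\<close> are concave, Lipschitz and increasing in both coordinates on the quadrant, hence
  their stopping regions are closed, convex and upward closed, which yields the boundary curves.
  A positive lower bound \<open>\<delta>\<close> of the shifted iterates, uniform in \<open>n\<close>, shows that it is optimal to
  stop wherever the flow stays in the half plane \<open>\<phi>0 + \<phi>1 \<ge> k * b - \<mu> * \<delta>\<close>, where \<open>k = lam + \<mu>\<close>.
  From \<open>(0, \<xi>\<^sup>*)\<close> the flow stays even in \<open>\<phi>0 + \<phi>1 \<ge> k * b\<close>, hence the strict inequalities.

  The limit \<open>v\<close> of the iterates agrees with the value function as far as the stopping region is
  concerned. Policies that wait a time depending on the state after the last jump are stopping
  times of nearly optimal cost. Conversely, \<open>exp (- lam * t) * v (\<Phi> t)\<close> plus the accumulated cost is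
  a submartingale. This is applied on a grid of mesh \<open>h\<close>, where it only involves the independence of
  the past from the gaps between later jumps, and \<open>h\<close> tends to \<open>0\<close>; no structure theorem for the
  stopping times is needed.
\<close>

section \<open>Boundary curves of closed convex upward closed regions\<close>

text \<open>Since \<open>lam * b = lam / c * sqrt 2\<close>, the constant part of the running cost,
  discounted up to \<open>\<tau>\<close>, is \<open>b - b * exp (- lam * \<tau>)\<close>; adding
  \<open>b\<close> leaves exactly the discounted stopping cost. The threshold \<open>k * b\<close>
  arises by integrating out the exponential first jump: discount times survival is
  \<open>exp (- k * u)\<close>, a jump at \<open>u\<close> has weight \<open>\<mu>\<close>, so
  waiting at the constant rate \<open>G + \<mu> * w = k * b\<close> costs precisely
  \<open>b\<close>. The value \<open>w\<close> after a jump is at most \<open>b\<close>, hence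
  waiting pays where \<open>G < lam * b\<close>; it is at least \<open>\<delta>\<close>, hence the
  half plane with \<open>k * b - \<mu> * \<delta>\<close>. Two obstacles shape the proof. The
  Lipschitz constants obtained for the iterates grow with \<open>n\<close>, so no regularity of the
  limit \<open>v\<close> is derived; its stopping region inherits closedness and convexity as the
  intersection of those of the iterates. And \<open>\<phi>0\<close> grows at rate
  \<open>lam + 1\<close> against the discount \<open>lam\<close>, so finiteness of costs needs the
  martingale built from \<open>U\<close>, while errors after \<open>n\<close> jumps vanish because
  the expected discount over one gap is \<open>\<mu> / k < 1\<close>.\<close>

definition upper_region :: "(real \<times> real) set \<Rightarrow> bool" where
  "upper_region C \<longleftrightarrow> C \<subseteq> {0..} \<times> {0..} \<and> closed C \<and> convex C \<and>
     (\<forall>x y x' y'. (x, y) \<in> C \<longrightarrow> x \<le> x' \<longrightarrow> y \<le> y' \<longrightarrow> (x', y') \<in> C) \<and>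
     (\<exists>y. (0, y) \<in> C) \<and> (\<exists>x. (x, 0) \<in> C)"

text \<open>In an \<open>upper_region\<close>, the point on the vertical axis and upward closure
  make every section over \<open>x \<ge> 0\<close> nonempty, and the quadrant bounds it below. For
  negative \<open>x\<close> the section is empty and the value arbitrary, so all statements restrict
  to \<open>{0..}\<close>.\<close>

definition lower_boundary :: "(real \<times> real) set \<Rightarrow> real \<Rightarrow> real" where
  "lower_boundary C x = Inf {y. (x, y) \<in> C}"

definition boundary_zero :: "(real \<times> real) set \<Rightarrow> real" where
  "boundary_zero C = Inf {x. (x, 0) \<in> C}"

lemma upper_regionD:
  assumes "upper_region C"
  shows "(x, y) \<in> C \<Longrightarrow> 0 \<le> x" "(x, y) \<in> C \<Longrightarrow> 0 \<le> y" "closed C" "convex C"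
    "(x, y) \<in> C \<Longrightarrow> x \<le> x' \<Longrightarrow> y \<le> y' \<Longrightarrow> (x', y') \<in> C"
  using assms unfolding upper_region_def by auto

text \<open>The section over \<open>x\<close> is closed, so its infimum is attained; upward closure
  adds everything above it.\<close>

lemma lower_boundary_iff:
  assumes C: "upper_region C" and x: "0 \<le> x"
  shows "(x, y) \<in> C \<longleftrightarrow> lower_boundary C x \<le> y"
proof -
  let ?A = "{y. (x, y) \<in> C}"
  obtain y0 where "(0, y0) \<in> C"
    using C unfolding upper_region_def by blast
  then have "y0 \<in> ?A"
    using upper_regionD(5)[OF C, of 0 y0 x y0] x by simp
  then have ne: "?A \<noteq> {}" by blast
  have bdd: "bdd_below ?A"
    using upper_regionD(2)[OF C] by (auto intro!: bdd_belowI[of _ 0])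
  have "closed ((\<lambda>y. (x, y)) -` C)"
    by (intro closed_vimage upper_regionD(3)[OF C] continuous_intros)
  then have cl: "closed ?A" by (simp add: vimage_def)
  have "Inf ?A \<in> ?A" using closed_contains_Inf[OF ne bdd cl] .
  then have "(x, lower_boundary C x) \<in> C" by (simp add: lower_boundary_def)
  then have "(x, y) \<in> C" if "lower_boundary C x \<le> y"
    using upper_regionD(5)[OF C, of x _ x y] that by blast
  moreover have "lower_boundary C x \<le> y" if "(x, y) \<in> C"
    unfolding lower_boundary_def using that by (intro cInf_lower bdd) simp
  ultimately show ?thesis by blast
qed

lemma boundary_zero_iff:
  assumes C: "upper_region C"
  shows "(x, 0) \<in> C \<longleftrightarrow> boundary_zero C \<le> x"
proof -
  let ?A = "{x. (x, 0) \<in> C}"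
  have ne: "?A \<noteq> {}"
    using C unfolding upper_region_def by blast
  have bdd: "bdd_below ?A"
    using upper_regionD(1)[OF C] by (auto intro!: bdd_belowI[of _ 0])
  have "closed ((\<lambda>x. (x, 0)) -` C)"
    by (intro closed_vimage upper_regionD(3)[OF C] continuous_intros)
  then have cl: "closed ?A" by (simp add: vimage_def)
  have "Inf ?A \<in> ?A" using closed_contains_Inf[OF ne bdd cl] .
  then have "(boundary_zero C, 0) \<in> C" by (simp add: boundary_zero_def)
  then have "(x, 0) \<in> C" if "boundary_zero C \<le> x"
    using upper_regionD(5)[OF C, of _ 0 x 0] that by blast
  moreover have "boundary_zero C \<le> x" if "(x, 0) \<in> C"
    unfolding boundary_zero_def using that by (intro cInf_lower bdd) simp
  ultimately show ?thesis by blast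
qed

lemma boundary_zero_nonneg: "upper_region C \<Longrightarrow> 0 \<le> boundary_zero C"
  using boundary_zero_iff[of C "boundary_zero C"] upper_regionD(1) by blast

lemma lower_boundary_nonneg: "upper_region C \<Longrightarrow> 0 \<le> x \<Longrightarrow> 0 \<le> lower_boundary C x"
  using lower_boundary_iff[of C x "lower_boundary C x"] upper_regionD(2) by blast

lemma upper_region_eq:
  assumes C: "upper_region C"
  shows "C = {(x, y). 0 \<le> x \<and> 0 \<le> y \<and> lower_boundary C x \<le> y}"
proof (rule set_eqI)
  fix p :: "real \<times> real"
  show "p \<in> C \<longleftrightarrow> p \<in> {(x, y). 0 \<le> x \<and> 0 \<le> y \<and> lower_boundary C x \<le> y}"
    using lower_boundary_iff[OF C, of "fst p" "snd p"] upper_regionD(1,2)[OF C, of "fst p" "snd p"]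
    by (cases p) auto
qed

lemma lower_boundary_antimono:
  assumes C: "upper_region C"
  shows "antimono_on {0..} (lower_boundary C)"
proof (rule monotone_onI)
  fix x y :: real assume xy: "x \<in> {0..}" "y \<in> {0..}" "x \<le> y"
  then have "(x, lower_boundary C x) \<in> C" using lower_boundary_iff[OF C] by simp
  then have "(y, lower_boundary C x) \<in> C"
    by (rule upper_regionD(5)[OF C _ xy(3) order_refl])
  then show "lower_boundary C y \<le> lower_boundary C x"
    using lower_boundary_iff[OF C] xy by simp
qed

lemma lower_boundary_convex:
  assumes C: "upper_region C"
  shows "convex_on {0..} (lower_boundary C)"
proof (rule convex_onI)
  fix t x y :: real assume t: "0 < t" "t < 1" and x: "x \<in> {0..}" "y \<in> {0..}"
  have "(x, lower_boundary C x) \<in> C" "(y, lower_boundary C y) \<in> C"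
    using lower_boundary_iff[OF C] x by auto
  then have "(1 - t) *\<^sub>R (x, lower_boundary C x) + t *\<^sub>R (y, lower_boundary C y) \<in> C"
    using upper_regionD(4)[OF C] t by (intro convexD) auto
  then show "lower_boundary C ((1 - t) *\<^sub>R x + t *\<^sub>R y)
      \<le> (1 - t) * lower_boundary C x + t * lower_boundary C y"
    using lower_boundary_iff[OF C, of "(1 - t) *\<^sub>R x + t *\<^sub>R y"] t x by auto
qed (simp add: convex_real_interval)

text \<open>Convexity gives continuity on the open half line only; at the endpoint \<open>0\<close>
  a convex function may jump upwards. There closedness of the region and monotonicity take
  over.\<close>

lemma lower_boundary_continuous:
  assumes C: "upper_region C"
  shows "continuous_on {0..} (lower_boundary C)"
proof -
  let ?g = "lower_boundary C"
  have "convex_on {0<..} ?g"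
    by (rule convex_on_subset[OF lower_boundary_convex[OF C]]) (auto simp: convex_real_interval)
  then have pos: "continuous_on {0<..} ?g"
    by (intro convex_on_continuous) auto
  have anti: "?g y \<le> ?g x" if "0 \<le> x" "x \<le> y" for x y
    using lower_boundary_antimono[OF C] that unfolding monotone_on_def by auto
  have zero: "\<exists>d>0. \<forall>x'\<in>{0..}. dist x' 0 < d \<longrightarrow> dist (?g x') (?g 0) < e" if e: "e > 0" for e
  proof -
    \<comment> \<open>Otherwise the points at height \<open>?g 0 - e\<close> over
      \<open>1 / (n + 1)\<close> all lie in \<open>C\<close>, and by closedness so does the one over
      \<open>0\<close>, below the boundary.\<close>
    have "\<exists>x>0. ?g 0 - e < ?g x"
    proof (rule ccontr)
      assume *: "\<not> (\<exists>x>0. ?g 0 - e < ?g x)"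
      have "(1 / real (Suc n), ?g 0 - e) \<in> C" for n
      proof -
        have "?g (1 / real (Suc n)) \<le> ?g 0 - e"
          using * by (meson divide_pos_pos not_less of_nat_0_less_iff zero_less_Suc zero_less_one)
        then show ?thesis by (subst lower_boundary_iff[OF C]) simp_all
      qed
      moreover have "(\<lambda>n. (1 / real (Suc n), ?g 0 - e)) \<longlonglongrightarrow> (0, ?g 0 - e)"
        by (intro tendsto_Pair tendsto_const LIMSEQ_Suc[OF lim_1_over_n])
      ultimately have "(0, ?g 0 - e) \<in> C"
        by (rule closed_sequentially[OF upper_regionD(3)[OF C]])
      then show False using e lower_boundary_iff[OF C, of 0] by auto
    qed
    then obtain x where x: "x > 0" "?g 0 - e < ?g x" by blast
    show ?thesis
    proof (intro exI[of _ x] conjI ballI impI x)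
      fix x' :: real assume "x' \<in> {0..}" "dist x' 0 < x"
      then have "0 \<le> x'" "x' \<le> x" by (auto simp: dist_real_def)
      then show "dist (?g x') (?g 0) < e"
        using anti[of 0 x'] anti[of x' x] x e by (auto simp: dist_real_def)
    qed
  qed
  show ?thesis
    unfolding continuous_on_eq_continuous_within
  proof
    fix x :: real assume "x \<in> {0..}"
    show "continuous (at x within {0..}) ?g"
    proof (cases "x = 0")
      case True
      then show ?thesis using zero by (simp add: continuous_within_eps_delta)
    next
      case False
      then have "isCont ?g x"
        using pos \<open>x \<in> {0..}\<close> by (auto simp: continuous_on_eq_continuous_at)
      then show ?thesis by (rule continuous_at_imp_continuous_at_within)
    qed
  qed
qed

lemma lower_boundary_zero:
  assumes C: "upper_region C" and x: "boundary_zero C \<le> x"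
  shows "lower_boundary C x = 0"
  using boundary_zero_iff[OF C] x lower_boundary_iff[OF C, of x 0]
    boundary_zero_nonneg[OF C] lower_boundary_nonneg[OF C, of x] by auto

text \<open>The boundary is positive at every \<open>x\<close> left of its first zero. By convexity
  its value at \<open>y\<close> is at most that of the chord from \<open>x\<close> to this zero,
  which is strictly smaller than at \<open>x\<close>.\<close>

lemma lower_boundary_strict_antimono:
  assumes C: "upper_region C"
  shows "strict_antimono_on {0..boundary_zero C} (lower_boundary C)"
proof (rule monotone_onI)
  let ?g = "lower_boundary C" and ?z = "boundary_zero C"
  fix x y assume xy: "x \<in> {0..?z}" "y \<in> {0..?z}" "x < y"
  have pos: "0 < ?g x"
    using boundary_zero_iff[OF C, of x] lower_boundary_iff[OF C, of x 0] xy by auto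
  define t where "t = (y - x) / (?z - x)"
  have t: "0 < t" "t \<le> 1" using xy by (auto simp: t_def)
  have "(1 - t) * x + t * ?z = x + t * (?z - x)" by (simp add: algebra_simps)
  also have "\<dots> = y" using xy by (simp add: t_def)
  finally have "?g y \<le> (1 - t) * ?g x + t * ?g ?z"
    using convex_onD[OF lower_boundary_convex[OF C], of t x ?z] t xy by auto
  also have "?g ?z = 0" by (rule lower_boundary_zero[OF C]) simp
  also have "(1 - t) * ?g x + t * 0 < ?g x" using pos t by (simp add: algebra_simps)
  finally show "?g y < ?g x" .
qed

lemma lower_boundary_mono:
  assumes "upper_region C" "upper_region C'" "C' \<subseteq> C" "0 \<le> x"
  shows "lower_boundary C x \<le> lower_boundary C' x"
  using lower_boundary_iff[of C x "lower_boundary C' x"]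
    lower_boundary_iff[of C' x "lower_boundary C' x"] assms by auto

lemma boundary_zero_mono:
  assumes "upper_region C" "upper_region C'" "C' \<subseteq> C"
  shows "boundary_zero C \<le> boundary_zero C'"
  using boundary_zero_iff[of C "boundary_zero C'"]
    boundary_zero_iff[of C' "boundary_zero C'"] assms by auto

text \<open>The supremum of the boundary heights dominates each of them, so this point lies in all
  \<open>C n\<close> and hence in \<open>D\<close>. Nothing is assumed about index \<open>0\<close>,
  so convergence is shown for the sequence shifted by one.\<close>

lemma lower_boundary_tendsto:
  assumes C: "\<And>n. n \<ge> 1 \<Longrightarrow> upper_region (C n)" and D: "upper_region D"
    and dec: "\<And>m n. 1 \<le> m \<Longrightarrow> m \<le> n \<Longrightarrow> C n \<subseteq> C m" and eq: "D = (\<Inter>n\<in>{1..}. C n)"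
    and x: "0 \<le> x"
  shows "(\<lambda>n. lower_boundary (C n) x) \<longlonglongrightarrow> lower_boundary D x"
proof (rule LIMSEQ_offset[where k = 1])
  let ?f = "\<lambda>n. lower_boundary (C (n + 1)) x"
  have inc: "incseq ?f"
    using x by (intro incseq_SucI lower_boundary_mono C dec) auto
  have le: "?f n \<le> lower_boundary D x" for n
    using x eq by (intro lower_boundary_mono C D) auto
  then have bdd: "bdd_above (range ?f)" by (auto intro!: bdd_aboveI)
  have lim: "?f \<longlonglongrightarrow> (SUP n. ?f n)"
    by (rule LIMSEQ_incseq_SUP[OF bdd inc])
  have "(x, SUP n. ?f n) \<in> C n" if "n \<ge> 1" for n
    using lower_boundary_iff[OF C[OF that] x] cSUP_upper[OF UNIV_I bdd, of "n - 1"] that by auto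
  then have "lower_boundary D x \<le> (SUP n. ?f n)"
    using lower_boundary_iff[OF D x] eq by auto
  moreover have "(SUP n. ?f n) \<le> lower_boundary D x"
    using le by (intro cSUP_least) auto
  ultimately show "?f \<longlonglongrightarrow> lower_boundary D x" using lim by simp
qed

section \<open>The deterministic flow\<close>

lemma affine_ode_sol_unique:
  assumes "f 0 = z" "\<And>t. (f has_real_derivative a * f t + b) (at t)"
  shows "affine_ode_sol a b z = f"
  unfolding affine_ode_sol_def by (rule the1_equality[OF affine_ode_ex1]) (use assms in auto)

lemma affine_ode_sol_0 [simp]: "affine_ode_sol a b z 0 = z"
  and affine_ode_sol_deriv: "(affine_ode_sol a b z has_real_derivative a * affine_ode_sol a b z t + b) (at t)"
  using theI'[OF affine_ode_ex1[of z a b]] unfolding affine_ode_sol_def by auto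

lemma affine_ode_sol_linear:
  "affine_ode_sol a b z t = z * exp (a * t) + affine_ode_sol a b 0 t"
proof -
  have "affine_ode_sol a b z = (\<lambda>t. z * exp (a * t) + affine_ode_sol a b 0 t)"
    by (rule affine_ode_sol_unique)
       (auto intro!: derivative_eq_intros affine_ode_sol_deriv simp: algebra_simps)
  then show ?thesis by simp
qed

lemma affine_ode_sol_add:
  "affine_ode_sol a b (affine_ode_sol a b z s) t = affine_ode_sol a b z (s + t)"
proof -
  have "affine_ode_sol a b (affine_ode_sol a b z s) = (\<lambda>t. affine_ode_sol a b z (s + t))"
  proof (rule affine_ode_sol_unique)
    fix t
    show "((\<lambda>t. affine_ode_sol a b z (s + t)) has_real_derivative
        a * affine_ode_sol a b z (s + t) + b) (at t)"
      using affine_ode_sol_deriv[of a b z "t + s"] unfolding DERIV_shift add.commute[of s] .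
  qed simp
  then show ?thesis by simp
qed

lemma affine_ode_sol_continuous: "continuous_on A (affine_ode_sol a b z)"
  by (rule continuous_on_subset[OF _ subset_UNIV])
     (auto intro!: continuous_at_imp_continuous_on DERIV_isCont[OF affine_ode_sol_deriv])

text \<open>After multiplication by the integrating factor \<open>exp (- (a * t))\<close> the
  solution has derivative \<open>b * exp (- (a * t))\<close>, which is nonnegative whatever the sign
  of \<open>a\<close>.\<close>

lemma affine_ode_sol_nonneg:
  assumes "0 \<le> b" "0 \<le> z" "0 \<le> t"
  shows "0 \<le> affine_ode_sol a b z t"
proof -
  let ?f = "\<lambda>t. affine_ode_sol a b z t * exp (- (a * t))"
  have "?f 0 \<le> ?f t"
  proof (rule DERIV_nonneg_imp_nondecreasing[OF assms(3)])
    fix s :: real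
    have "(?f has_real_derivative b * exp (- (a * s))) (at s)"
      by (auto intro!: derivative_eq_intros affine_ode_sol_deriv simp: algebra_simps)
    then show "\<exists>y. (?f has_real_derivative y) (at s) \<and> 0 \<le> y"
      using assms by (intro exI[of _ "b * exp (- (a * s))"]) auto
  qed
  then show ?thesis using assms by (simp add: zero_le_mult_iff) (smt (verit) exp_gt_zero mult_neg_pos)
qed

lemma measurable_fst_borel [measurable (raw)]:
  fixes f :: "'a \<Rightarrow> 'b::second_countable_topology \<times> 'c::second_countable_topology"
  assumes "f \<in> borel_measurable M" shows "(\<lambda>x. fst (f x)) \<in> borel_measurable M"
  using measurable_compose[OF assms borel_measurable_continuous_onI[OF continuous_on_fst[OF continuous_on_id]]] by simp

lemma measurable_snd_borel [measurable (raw)]: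
  fixes f :: "'a \<Rightarrow> 'b::second_countable_topology \<times> 'c::second_countable_topology"
  assumes "f \<in> borel_measurable M" shows "(\<lambda>x. snd (f x)) \<in> borel_measurable M"
  using measurable_compose[OF assms borel_measurable_continuous_onI[OF continuous_on_snd[OF continuous_on_id]]] by simp

locale disorder =
  fixes lam \<mu> c m :: real
  assumes lam: "0 < lam" and mu: "1 < \<mu>" and c: "0 < c" and m: "-1 < m" "m < 1"
begin

definition Q :: "(real \<times> real) set" where "Q = {0..} \<times> {0..}"

lemma Q_iff: "\<phi> \<in> Q \<longleftrightarrow> 0 \<le> fst \<phi> \<and> 0 \<le> snd \<phi>"
  by (auto simp: Q_def mem_Times_iff)

definition fl :: "real \<Rightarrow> real \<times> real \<Rightarrow> real \<times> real" where "fl = flow lam m"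

definition jm :: "real \<times> real \<Rightarrow> real \<times> real" where "jm = jump_map \<mu>"

definition k :: real where "k = lam + \<mu>"

definition b :: real where "b = sqrt 2 / c"

definition G :: "real \<times> real \<Rightarrow> real" where "G \<phi> = fst \<phi> + snd \<phi>"

definition px :: "real \<Rightarrow> real" where "px t = fst (fl t (0, 0))"
definition py :: "real \<Rightarrow> real" where "py t = snd (fl t (0, 0))"

lemma k_pos: "0 < k" and k_gt: "lam + 1 < k" and b_pos: "0 < b" and mu_pos: "0 < \<mu>"
  using lam mu c by (auto simp: k_def b_def)

lemma fl_eq: "fl t \<phi> = (fst \<phi> * exp ((lam + 1) * t) + px t, snd \<phi> * exp ((lam - 1) * t) + py t)"
  unfolding fl_def px_def py_def flow_def x_path_def y_path_def
  by (simp add: affine_ode_sol_linear[of _ _ "fst \<phi>"] affine_ode_sol_linear[of _ _ "snd \<phi>"])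

lemma drift_pos: "0 < lam * (1 - m) / sqrt 2" "0 < lam * (1 + m) / sqrt 2"
  using lam m by auto

lemma fl_0 [simp]: "fl 0 \<phi> = \<phi>"
  by (simp add: fl_def flow_def x_path_def y_path_def)

lemma fl_add: "fl s (fl t \<phi>) = fl (t + s) \<phi>"
  by (simp add: fl_def flow_def x_path_def y_path_def affine_ode_sol_add)

lemma fl_fst_deriv:
  "((\<lambda>t. fst (fl t \<phi>)) has_real_derivative (lam + 1) * fst (fl t \<phi>) + lam * (1 - m) / sqrt 2) (at t)"
  unfolding fl_def flow_def x_path_def by (simp add: affine_ode_sol_deriv)

lemma fl_snd_deriv:
  "((\<lambda>t. snd (fl t \<phi>)) has_real_derivative (lam - 1) * snd (fl t \<phi>) + lam * (1 + m) / sqrt 2) (at t)"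
  unfolding fl_def flow_def y_path_def by (simp add: affine_ode_sol_deriv)

lemma px_nonneg: "0 \<le> t \<Longrightarrow> 0 \<le> px t" and py_nonneg: "0 \<le> t \<Longrightarrow> 0 \<le> py t"
  using drift_pos by (auto simp: px_def py_def fl_def flow_def x_path_def y_path_def
      intro!: affine_ode_sol_nonneg)

lemma px_continuous: "continuous_on A px" and py_continuous: "continuous_on A py"
  unfolding px_def[abs_def] py_def[abs_def] fl_def flow_def x_path_def y_path_def
  by (simp_all add: affine_ode_sol_continuous)

lemma fl_Q: "\<phi> \<in> Q \<Longrightarrow> 0 \<le> t \<Longrightarrow> fl t \<phi> \<in> Q"
  by (auto simp: fl_eq px_nonneg py_nonneg Q_iff intro!: add_nonneg_nonneg mult_nonneg_nonneg)

lemma jm_eq: "jm \<phi> = ((1 - 1 / \<mu>) * fst \<phi>, (1 + 1 / \<mu>) * snd \<phi>)"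
  by (simp add: jm_def jump_map_def)

lemma jm_Q: "\<phi> \<in> Q \<Longrightarrow> jm \<phi> \<in> Q"
  using mu by (auto simp: jm_eq Q_iff)

lemma px_measurable [measurable]: "px \<in> borel_measurable borel"
  and py_measurable [measurable]: "py \<in> borel_measurable borel"
  by (auto intro!: borel_measurable_continuous_onI px_continuous py_continuous)

lemma fl_measurable [measurable (raw)]:
  assumes [measurable]: "f \<in> borel_measurable M" "g \<in> borel_measurable M"
  shows "(\<lambda>x. fl (f x) (g x)) \<in> borel_measurable M"
  unfolding fl_eq by (intro borel_measurable_Pair) measurable

lemma jm_measurable [measurable (raw)]:
  assumes [measurable]: "g \<in> borel_measurable M"
  shows "(\<lambda>x. jm (g x)) \<in> borel_measurable M"
  unfolding jm_eq by (intro borel_measurable_Pair) measurable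

lemma G_measurable [measurable (raw)]:
  assumes [measurable]: "g \<in> borel_measurable M"
  shows "(\<lambda>x. G (g x)) \<in> borel_measurable M"
  unfolding G_def by measurable

lemma G_nonneg: "\<phi> \<in> Q \<Longrightarrow> 0 \<le> G \<phi>"
  by (auto simp: G_def Q_iff)

section \<open>The one-stage operator\<close>

text \<open>The expected discounted cost up to \<open>t\<close> or the first jump, with running cost
  \<open>r\<close> and cost \<open>\<rho> u\<close> for a jump at \<open>u\<close>, after
  integrating out an exponential jump time of rate \<open>\<mu>\<close>; see
  \<open>nn_integral_ex_stage\<close>.\<close>

definition stage :: "(real \<Rightarrow> ennreal) \<Rightarrow> (real \<Rightarrow> ennreal) \<Rightarrow> real \<Rightarrow> ennreal" where
  "stage r \<rho> t = (\<integral>\<^sup>+u\<in>{0..t}. ennreal (exp (- k * u)) * (r u + ennreal \<mu> * \<rho> u) \<partial>lborel)"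

lemma stage_mono:
  assumes "\<And>u. 0 \<le> u \<Longrightarrow> u \<le> t \<Longrightarrow> r u \<le> r' u" "\<And>u. 0 \<le> u \<Longrightarrow> u \<le> t \<Longrightarrow> \<rho> u \<le> \<rho>' u"
  shows "stage r \<rho> t \<le> stage r' \<rho>' t"
  unfolding stage_def
  by (intro nn_integral_mono) (auto split: split_indicator intro!: mult_left_mono add_mono assms)

lemma stage_0 [simp]: "stage r \<rho> 0 = 0"
proof -
  have "stage r \<rho> 0 = (\<integral>\<^sup>+u\<in>{0}. (ennreal (exp (- k * u)) * (r u + ennreal \<mu> * \<rho> u)) \<partial>lborel)"
    by (simp add: stage_def)
  also have "\<dots> = 0"
    by (rule nn_integral_null_set) (simp add: null_sets_def)
  finally show ?thesis .
qed

lemma stage_measurable [measurable (raw)]: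
  assumes [measurable]: "(\<lambda>(x, u). r x u) \<in> borel_measurable (M \<Otimes>\<^sub>M borel)"
    "(\<lambda>(x, u). \<rho> x u) \<in> borel_measurable (M \<Otimes>\<^sub>M borel)" "t \<in> borel_measurable M"
  shows "(\<lambda>x. stage (r x) (\<rho> x) (t x)) \<in> borel_measurable M"
proof -
  have "(\<lambda>x. stage (r x) (\<rho> x) (t x)) = (\<lambda>x. \<integral>\<^sup>+u. ennreal (exp (- k * u)) *
      (r x u + ennreal \<mu> * \<rho> x u) * (if 0 \<le> u \<and> u \<le> t x then 1 else 0) \<partial>lborel)"
    unfolding stage_def by (intro ext nn_integral_cong) (auto split: split_indicator)
  also have "\<dots> \<in> borel_measurable M" by measurable
  finally show ?thesis .
qed

lemma stage_add:
  assumes [measurable]: "r \<in> borel_measurable borel" "\<rho> \<in> borel_measurable borel"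
    "r' \<in> borel_measurable borel" "\<rho>' \<in> borel_measurable borel"
  shows "stage (\<lambda>u. r u + r' u) (\<lambda>u. \<rho> u + \<rho>' u) t = stage r \<rho> t + stage r' \<rho>' t"
proof -
  have "stage (\<lambda>u. r u + r' u) (\<lambda>u. \<rho> u + \<rho>' u) t =
    (\<integral>\<^sup>+u. ennreal (exp (- k * u)) * (r u + ennreal \<mu> * \<rho> u) * indicator {0..t} u +
       ennreal (exp (- k * u)) * (r' u + ennreal \<mu> * \<rho>' u) * indicator {0..t} u \<partial>lborel)"
    unfolding stage_def by (intro nn_integral_cong) (auto simp: algebra_simps)
  also have "\<dots> = stage r \<rho> t + stage r' \<rho>' t"
    unfolding stage_def by (rule nn_integral_add) measurable
  finally show ?thesis .
qed

lemma stage_cmult: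
  assumes [measurable]: "r \<in> borel_measurable borel" "\<rho> \<in> borel_measurable borel"
  shows "stage (\<lambda>u. a * r u) (\<lambda>u. a * \<rho> u) t = a * stage r \<rho> t"
  unfolding stage_def by (subst nn_integral_cmult[symmetric]) (auto simp: algebra_simps)

lemma nn_integral_Icc_split:
  fixes f :: "real \<Rightarrow> ennreal"
  assumes [measurable]: "f \<in> borel_measurable borel" and "0 \<le> h" "0 \<le> t"
  shows "(\<integral>\<^sup>+u\<in>{0..h + t}. f u \<partial>lborel) = (\<integral>\<^sup>+u\<in>{0..h}. f u \<partial>lborel) + (\<integral>\<^sup>+u\<in>{0..t}. f (h + u) \<partial>lborel)"
proof -
  have "(\<integral>\<^sup>+u\<in>{0..h + t}. f u \<partial>lborel) = (\<integral>\<^sup>+u. f u * indicator {0..h} u + f u * indicator {h<..h+t} u \<partial>lborel)"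
    using assms by (intro nn_integral_cong) (auto split: split_indicator)
  also have "\<dots> = (\<integral>\<^sup>+u\<in>{0..h}. f u \<partial>lborel) + (\<integral>\<^sup>+u. f u * indicator {h<..h+t} u \<partial>lborel)"
    by (rule nn_integral_add) measurable
  also have "(\<integral>\<^sup>+u. f u * indicator {h<..h+t} u \<partial>lborel) = (\<integral>\<^sup>+u. f (h + u) * indicator {h<..h+t} (h + u) \<partial>lborel)"
    by (subst nn_integral_real_affine[where c = 1 and t = h]) auto
  also have "\<dots> = (\<integral>\<^sup>+u\<in>{0..t}. f (h + u) \<partial>lborel)"
    by (rule nn_integral_cong_AE, use AE_lborel_singleton[of 0] in eventually_elim)
       (auto split: split_indicator)
  finally show ?thesis .
qed

lemma stage_shift:
  assumes [measurable]: "r \<in> borel_measurable borel" "\<rho> \<in> borel_measurable borel"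
    and "0 \<le> h" "0 \<le> t"
  shows "stage r \<rho> (h + t) =
    stage r \<rho> h + ennreal (exp (- k * h)) * stage (\<lambda>u. r (h + u)) (\<lambda>u. \<rho> (h + u)) t"
proof -
  let ?f = "\<lambda>u. ennreal (exp (- k * u)) * (r u + ennreal \<mu> * \<rho> u)"
  have "stage r \<rho> (h + t) = stage r \<rho> h + (\<integral>\<^sup>+u\<in>{0..t}. ?f (h + u) \<partial>lborel)"
    unfolding stage_def using assms by (intro nn_integral_Icc_split) auto
  also have "(\<integral>\<^sup>+u\<in>{0..t}. ?f (h + u) \<partial>lborel) = (\<integral>\<^sup>+u. ennreal (exp (- k * h)) *
      (ennreal (exp (- k * u)) * (r (h + u) + ennreal \<mu> * \<rho> (h + u)) * indicator {0..t} u) \<partial>lborel)"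
  proof (rule nn_integral_cong)
    fix u :: real
    have e: "ennreal (exp (- k * (h + u))) = ennreal (exp (- k * h)) * ennreal (exp (- k * u))"
      by (simp add: ennreal_mult'[symmetric] exp_add[symmetric] algebra_simps)
    show "?f (h + u) * indicator {0..t} u = ennreal (exp (- k * h)) *
      (ennreal (exp (- k * u)) * (r (h + u) + ennreal \<mu> * \<rho> (h + u)) * indicator {0..t} u)"
      unfolding e by (simp add: mult.assoc)
  qed
  also have "\<dots> = ennreal (exp (- k * h)) * stage (\<lambda>u. r (h + u)) (\<lambda>u. \<rho> (h + u)) t"
    unfolding stage_def by (rule nn_integral_cmult) measurable
  finally show ?thesis .
qed

lemma nn_integral_exp:
  assumes "0 < a" "0 \<le> t"
  shows "(\<integral>\<^sup>+u\<in>{0..t}. ennreal (exp (- a * u)) \<partial>lborel) = ennreal ((1 - exp (- a * t)) / a)"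
proof -
  have "(\<integral>\<^sup>+u\<in>{0..t}. ennreal (exp (- a * u)) \<partial>lborel) = (- exp (- a * t) / a) - (- exp (- a * 0) / a)"
    by (rule nn_integral_FTC_Icc) (use assms in \<open>auto intro!: derivative_eq_intros\<close>)
  then show ?thesis by (simp add: diff_divide_distrib)
qed

lemma stage_const:
  assumes "0 \<le> x" "0 \<le> y" "0 \<le> t"
  shows "stage (\<lambda>_. ennreal x) (\<lambda>_. ennreal y) t = ennreal ((x + \<mu> * y) / k * (1 - exp (- k * t)))"
proof -
  have "stage (\<lambda>_. ennreal x) (\<lambda>_. ennreal y) t =
    (\<integral>\<^sup>+u. ennreal (x + \<mu> * y) * (ennreal (exp (- k * u)) * indicator {0..t} u) \<partial>lborel)"
    unfolding stage_def using assms mu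
    by (intro nn_integral_cong) (auto simp: ennreal_mult' algebra_simps split: split_indicator)
  also have "\<dots> = ennreal (x + \<mu> * y) * ennreal ((1 - exp (- k * t)) / k)"
    by (subst nn_integral_cmult) (use nn_integral_exp[OF k_pos assms(3)] in auto)
  also have "\<dots> = ennreal ((x + \<mu> * y) / k * (1 - exp (- k * t)))"
    using assms mu by (subst ennreal_mult'[symmetric]) auto
  finally show ?thesis .
qed

text \<open>\<open>exp (- lam * t) * U (\<Phi> t)\<close> is a martingale; it supplies all integrability.\<close>

definition U :: "real \<times> real \<Rightarrow> real" where "U \<phi> = G \<phi> + sqrt 2"

lemma U_nonneg: "\<phi> \<in> Q \<Longrightarrow> 0 \<le> U \<phi>"
  by (simp add: U_def G_nonneg)

lemma U_measurable [measurable (raw)]: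
  assumes [measurable]: "g \<in> borel_measurable M"
  shows "(\<lambda>x. U (g x)) \<in> borel_measurable M"
  unfolding U_def by measurable

lemma sqrt2_split: "lam * (1 - m) / sqrt 2 + lam * (1 + m) / sqrt 2 = lam * sqrt 2"
proof -
  have "lam * (1 - m) / sqrt 2 + lam * (1 + m) / sqrt 2 = lam * (2 / sqrt 2)"
    by (simp add: field_simps)
  then show ?thesis by (simp add: real_div_sqrt)
qed

text \<open>The generator maps \<open>U\<close> to \<open>lam * U\<close>: the drift contributes
  \<open>(lam + 1) * fst + (lam - 1) * snd + lam * sqrt 2\<close>, the jumps
  \<open>snd - fst\<close>. This forces the constant \<open>sqrt 2\<close> in
  \<open>U\<close>.\<close>

lemma U_deriv:
  "((\<lambda>t. - (exp (- k * t) * U (fl t \<phi>))) has_real_derivative exp (- k * u) * (\<mu> * U (jm (fl u \<phi>)))) (at u)"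
proof -
  define x' where "x' = (lam + 1) * fst (fl u \<phi>) + lam * (1 - m) / sqrt 2"
  define y' where "y' = (lam - 1) * snd (fl u \<phi>) + lam * (1 + m) / sqrt 2"
  have xy: "x' + y' = (lam + 1) * fst (fl u \<phi>) + (lam - 1) * snd (fl u \<phi>) + lam * sqrt 2"
    unfolding x'_def y'_def using sqrt2_split by simp
  have "\<mu> * U (jm (fl u \<phi>)) = \<mu> * G (fl u \<phi>) + (snd (fl u \<phi>) - fst (fl u \<phi>)) + \<mu> * sqrt 2"
    using mu by (simp add: U_def G_def jm_eq field_simps)
  then have e: "\<mu> * U (jm (fl u \<phi>)) = k * U (fl u \<phi>) - (x' + y')"
    unfolding xy by (simp add: U_def G_def k_def algebra_simps)
  show ?thesis unfolding e unfolding U_def G_def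
    by (auto intro!: derivative_eq_intros fl_fst_deriv[of \<phi> u, folded x'_def]
        fl_snd_deriv[of \<phi> u, folded y'_def] simp: algebra_simps)
qed

text \<open>The martingale identity for \<open>U\<close> up to the minimum of \<open>t\<close> and
  the first jump, obtained from \<open>U_deriv\<close> by the fundamental theorem of
  calculus.\<close>

lemma stage_U:
  assumes "\<phi> \<in> Q" "0 \<le> t"
  shows "stage (\<lambda>_. 0) (\<lambda>u. ennreal (U (jm (fl u \<phi>)))) t + ennreal (exp (- k * t)) * ennreal (U (fl t \<phi>)) = ennreal (U \<phi>)"
proof -
  let ?f = "\<lambda>t. - (exp (- k * t) * U (fl t \<phi>))"
  have pos: "0 \<le> exp (- k * u) * (\<mu> * U (jm (fl u \<phi>)))" if "0 \<le> u" for u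
    using that mu_pos assms by (intro mult_nonneg_nonneg U_nonneg jm_Q fl_Q) auto
  have "stage (\<lambda>_. 0) (\<lambda>u. ennreal (U (jm (fl u \<phi>)))) t =
    (\<integral>\<^sup>+u. ennreal (exp (- k * u) * (\<mu> * U (jm (fl u \<phi>)))) * indicator {0..t} u \<partial>lborel)"
    unfolding stage_def using mu by (intro nn_integral_cong) (auto simp: ennreal_mult' split: split_indicator)
  also have "\<dots> = ennreal (?f t - ?f 0)"
    by (rule nn_integral_FTC_Icc) (use assms pos U_deriv in \<open>auto intro: DERIV_subset\<close>)
  finally have *: "stage (\<lambda>_. 0) (\<lambda>u. ennreal (U (jm (fl u \<phi>)))) t = ennreal (U \<phi> - exp (- k * t) * U (fl t \<phi>))"
    by simp
  have "0 \<le> exp (- k * t) * U (fl t \<phi>)"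
    using assms by (intro mult_nonneg_nonneg U_nonneg fl_Q) auto
  moreover have "?f 0 \<le> ?f t"
    by (rule DERIV_nonneg_imp_nondecreasing[OF assms(2)]) (use U_deriv pos in blast)
  ultimately show ?thesis
    unfolding * by (simp add: ennreal_mult'[symmetric] ennreal_plus[symmetric] del: ennreal_plus)
qed

section \<open>The value iteration\<close>

text \<open>The cost of waiting for the time \<open>t\<close> unless a jump comes first, with value
  \<open>w\<close> after that jump. The last term is the stopping cost \<open>b\<close>, discounted
  and weighted with the probability of no jump before \<open>t\<close>.\<close>

definition F :: "(real \<times> real \<Rightarrow> ennreal) \<Rightarrow> real \<Rightarrow> real \<times> real \<Rightarrow> ennreal" where
  "F w t \<phi> = stage (\<lambda>u. ennreal (G (fl u \<phi>))) (\<lambda>u. w (jm (fl u \<phi>))) t + ennreal (b * exp (- k * t))"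

text \<open>\<open>vh n\<close> is \<open>b\<close> plus the paper's \<open>v\<^sub>n\<close>; the shift makes all costs nonnegative.\<close>

primrec vh :: "nat \<Rightarrow> real \<times> real \<Rightarrow> ennreal" where
  "vh 0 = (\<lambda>_. ennreal b)"
| "vh (Suc n) = (\<lambda>\<phi>. INF t\<in>{0..}. F (vh n) t \<phi>)"

lemma F_measurable [measurable (raw)]:
  assumes [measurable]: "w \<in> borel_measurable borel" "t \<in> borel_measurable M" "f \<in> borel_measurable M"
  shows "(\<lambda>x. F w (t x) (f x)) \<in> borel_measurable M"
  unfolding F_def by measurable

lemma F_mono:
  assumes "\<phi> \<in> Q" "\<And>\<psi>. \<psi> \<in> Q \<Longrightarrow> w \<psi> \<le> w' \<psi>"
  shows "F w t \<phi> \<le> F w' t \<phi>"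
  unfolding F_def by (intro add_mono stage_mono order_refl assms(2) jm_Q fl_Q assms(1))

lemma F_0 [simp]: "F w 0 \<phi> = ennreal b"
  by (simp add: F_def)

lemma vh_le_b: "vh n \<phi> \<le> ennreal b"
  by (cases n) (auto intro!: INF_lower2[of 0])

lemma vh_Suc_le: "\<phi> \<in> Q \<Longrightarrow> vh (Suc n) \<phi> \<le> vh n \<phi>"
proof (induction n arbitrary: \<phi>)
  case 0
  then show ?case using vh_le_b[of "Suc 0"] by simp
next
  case (Suc n)
  show ?case
    unfolding vh.simps(2)[of "Suc n"] vh.simps(2)[of n]
    using F_mono[OF Suc.prems Suc.IH] by (intro INF_mono bexI[of _ t for t]) auto
qed

lemma vh_antimono: "\<phi> \<in> Q \<Longrightarrow> i \<le> j \<Longrightarrow> vh j \<phi> \<le> vh i \<phi>"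
  by (rule lift_Suc_antimono_le[of "\<lambda>n. vh n \<phi>"]) (auto simp del: vh.simps intro: vh_Suc_le)

text \<open>Rational waiting times suffice: a slightly longer wait costs little more. This makes the
  infimum countable, hence the iterates measurable, and later allows a measurable choice of waiting
  times.\<close>

lemma F_near:
  assumes [measurable]: "w \<in> borel_measurable borel" and w: "\<And>\<phi>. w \<phi> \<le> ennreal b"
    and t: "0 \<le> t" and e: "0 < e"
  shows "\<exists>q\<in>\<rat> \<inter> {0..}. F w q \<phi> \<le> F w t \<phi> + ennreal e"
proof -
  have "compact ((\<lambda>u. G (fl (t + u) \<phi>)) ` {0..1})"
    unfolding G_def fl_eq
    by (intro compact_continuous_image)
       (auto intro!: continuous_intros continuous_on_compose2[OF px_continuous[of UNIV]]
         continuous_on_compose2[OF py_continuous[of UNIV]])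
  then have "bdd_above ((\<lambda>u. G (fl (t + u) \<phi>)) ` {0..1})"
    by (intro bounded_imp_bdd_above compact_imp_bounded)
  then obtain C0 where C0: "\<And>u. u \<in> {0..1} \<Longrightarrow> G (fl (t + u) \<phi>) \<le> C0"
    unfolding bdd_above_def by blast
  define C where "C = max C0 0"
  have C: "\<And>u. u \<in> {0..1} \<Longrightarrow> G (fl (t + u) \<phi>) \<le> C" "0 \<le> C"
    using C0 by (auto simp: C_def max.coboundedI1)
  \<comment> \<open>Waiting longer by \<open>h \<le> 1\<close> costs at most
    \<open>(C + \<mu> * b) / k * (1 - exp (- k * h))\<close>, thus at most
    \<open>(C + \<mu> * b) * h\<close>; the added \<open>1\<close> only keeps the denominator
    positive.\<close>
  define d where "d = min 1 (e / (C + \<mu> * b + 1))"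
  have pos: "0 < C + \<mu> * b + 1" using C mu_pos b_pos by (simp add: add_nonneg_pos)
  have "0 < d" using e pos by (simp add: d_def)
  then obtain q where q: "q \<in> \<rat>" "t < q" "q < t + d"
    using Rats_dense_in_real[of t "t + d"] by auto
  define h where "h = q - t"
  have h: "0 \<le> h" "h \<le> 1" "h \<le> e / (C + \<mu> * b + 1)" "q = t + h"
    using q by (auto simp: h_def d_def)
  have "stage (\<lambda>u. ennreal (G (fl (t + u) \<phi>))) (\<lambda>u. w (jm (fl (t + u) \<phi>))) h
      \<le> stage (\<lambda>_. ennreal C) (\<lambda>_. ennreal b) h"
    using C h by (intro stage_mono) (auto intro!: ennreal_leI w)
  also have "\<dots> = ennreal ((C + \<mu> * b) / k * (1 - exp (- k * h)))"
    using C b_pos h by (intro stage_const) auto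
  also have "\<dots> \<le> ennreal e"
  proof (rule ennreal_leI)
    have "1 - exp (- k * h) \<le> k * h" using exp_ge_add_one_self[of "- k * h"] by simp
    then have "(C + \<mu> * b) / k * (1 - exp (- k * h)) \<le> (C + \<mu> * b) / k * (k * h)"
      using C mu_pos b_pos k_pos by (intro mult_left_mono) auto
    also have "\<dots> = (C + \<mu> * b) * h" using k_pos by simp
    also have "\<dots> \<le> (C + \<mu> * b + 1) * h" using h by (simp add: mult_right_mono)
    also have "\<dots> \<le> e" using h(3) pos by (simp add: field_simps)
    finally show "(C + \<mu> * b) / k * (1 - exp (- k * h)) \<le> e" .
  qed
  finally have S: "stage (\<lambda>u. ennreal (G (fl (t + u) \<phi>))) (\<lambda>u. w (jm (fl (t + u) \<phi>))) h \<le> ennreal e" .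
  have "F w q \<phi> = stage (\<lambda>u. ennreal (G (fl u \<phi>))) (\<lambda>u. w (jm (fl u \<phi>))) t +
      ennreal (exp (- k * t)) * stage (\<lambda>u. ennreal (G (fl (t + u) \<phi>))) (\<lambda>u. w (jm (fl (t + u) \<phi>))) h +
      ennreal (b * exp (- k * q))"
    unfolding F_def h(4) using t h by (subst stage_shift) auto
  also have "\<dots> \<le> stage (\<lambda>u. ennreal (G (fl u \<phi>))) (\<lambda>u. w (jm (fl u \<phi>))) t + 1 * ennreal e + ennreal (b * exp (- k * t))"
    using t k_pos b_pos h q
    by (intro add_mono mult_mono S ennreal_leI order_refl) (auto intro!: mult_left_mono ennreal_leI simp flip: ennreal_1)
  also have "\<dots> = F w t \<phi> + ennreal e" by (simp add: F_def ac_simps)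
  finally show ?thesis using q t h by (intro bexI[of _ q]) auto
qed

lemma INF_F_rat:
  assumes [measurable]: "w \<in> borel_measurable borel" and w: "\<And>\<phi>. w \<phi> \<le> ennreal b"
  shows "(INF t\<in>{0..}. F w t \<phi>) = (INF q\<in>\<rat> \<inter> {0..}. F w q \<phi>)"
proof (rule antisym)
  show "(INF q\<in>\<rat> \<inter> {0..}. F w q \<phi>) \<le> (INF t\<in>{0..}. F w t \<phi>)"
  proof (rule INF_greatest)
    fix t :: real assume t: "t \<in> {0..}"
    show "(INF q\<in>\<rat> \<inter> {0..}. F w q \<phi>) \<le> F w t \<phi>"
    proof (rule ennreal_le_epsilon)
      fix e :: real assume "0 < e"
      then obtain q where "q \<in> \<rat> \<inter> {0..}" "F w q \<phi> \<le> F w t \<phi> + ennreal e"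
        using F_near[OF assms, of t e \<phi>] t by auto
      then show "(INF q\<in>\<rat> \<inter> {0..}. F w q \<phi>) \<le> F w t \<phi> + ennreal e"
        by (rule INF_lower2)
    qed
  qed
qed (rule INF_superset_mono, auto)

lemma vh_measurable [measurable]: "vh n \<in> borel_measurable borel"
proof (induction n)
  case (Suc n)
  note Suc [measurable]
  have "countable (\<rat> \<inter> {0::real..})" using countable_rat by (rule countable_subset[rotated]) auto
  then show ?case
    using INF_F_rat[OF Suc vh_le_b] by simp
qed simp

lemma vh_le_F: "0 \<le> t \<Longrightarrow> vh (Suc n) \<phi> \<le> F (vh n) t \<phi>"
  by (auto intro: INF_lower)

lemma fl_mono:
  assumes "fst \<phi> \<le> fst \<psi>" "snd \<phi> \<le> snd \<psi>"
  shows "fst (fl t \<phi>) \<le> fst (fl t \<psi>)" "snd (fl t \<phi>) \<le> snd (fl t \<psi>)"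
  using assms by (simp_all add: fl_eq)

lemma jm_mono:
  assumes "fst \<phi> \<le> fst \<psi>" "snd \<phi> \<le> snd \<psi>"
  shows "fst (jm \<phi>) \<le> fst (jm \<psi>)" "snd (jm \<phi>) \<le> snd (jm \<psi>)"
  using assms mu by (auto simp: jm_eq intro!: mult_left_mono)

lemma vh_mono:
  assumes "fst \<phi> \<le> fst \<psi>" "snd \<phi> \<le> snd \<psi>"
  shows "vh n \<phi> \<le> vh n \<psi>"
  using assms
proof (induction n arbitrary: \<phi> \<psi>)
  case (Suc n)
  show ?case
    unfolding vh.simps F_def
    using Suc.prems
    by (intro INF_mono) (auto intro!: bexI add_mono stage_mono Suc.IH jm_mono fl_mono ennreal_leI simp: G_def)
qed simp

lemma fl_affine: "fl u ((1 - p) *\<^sub>R \<phi> + p *\<^sub>R \<psi>) = (1 - p) *\<^sub>R fl u \<phi> + p *\<^sub>R fl u \<psi>"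
  by (simp add: fl_eq algebra_simps)

lemma jm_affine: "jm ((1 - p) *\<^sub>R \<phi> + p *\<^sub>R \<psi>) = (1 - p) *\<^sub>R jm \<phi> + p *\<^sub>R jm \<psi>"
  by (simp add: jm_eq prod_eq_iff algebra_simps add_divide_distrib[symmetric] flip: diff_divide_distrib)

text \<open>Flow and jump are affine in the state, so for a fixed waiting time \<open>F\<close>
  preserves concavity, and an infimum of concave functions is concave.\<close>

lemma vh_concave:
  assumes "\<phi> \<in> Q" "\<psi> \<in> Q" "0 \<le> p" "p \<le> 1"
  shows "ennreal (1 - p) * vh n \<phi> + ennreal p * vh n \<psi> \<le> vh n ((1 - p) *\<^sub>R \<phi> + p *\<^sub>R \<psi>)"
  using assms(1,2)
proof (induction n arbitrary: \<phi> \<psi>)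
  case 0
  then show ?case using assms(3,4) b_pos
    by (simp add: ennreal_mult'[symmetric] ennreal_plus[symmetric] algebra_simps del: ennreal_plus)
next
  case (Suc n)
  let ?\<theta> = "(1 - p) *\<^sub>R \<phi> + p *\<^sub>R \<psi>"
  show ?case
    unfolding vh.simps(2)
  proof (rule INF_greatest)
    fix t :: real assume t: "t \<in> {0..}"
    have Gu: "ennreal (1 - p) * ennreal (G (fl u \<phi>)) + ennreal p * ennreal (G (fl u \<psi>)) = ennreal (G (fl u ?\<theta>))"
      if "0 \<le> u" for u
    proof -
      have "G (fl u ?\<theta>) = (1 - p) * G (fl u \<phi>) + p * G (fl u \<psi>)"
        unfolding fl_affine by (simp add: G_def algebra_simps)
      then show ?thesis
        using that assms(3,4) G_nonneg[OF fl_Q[OF Suc.prems(1) that]] G_nonneg[OF fl_Q[OF Suc.prems(2) that]]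
        by (simp add: ennreal_mult' ennreal_plus)
    qed
    have bb: "ennreal (1 - p) * ennreal (b * exp (- k * t)) + ennreal p * ennreal (b * exp (- k * t)) = ennreal (b * exp (- k * t))"
      using assms(3,4) b_pos
      by (simp add: ennreal_mult'[symmetric] ennreal_plus[symmetric] algebra_simps del: ennreal_plus)
    have "ennreal (1 - p) * (INF t\<in>{0..}. F (vh n) t \<phi>) + ennreal p * (INF t\<in>{0..}. F (vh n) t \<psi>)
      \<le> ennreal (1 - p) * F (vh n) t \<phi> + ennreal p * F (vh n) t \<psi>"
      using t by (intro add_mono mult_left_mono INF_lower) auto
    also have "\<dots> = (ennreal (1 - p) * stage (\<lambda>u. ennreal (G (fl u \<phi>))) (\<lambda>u. vh n (jm (fl u \<phi>))) t +
        ennreal p * stage (\<lambda>u. ennreal (G (fl u \<psi>))) (\<lambda>u. vh n (jm (fl u \<psi>))) t) +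
        (ennreal (1 - p) * ennreal (b * exp (- k * t)) + ennreal p * ennreal (b * exp (- k * t)))"
      unfolding F_def by (simp only: distrib_left ac_simps)
    also have "\<dots> = stage (\<lambda>u. ennreal (1 - p) * ennreal (G (fl u \<phi>)) + ennreal p * ennreal (G (fl u \<psi>)))
        (\<lambda>u. ennreal (1 - p) * vh n (jm (fl u \<phi>)) + ennreal p * vh n (jm (fl u \<psi>))) t + ennreal (b * exp (- k * t))"
    proof -
      have "stage (\<lambda>u. ennreal q * ennreal (G (fl u \<theta>))) (\<lambda>u. ennreal q * vh n (jm (fl u \<theta>))) t =
          ennreal q * stage (\<lambda>u. ennreal (G (fl u \<theta>))) (\<lambda>u. vh n (jm (fl u \<theta>))) t" for q \<theta>
        by (rule stage_cmult) measurable
      then show ?thesis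
        unfolding bb by (subst stage_add) simp_all
    qed
    also have "\<dots> \<le> F (vh n) t ?\<theta>"
      unfolding F_def
      using Suc.prems t
      by (intro add_mono order_refl stage_mono)
         (auto simp only: Gu fl_affine jm_affine intro!: Suc.IH jm_Q fl_Q)
    finally show "ennreal (1 - p) * (INF t\<in>{0..}. F (vh n) t \<phi>) + ennreal p * (INF t\<in>{0..}. F (vh n) t \<psi>) \<le> F (vh n) t ?\<theta>" .
  qed
qed

text \<open>Upper bounds in nonnegative directions suffice because the iterates are monotone.
  Displacements grow at most like \<open>exp ((lam + 1) * u)\<close> along the flow and by
  \<open>1 + 1 / \<mu>\<close> at a jump; against the weight \<open>exp (- k * u)\<close> there
  remains \<open>exp (- (\<mu> - 1) * u)\<close>, integrable as \<open>\<mu> > 1\<close>.\<close>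

lemma vh_Lipschitz:
  "\<exists>L\<ge>0. \<forall>\<phi>\<in>Q. \<forall>d\<in>Q. vh n (\<phi> + d) \<le> vh n \<phi> + ennreal (L * (fst d + snd d))"
proof (induction n)
  case 0
  show ?case by (auto intro!: exI[of _ 0])
next
  case (Suc n)
  then obtain L where L: "0 \<le> L" "\<And>\<phi> d. \<phi> \<in> Q \<Longrightarrow> d \<in> Q \<Longrightarrow> vh n (\<phi> + d) \<le> vh n \<phi> + ennreal (L * (fst d + snd d))"
    by blast
  \<comment> \<open>The integrand is bounded by \<open>1 + \<mu> * (1 + 1 / \<mu>) * L\<close> times
    \<open>exp (- (\<mu> - 1) * u)\<close>, whose integral is at most
    \<open>1 / (\<mu> - 1)\<close>.\<close>
  define L' where "L' = (1 + (\<mu> + 1) * L) / (\<mu> - 1)"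
  have "0 \<le> L'" using L mu by (simp add: L'_def)
  moreover have "vh (Suc n) (\<phi> + d) \<le> vh (Suc n) \<phi> + ennreal (L' * (fst d + snd d))" if \<phi>: "\<phi> \<in> Q" and d: "d \<in> Q" for \<phi> d
  proof -
    define D where "D = fst d + snd d"
    have D: "0 \<le> D" using d by (auto simp: D_def Q_iff)
    let ?e = "\<lambda>u. D * exp ((lam + 1) * u)"
    have F_le: "F (vh n) t (\<phi> + d) \<le> F (vh n) t \<phi> + ennreal (L' * D)" if t: "0 \<le> t" for t
    proof -
      have 1: "ennreal (G (fl u (\<phi> + d))) \<le> ennreal (G (fl u \<phi>)) + ennreal (?e u)" if u: "0 \<le> u" for u
      proof -
        have "G (fl u (\<phi> + d)) = G (fl u \<phi>) + (fst d * exp ((lam + 1) * u) + snd d * exp ((lam - 1) * u))"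
          by (simp add: G_def fl_eq algebra_simps)
        also have "\<dots> \<le> G (fl u \<phi>) + (fst d * exp ((lam + 1) * u) + snd d * exp ((lam + 1) * u))"
          using d u by (intro add_left_mono add_mono mult_left_mono) (auto simp: Q_iff intro!: mult_right_mono)
        also have "\<dots> = G (fl u \<phi>) + ?e u" by (simp add: D_def algebra_simps)
        finally show ?thesis
          using u G_nonneg[OF fl_Q[OF \<phi> u]] D by (simp add: ennreal_plus[symmetric] ennreal_leI del: ennreal_plus)
      qed
      have 2: "vh n (jm (fl u (\<phi> + d))) \<le> vh n (jm (fl u \<phi>)) + ennreal (L * (1 + 1 / \<mu>) * ?e u)" if u: "0 \<le> u" for u
      proof -
        define d' where "d' = ((1 - 1 / \<mu>) * (fst d * exp ((lam + 1) * u)), (1 + 1 / \<mu>) * (snd d * exp ((lam - 1) * u)))"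
        have d': "d' \<in> Q" using d mu by (auto simp: d'_def Q_iff)
        have eq: "jm (fl u (\<phi> + d)) = jm (fl u \<phi>) + d'"
          by (simp add: jm_eq fl_eq d'_def algebra_simps)
        have "fst d' + snd d' \<le> (1 + 1 / \<mu>) * (fst d * exp ((lam + 1) * u)) + (1 + 1 / \<mu>) * (snd d * exp ((lam + 1) * u))"
          using d mu u unfolding d'_def fst_conv snd_conv
          by (intro add_mono mult_mono) (auto simp: Q_iff intro!: mult_right_mono)
        also have "\<dots> = (1 + 1 / \<mu>) * ?e u" by (simp add: D_def algebra_simps)
        finally have "L * (fst d' + snd d') \<le> L * ((1 + 1 / \<mu>) * ?e u)"
          using L(1) by (rule mult_left_mono)
        then have "ennreal (L * (fst d' + snd d')) \<le> ennreal (L * (1 + 1 / \<mu>) * ?e u)"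
          by (simp add: ennreal_leI mult.assoc)
        then show ?thesis
          unfolding eq using L(2)[OF jm_Q[OF fl_Q[OF \<phi> u]] d'] by (meson add_left_mono order_trans)
      qed
      have "stage (\<lambda>u. ennreal (?e u)) (\<lambda>u. ennreal (L * (1 + 1 / \<mu>) * ?e u)) t
        = (\<integral>\<^sup>+u. ennreal ((1 + (\<mu> + 1) * L) * D) * (ennreal (exp (- (\<mu> - 1) * u)) * indicator {0..t} u) \<partial>lborel)"
        unfolding stage_def
      proof (intro nn_integral_cong)
        fix u
        have "ennreal (exp (- k * u)) * (ennreal (?e u) + ennreal \<mu> * ennreal (L * (1 + 1 / \<mu>) * ?e u))
          = ennreal (exp (- k * u) * (?e u + \<mu> * (L * (1 + 1 / \<mu>) * ?e u)))"
          using D L mu_pos by (simp add: ennreal_mult' ennreal_plus)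
        also have "exp (- k * u) * (?e u + \<mu> * (L * (1 + 1 / \<mu>) * ?e u)) =
            (1 + (\<mu> + 1) * L) * D * (exp (- k * u) * exp ((lam + 1) * u))"
          using mu_pos by (simp add: field_simps)
        also have "exp (- k * u) * exp ((lam + 1) * u) = exp (- (\<mu> - 1) * u)"
          by (simp add: exp_add[symmetric] k_def algebra_simps)
        finally show "ennreal (exp (- k * u)) * (ennreal (?e u) + ennreal \<mu> * ennreal (L * (1 + 1 / \<mu>) * ?e u)) * indicator {0..t} u
           = ennreal ((1 + (\<mu> + 1) * L) * D) * (ennreal (exp (- (\<mu> - 1) * u)) * indicator {0..t} u)"
          using D L mu_pos by (simp add: ennreal_mult' ac_simps)
      qed
      also have "\<dots> = ennreal ((1 + (\<mu> + 1) * L) * D) * ennreal ((1 - exp (- (\<mu> - 1) * t)) / (\<mu> - 1))"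
        using nn_integral_exp[of "\<mu> - 1" t] mu t by (subst nn_integral_cmult) auto
      also have "\<dots> = ennreal (((1 + (\<mu> + 1) * L) * D) * ((1 - exp (- (\<mu> - 1) * t)) / (\<mu> - 1)))"
        using D L(1) mu_pos by (intro ennreal_mult'[symmetric] mult_nonneg_nonneg add_nonneg_nonneg) auto
      also have "\<dots> \<le> ennreal (((1 + (\<mu> + 1) * L) * D) * (1 / (\<mu> - 1)))"
        using D L mu by (intro ennreal_leI mult_left_mono divide_right_mono) auto
      also have "\<dots> = ennreal (L' * D)" by (simp add: L'_def)
      finally have 3: "stage (\<lambda>u. ennreal (?e u)) (\<lambda>u. ennreal (L * (1 + 1 / \<mu>) * ?e u)) t \<le> ennreal (L' * D)" .
      have "stage (\<lambda>u. ennreal (G (fl u (\<phi> + d)))) (\<lambda>u. vh n (jm (fl u (\<phi> + d)))) t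
        \<le> stage (\<lambda>u. ennreal (G (fl u \<phi>)) + ennreal (?e u)) (\<lambda>u. vh n (jm (fl u \<phi>)) + ennreal (L * (1 + 1 / \<mu>) * ?e u)) t"
        by (intro stage_mono 1 2)
      also have "\<dots> = stage (\<lambda>u. ennreal (G (fl u \<phi>))) (\<lambda>u. vh n (jm (fl u \<phi>))) t +
          stage (\<lambda>u. ennreal (?e u)) (\<lambda>u. ennreal (L * (1 + 1 / \<mu>) * ?e u)) t"
        by (rule stage_add) measurable
      also have "\<dots> \<le> stage (\<lambda>u. ennreal (G (fl u \<phi>))) (\<lambda>u. vh n (jm (fl u \<phi>))) t + ennreal (L' * D)"
        by (intro add_left_mono 3)
      finally show ?thesis
        unfolding F_def by (simp add: add.assoc add.commute[of "ennreal (L' * D)"] add_mono)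
    qed
    \<comment> \<open>The constant is moved to the left so that the infimum on the right can be
      bounded termwise.\<close>
    have "vh (Suc n) (\<phi> + d) - ennreal (L' * D) \<le> vh (Suc n) \<phi>"
      unfolding vh.simps(2)[of n]
    proof (rule INF_greatest)
      fix t :: real assume "t \<in> {0..}"
      then have "(INF t\<in>{0..}. F (vh n) t (\<phi> + d)) \<le> F (vh n) t \<phi> + ennreal (L' * D)"
        using F_le by (intro INF_lower2[of t]) auto
      then show "(INF t\<in>{0..}. F (vh n) t (\<phi> + d)) - ennreal (L' * D) \<le> F (vh n) t \<phi>"
        by (subst ennreal_minus_le_iff) (auto simp: ac_simps)
    qed
    then show ?thesis
      unfolding D_def by (subst (asm) ennreal_minus_le_iff) (auto simp: ac_simps)
  qed
  ultimately show ?case by blast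
qed

lemma vh_eq_bI: "ennreal b \<le> vh n \<phi> \<Longrightarrow> vh n \<phi> = ennreal b"
  by (intro antisym vh_le_b)

text \<open>The slack \<open>\<delta>\<close> makes the comparisons with \<open>\<xi>\<^sup>*\<close> strict, also in the limit.\<close>

lemma vh_lower_bound: "\<exists>\<delta>>0. \<delta> \<le> b \<and> (\<forall>n. \<forall>\<phi>\<in>Q. ennreal \<delta> \<le> vh n \<phi>)"
proof -
  define d where "d = lam * (1 - m) / sqrt 2 / (lam + 1)"
  have d: "0 < d" unfolding d_def using lam by (intro divide_pos_pos drift_pos) auto
  have px: "px t = d * (exp ((lam + 1) * t) - 1)" for t
  proof -
    have "px t = affine_ode_sol (lam + 1) (lam * (1 - m) / sqrt 2) 0 t"
      by (simp add: px_def fl_def flow_def x_path_def)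
    also have "\<dots> = (0 + d) * exp ((lam + 1) * t) - d"
      unfolding d_def using lam by (intro affine_ode_sol_eq) simp
    finally show ?thesis by (simp add: algebra_simps)
  qed
  define p where "p = px (1 / 2)"
  have p: "0 < p" using d lam by (simp add: p_def px)
  \<comment> \<open>Stopping before time \<open>1\<close> costs at least
    \<open>b * exp (- k)\<close>. Waiting longer accumulates running cost on
    \<open>{1/2..1}\<close>, where the first coordinate is at least \<open>p\<close> from any
    starting point.\<close>
  define \<delta> where "\<delta> = min (b * exp (- k)) (exp (- k) * p / 2)"
  have \<delta>: "0 < \<delta>" using p b_pos by (simp add: \<delta>_def)
  have \<delta>b: "\<delta> \<le> b"
  proof -
    have "b * exp (- k) \<le> b * 1" using b_pos k_pos by (intro mult_left_mono) auto
    then show ?thesis by (simp add: \<delta>_def)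
  qed
  have "ennreal \<delta> \<le> vh n \<phi>" if \<phi>: "\<phi> \<in> Q" for n \<phi>
  proof (cases n)
    case (Suc n')
    have "ennreal \<delta> \<le> F (vh n') t \<phi>" if t: "0 \<le> t" for t
    proof (cases "t \<le> 1")
      case True
      have "\<delta> \<le> b * exp (- k)" by (simp add: \<delta>_def)
      also have "\<dots> \<le> b * exp (- k * t)"
        using True b_pos k_pos by (auto intro!: mult_left_mono)
      finally have "ennreal \<delta> \<le> ennreal (b * exp (- k * t))" by (rule ennreal_leI)
      then show ?thesis unfolding F_def by (simp add: add_increasing)
    next
      case False
      have "ennreal \<delta> \<le> ennreal (exp (- k) * p) * ennreal (1 / 2)"
        using p by (subst ennreal_mult'[symmetric]) (auto intro!: ennreal_leI simp: \<delta>_def)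
      also have "\<dots> = (\<integral>\<^sup>+u. ennreal (exp (- k) * p) * indicator {1/2..1::real} u \<partial>lborel)"
        by (simp add: nn_integral_cmult)
      also have "\<dots> \<le> stage (\<lambda>u. ennreal (G (fl u \<phi>))) (\<lambda>u. vh n' (jm (fl u \<phi>))) t"
        unfolding stage_def
      proof (intro nn_integral_mono)
        fix u :: real
        have "ennreal (exp (- k) * p) \<le> ennreal (exp (- k * u)) * (ennreal (G (fl u \<phi>)) + ennreal \<mu> * vh n' (jm (fl u \<phi>)))"
          if u: "1/2 \<le> u" "u \<le> 1"
        proof -
          have "p \<le> px u" unfolding p_def px using u d lam by auto
          also have "\<dots> \<le> G (fl u \<phi>)"
            using \<phi> u py_nonneg[of u] by (auto simp: G_def fl_eq Q_iff intro!: add_nonneg_nonneg mult_nonneg_nonneg)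
          finally have "exp (- k) * p \<le> exp (- k * u) * G (fl u \<phi>)"
            using u k_pos p by (intro mult_mono) auto
          then have "ennreal (exp (- k) * p) \<le> ennreal (exp (- k * u)) * ennreal (G (fl u \<phi>))"
            by (simp add: ennreal_mult'[symmetric] ennreal_leI)
          also have "\<dots> \<le> ennreal (exp (- k * u)) * (ennreal (G (fl u \<phi>)) + ennreal \<mu> * vh n' (jm (fl u \<phi>)))"
            by (intro mult_left_mono) auto
          finally show ?thesis .
        qed
        then show "ennreal (exp (- k) * p) * indicator {1/2..1} u \<le>
            ennreal (exp (- k * u)) * (ennreal (G (fl u \<phi>)) + ennreal \<mu> * vh n' (jm (fl u \<phi>))) * indicator {0..t} u"
          using False by (auto split: split_indicator)
      qed
      finally show ?thesis unfolding F_def by (simp add: add_increasing2)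
    qed
    then show ?thesis unfolding Suc by (auto intro!: INF_greatest)
  qed (use \<delta>b in \<open>auto intro: ennreal_leI\<close>)
  with \<delta> \<delta>b show ?thesis by blast
qed

text \<open>Along such a flow the running cost plus \<open>\<mu>\<close> times the post-jump value
  is at least \<open>k * b\<close> at all times, and by \<open>stage_const\<close> even the constant
  rate \<open>k * b\<close> makes every waiting time cost exactly \<open>b\<close>.\<close>

lemma vh_eq_b:
  assumes \<phi>: "\<phi> \<in> Q" and \<delta>: "0 < \<delta>" "\<delta> \<le> b" "\<And>n \<psi>. \<psi> \<in> Q \<Longrightarrow> ennreal \<delta> \<le> vh n \<psi>"
    and ge: "\<And>u. 0 \<le> u \<Longrightarrow> k * b - \<mu> * \<delta> \<le> G (fl u \<phi>)"
  shows "vh n \<phi> = ennreal b"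
proof (cases n)
  case (Suc n')
  have "ennreal b \<le> F (vh n') t \<phi>" if t: "0 \<le> t" for t
  proof -
    have nn: "0 \<le> k * b - \<mu> * \<delta>"
      using \<delta> mu_pos lam b_pos by (simp add: k_def distrib_right add_increasing mult_mono)
    have le: "exp (- k * t) \<le> 1" using t k_pos by simp
    have "b = (k * b - \<mu> * \<delta> + \<mu> * \<delta>) / k * (1 - exp (- k * t)) + b * exp (- k * t)"
      using k_pos by (simp add: field_simps)
    then have "ennreal b = stage (\<lambda>_. ennreal (k * b - \<mu> * \<delta>)) (\<lambda>_. ennreal \<delta>) t + ennreal (b * exp (- k * t))"
      using nn \<delta> t k_pos b_pos le
      by (subst stage_const) (auto simp: ennreal_plus[symmetric] simp del: ennreal_plus)
    also have "\<dots> \<le> F (vh n') t \<phi>"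
      unfolding F_def by (intro add_mono stage_mono order_refl ennreal_leI ge \<delta> jm_Q fl_Q \<phi>)
    finally show ?thesis .
  qed
  then have "ennreal b \<le> vh n \<phi>" unfolding Suc by (auto intro!: INF_greatest)
  then show ?thesis using vh_le_b by (intro antisym)
qed simp

lemma G_fl_continuous: "continuous_on A (\<lambda>u. G (fl u \<phi>))"
  unfolding G_def fl_eq
  by (auto intro!: continuous_intros continuous_on_compose2[OF px_continuous[of UNIV]]
         continuous_on_compose2[OF py_continuous[of UNIV]])

text \<open>Waiting briefly and then stopping costs at a rate below
  \<open>lam * b + \<mu> * b = k * b\<close>, hence less than \<open>b\<close>. This is the origin
  of the lower bound \<open>lam / c * sqrt 2\<close> on the boundaries; one iteration suffices since
  the iterates decrease.\<close>

lemma vh_less_b: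
  assumes \<phi>: "\<phi> \<in> Q" and less: "G \<phi> < lam * b"
  shows "vh (Suc n) \<phi> < ennreal b"
proof -
  define e where "e = (lam * b - G \<phi>) / 2"
  have e: "0 < e" "G \<phi> < lam * b - e" "0 \<le> lam * b - e"
    using less G_nonneg[OF \<phi>] by (auto simp: e_def field_simps)
  have "isCont (\<lambda>u. G (fl u \<phi>)) 0"
    using G_fl_continuous[of UNIV \<phi>] by (simp add: continuous_on_eq_continuous_at)
  then have "eventually (\<lambda>u. G (fl u \<phi>) < lam * b - e) (at 0)"
    using e by (intro order_tendstoD) (auto simp: isCont_def)
  then obtain d where d: "0 < d" "\<And>u. u \<noteq> 0 \<Longrightarrow> dist u 0 < d \<Longrightarrow> G (fl u \<phi>) < lam * b - e"
    unfolding eventually_at by auto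
  define h where "h = d / 2"
  have h: "0 < h" using d by (simp add: h_def)
  have le: "G (fl u \<phi>) \<le> lam * b - e" if "0 \<le> u" "u \<le> h" for u
    using d(2)[of u] that e(2) d(1) by (cases "u = 0") (auto simp: h_def less_imp_le)
  have E: "exp (- k * h) < 1" using h k_pos by simp
  have "vh (Suc n) \<phi> \<le> vh (Suc 0) \<phi>" using \<phi> by (intro vh_antimono) auto
  also have "\<dots> \<le> F (vh 0) h \<phi>" using h by (intro vh_le_F) auto
  also have "\<dots> \<le> stage (\<lambda>_. ennreal (lam * b - e)) (\<lambda>_. ennreal b) h + ennreal (b * exp (- k * h))"
    unfolding F_def by (intro add_mono stage_mono ennreal_leI le) auto
  also have "\<dots> = ennreal ((lam * b - e + \<mu> * b) / k * (1 - exp (- k * h)) + b * exp (- k * h))"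
    using e b_pos h E k_pos mu_pos by (subst stage_const) (auto intro!: ennreal_plus[symmetric])
  also have "\<dots> < ennreal b"
  proof (rule ennreal_lessI[OF b_pos])
    have "(lam * b - e + \<mu> * b) / k = b - e / k"
      using k_pos by (simp add: k_def field_simps)
    then have "(lam * b - e + \<mu> * b) / k * (1 - exp (- k * h)) + b * exp (- k * h) =
        (b - e / k) * (1 - exp (- k * h)) + b * exp (- k * h)" by (rule arg_cong)
    also have "\<dots> = b - e / k * (1 - exp (- k * h))" by (simp only: algebra_simps)
    also have "\<dots> < b" using e k_pos E by simp
    finally show "(lam * b - e + \<mu> * b) / k * (1 - exp (- k * h)) + b * exp (- k * h) < b" .
  qed
  finally show ?thesis .
qed

section \<open>The limit of the value iteration and its dynamic programming inequality\<close>

definition vinf :: "real \<times> real \<Rightarrow> ennreal" where "vinf \<phi> = (INF n. vh n \<phi>)"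

lemma vinf_measurable [measurable]: "vinf \<in> borel_measurable borel"
  unfolding vinf_def[abs_def] by measurable

lemma vinf_le_vh: "vinf \<phi> \<le> vh n \<phi>"
  unfolding vinf_def by (rule INF_lower) simp

lemma vinf_le_b: "vinf \<phi> \<le> ennreal b"
  using vinf_le_vh[of \<phi> 0] by simp

lemma vh_tendsto_vinf: "\<phi> \<in> Q \<Longrightarrow> (\<lambda>n. vh n \<phi>) \<longlonglongrightarrow> vinf \<phi>"
  unfolding vinf_def by (rule LIMSEQ_INF) (auto simp: decseq_def intro: vh_antimono)

text \<open>Since \<open>(\<mu> - 1) * G \<psi> \<le> \<mu> * U (jm \<psi>)\<close>, the running
  cost is dominated by post-jump values of \<open>U\<close>, whose stage \<open>stage_U\<close>
  bounds by \<open>U \<phi>\<close>. The bound does not depend on \<open>t\<close>, so it survives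
  \<open>t\<close> tending to infinity.\<close>

lemma stage_G_le:
  assumes "\<phi> \<in> Q" "0 \<le> t"
  shows "stage (\<lambda>u. ennreal (G (fl u \<phi>))) (\<lambda>_. 0) t \<le> ennreal (U \<phi> / (\<mu> - 1))"
proof -
  have le: "(\<mu> - 1) * G \<psi> \<le> \<mu> * U (jm \<psi>)" if "\<psi> \<in> Q" for \<psi>
  proof -
    have "\<mu> * U (jm \<psi>) = (\<mu> - 1) * G \<psi> + (2 * snd \<psi> + \<mu> * sqrt 2)"
      using mu by (simp add: U_def G_def jm_eq field_simps)
    moreover have "0 \<le> 2 * snd \<psi> + \<mu> * sqrt 2" using that mu_pos by (simp add: Q_iff)
    ultimately show ?thesis by linarith
  qed
  have "stage (\<lambda>u. ennreal (G (fl u \<phi>))) (\<lambda>_. 0) t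
      \<le> stage (\<lambda>u. ennreal (1 / (\<mu> - 1)) * 0) (\<lambda>u. ennreal (1 / (\<mu> - 1)) * ennreal (U (jm (fl u \<phi>)))) t"
    unfolding stage_def
  proof (rule nn_integral_mono)
    fix u
    show "ennreal (exp (- k * u)) * (ennreal (G (fl u \<phi>)) + ennreal \<mu> * 0) * indicator {0..t} u
      \<le> ennreal (exp (- k * u)) * (ennreal (1 / (\<mu> - 1)) * 0 + ennreal \<mu> * (ennreal (1 / (\<mu> - 1)) * ennreal (U (jm (fl u \<phi>))))) * indicator {0..t} u"
    proof (cases "u \<in> {0..t}")
      case True
      then have "ennreal (G (fl u \<phi>)) \<le> ennreal \<mu> * (ennreal (1 / (\<mu> - 1)) * ennreal (U (jm (fl u \<phi>))))"
        using le[OF fl_Q[OF assms(1), of u]] mu by (simp add: ennreal_mult'[symmetric] field_simps ennreal_leI)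
      then show ?thesis by (auto intro!: mult_left_mono mult_right_mono)
    qed simp
  qed
  also have "\<dots> = ennreal (1 / (\<mu> - 1)) * stage (\<lambda>u. 0) (\<lambda>u. ennreal (U (jm (fl u \<phi>)))) t"
    by (rule stage_cmult) measurable
  also have "\<dots> \<le> ennreal (1 / (\<mu> - 1)) * ennreal (U \<phi>)"
    unfolding stage_U[OF assms, symmetric] by (intro mult_left_mono) auto
  also have "\<dots> = ennreal (U \<phi> / (\<mu> - 1))"
    using mu by (simp add: ennreal_mult'[symmetric])
  finally show ?thesis .
qed

lemma stage_G_finite:
  assumes "\<phi> \<in> Q" "0 \<le> t"
  shows "stage (\<lambda>u. ennreal (G (fl u \<phi>))) (\<lambda>_. ennreal b) t < \<infinity>"
proof -
  have "stage (\<lambda>u. ennreal (G (fl u \<phi>)) + 0) (\<lambda>_. 0 + ennreal b) t =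
      stage (\<lambda>u. ennreal (G (fl u \<phi>))) (\<lambda>_. 0) t + stage (\<lambda>_. 0) (\<lambda>_. ennreal b) t"
    by (rule stage_add) measurable
  moreover have "stage (\<lambda>_. ennreal 0) (\<lambda>_. ennreal b) t < \<infinity>"
    using b_pos assms by (subst stage_const) auto
  ultimately show ?thesis
    using stage_G_le[OF assms] by (auto simp: top_unique less_top[symmetric])
qed

lemma F_shift:
  assumes [measurable]: "w \<in> borel_measurable borel" and "0 \<le> h" "0 \<le> t"
  shows "F w (h + t) \<phi> = stage (\<lambda>u. ennreal (G (fl u \<phi>))) (\<lambda>u. w (jm (fl u \<phi>))) h
    + ennreal (exp (- k * h)) * F w t (fl h \<phi>)"
proof -
  have "b * exp (- k * (h + t)) = exp (- k * h) * (b * exp (- k * t))"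
    by (simp add: exp_add[symmetric] algebra_simps)
  then have "ennreal (b * exp (- k * (h + t))) = ennreal (exp (- k * h)) * ennreal (b * exp (- k * t))"
    by (simp only: ennreal_mult' exp_ge_zero)
  then show ?thesis
    unfolding F_def fl_add using assms
    by (subst stage_shift) (simp_all add: distrib_left add.assoc)
qed

text \<open>For the iterates, the wait \<open>h\<close> is prolonged by a nearly optimal wait from
  \<open>fl h \<phi>\<close>. A jump uses up one stage while the passage of time does not, hence
  \<open>vh n\<close> under the integral but \<open>vh (Suc n)\<close> at time \<open>h\<close>;
  dominated convergence removes the mismatch.\<close>

lemma vinf_le_stage:
  assumes \<phi>: "\<phi> \<in> Q" and h: "0 \<le> h"
  shows "vinf \<phi> \<le> stage (\<lambda>u. ennreal (G (fl u \<phi>))) (\<lambda>u. vinf (jm (fl u \<phi>))) h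
    + ennreal (exp (- k * h)) * vinf (fl h \<phi>)"
proof (rule LIMSEQ_le_const)
  let ?X = "\<lambda>n. stage (\<lambda>u. ennreal (G (fl u \<phi>))) (\<lambda>u. vh n (jm (fl u \<phi>))) h
    + ennreal (exp (- k * h)) * vh (Suc n) (fl h \<phi>)"
  have "(\<lambda>n. stage (\<lambda>u. ennreal (G (fl u \<phi>))) (\<lambda>u. vh n (jm (fl u \<phi>))) h) \<longlonglongrightarrow>
      stage (\<lambda>u. ennreal (G (fl u \<phi>))) (\<lambda>u. vinf (jm (fl u \<phi>))) h"
    unfolding stage_def
  proof (rule nn_integral_dominated_convergence[where
        w = "\<lambda>u. ennreal (exp (- k * u)) * (ennreal (G (fl u \<phi>)) + ennreal \<mu> * ennreal b) * indicator {0..h} u"])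
    show "(\<integral>\<^sup>+u\<in>{0..h}. (ennreal (exp (- k * u)) * (ennreal (G (fl u \<phi>)) + ennreal \<mu> * ennreal b)) \<partial>lborel) < \<infinity>"
      using stage_G_finite[OF assms] unfolding stage_def .
    show "AE u in lborel. (\<lambda>n. ennreal (exp (- k * u)) * (ennreal (G (fl u \<phi>)) + ennreal \<mu> * vh n (jm (fl u \<phi>))) * indicator {0..h} u)
      \<longlonglongrightarrow> ennreal (exp (- k * u)) * (ennreal (G (fl u \<phi>)) + ennreal \<mu> * vinf (jm (fl u \<phi>))) * indicator {0..h} u"
    proof (rule AE_I2)
      fix u
      show "(\<lambda>n. ennreal (exp (- k * u)) * (ennreal (G (fl u \<phi>)) + ennreal \<mu> * vh n (jm (fl u \<phi>))) * indicator {0..h} u)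
      \<longlonglongrightarrow> ennreal (exp (- k * u)) * (ennreal (G (fl u \<phi>)) + ennreal \<mu> * vinf (jm (fl u \<phi>))) * indicator {0..h} u"
      proof (cases "u \<in> {0..h}")
        case True
        then have "(\<lambda>n. vh n (jm (fl u \<phi>))) \<longlonglongrightarrow> vinf (jm (fl u \<phi>))"
          by (intro vh_tendsto_vinf jm_Q fl_Q \<phi>) auto
        then show ?thesis using True by (auto intro!: tendsto_intros ennreal_tendsto_cmult)
      qed simp
    qed
  qed (auto intro!: AE_I2 mult_right_mono mult_left_mono add_left_mono vh_le_b)
  moreover have "(\<lambda>n. ennreal (exp (- k * h)) * vh (Suc n) (fl h \<phi>)) \<longlonglongrightarrow> ennreal (exp (- k * h)) * vinf (fl h \<phi>)"
    using vh_tendsto_vinf[OF fl_Q[OF \<phi> h]] by (intro ennreal_tendsto_cmult LIMSEQ_Suc) auto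
  ultimately show "?X \<longlonglongrightarrow> stage (\<lambda>u. ennreal (G (fl u \<phi>))) (\<lambda>u. vinf (jm (fl u \<phi>))) h
    + ennreal (exp (- k * h)) * vinf (fl h \<phi>)"
    by (rule tendsto_add)
  have "vinf \<phi> \<le> ?X n" for n
  proof (rule ennreal_le_epsilon)
    fix e :: real assume e: "0 < e"
    have *: "x < x + ennreal e" if "x \<le> ennreal b" for x
      using that e by (cases x) (auto simp: ennreal_plus[symmetric] ennreal_less_iff top_unique simp del: ennreal_plus)
    have "(INF t\<in>{0..}. F (vh n) t (fl h \<phi>)) < vh (Suc n) (fl h \<phi>) + ennreal e"
      using *[OF vh_le_b[of "Suc n"]] by simp
    then obtain t where t: "0 \<le> t" "F (vh n) t (fl h \<phi>) \<le> vh (Suc n) (fl h \<phi>) + ennreal e"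
      unfolding INF_less_iff by (meson atLeast_iff less_imp_le)
    have "vinf \<phi> \<le> vh (Suc n) \<phi>" by (rule vinf_le_vh)
    also have "\<dots> \<le> F (vh n) (h + t) \<phi>" using h t by (intro vh_le_F) auto
    also have "\<dots> \<le> stage (\<lambda>u. ennreal (G (fl u \<phi>))) (\<lambda>u. vh n (jm (fl u \<phi>))) h
        + ennreal (exp (- k * h)) * (vh (Suc n) (fl h \<phi>) + ennreal e)"
      using h t by (subst F_shift) (auto intro!: add_left_mono mult_left_mono)
    also have "\<dots> \<le> ?X n + ennreal e"
    proof -
      have "ennreal (exp (- k * h)) * ennreal e \<le> 1 * ennreal e"
        using h k_pos by (intro mult_right_mono) (auto simp flip: ennreal_1 intro: ennreal_leI)
      then show ?thesis by (simp add: distrib_left add.assoc[symmetric] add_left_mono del: vh.simps)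
    qed
    finally show "vinf \<phi> \<le> ?X n + ennreal e" .
  qed
  then show "\<exists>N. \<forall>n\<ge>N. vinf \<phi> \<le> ?X n" by blast
qed

section \<open>The stopping regions of the value iteration\<close>

definition \<Gamma>n :: "nat \<Rightarrow> (real \<times> real) set" where "\<Gamma>n n = {\<phi>\<in>Q. vh n \<phi> = ennreal b}"

definition \<Gamma>inf :: "(real \<times> real) set" where "\<Gamma>inf = {\<phi>\<in>Q. vinf \<phi> = ennreal b}"

lemma \<Gamma>n_antimono: "i \<le> j \<Longrightarrow> \<Gamma>n j \<subseteq> \<Gamma>n i"
  unfolding \<Gamma>n_def using vh_le_b[of i] vh_antimono[of _ i j] by (auto intro: antisym) (metis antisym)

lemma \<Gamma>inf_eq: "\<Gamma>inf = (\<Inter>n\<in>{1..}. \<Gamma>n n)"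
proof (intro set_eqI iffI)
  fix \<phi> assume "\<phi> \<in> \<Gamma>inf"
  then have "\<phi> \<in> Q" "ennreal b \<le> vh n \<phi>" for n
    using vinf_le_vh[of \<phi> n] by (auto simp: \<Gamma>inf_def)
  then show "\<phi> \<in> (\<Inter>n\<in>{1..}. \<Gamma>n n)"
    by (auto simp: \<Gamma>n_def intro!: vh_eq_bI)
next
  fix \<phi> assume *: "\<phi> \<in> (\<Inter>n\<in>{1..}. \<Gamma>n n)"
  then have "\<phi> \<in> \<Gamma>n (Suc n)" for n by auto
  moreover have "\<phi> \<in> \<Gamma>n 0" using * \<Gamma>n_antimono[of 0 1] by auto
  ultimately have "\<phi> \<in> \<Gamma>n n" for n by (cases n) auto
  then show "\<phi> \<in> \<Gamma>inf" by (simp add: \<Gamma>n_def \<Gamma>inf_def vinf_def)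
qed

text \<open>If points \<open>f i\<close> of the region tend to \<open>\<phi>\<close>, then
  \<open>f i\<close> lies below \<open>\<phi>\<close> plus the positive parts of
  \<open>f i - \<phi>\<close>; monotonicity and the one-sided Lipschitz bound give
  \<open>b \<le> vh n \<phi>\<close> in the limit.\<close>

lemma closed_\<Gamma>n: "closed (\<Gamma>n n)"
proof -
  obtain L where L: "0 \<le> L" "\<And>\<phi> d. \<phi> \<in> Q \<Longrightarrow> d \<in> Q \<Longrightarrow> vh n (\<phi> + d) \<le> vh n \<phi> + ennreal (L * (fst d + snd d))"
    using vh_Lipschitz by blast
  show ?thesis
    unfolding closed_sequential_limits
  proof (intro allI impI, elim conjE)
    fix f \<phi> assume f: "\<forall>i. f i \<in> \<Gamma>n n" "f \<longlonglongrightarrow> \<phi>"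
    have fQ: "f i \<in> Q" "vh n (f i) = ennreal b" for i using f by (auto simp: \<Gamma>n_def)
    have "closed Q" unfolding Q_def by (intro closed_Times closed_atLeast)
    then have \<phi>: "\<phi> \<in> Q" using f fQ by (auto dest: closed_sequentially)
    let ?d = "\<lambda>i. (max 0 (fst (f i) - fst \<phi>), max 0 (snd (f i) - snd \<phi>))"
    have "ennreal b \<le> vh n \<phi> + ennreal (L * (fst (?d i) + snd (?d i)))" for i
    proof -
      have "ennreal b \<le> vh n (\<phi> + ?d i)"
        unfolding fQ(2)[of i, symmetric] by (intro vh_mono) auto
      also have "\<dots> \<le> vh n \<phi> + ennreal (L * (fst (?d i) + snd (?d i)))"
        by (intro L \<phi>) (simp add: Q_iff)
      finally show ?thesis .
    qed
    moreover have "(\<lambda>i. vh n \<phi> + ennreal (L * (fst (?d i) + snd (?d i)))) \<longlonglongrightarrow> vh n \<phi> + ennreal (L * (fst (max 0 (fst \<phi> - fst \<phi>), max 0 (snd \<phi> - snd \<phi>)) + snd (max 0 (fst \<phi> - fst \<phi>), max 0 (snd \<phi> - snd \<phi>))))"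
      by (intro tendsto_intros f)
    ultimately have "ennreal b \<le> vh n \<phi>"
      by (intro LIMSEQ_le_const) auto
    then show "\<phi> \<in> \<Gamma>n n" using \<phi> by (auto simp: \<Gamma>n_def intro!: vh_eq_bI)
  qed
qed

lemma convex_\<Gamma>n: "convex (\<Gamma>n n)"
  unfolding convex_alt
proof (intro ballI allI impI, elim conjE)
  fix \<phi> \<psi> and p :: real assume *: "\<phi> \<in> \<Gamma>n n" "\<psi> \<in> \<Gamma>n n" "0 \<le> p" "p \<le> 1"
  have "convex Q" unfolding Q_def by (intro convex_Times) (simp_all add: convex_real_interval)
  then have "(1 - p) *\<^sub>R \<phi> + p *\<^sub>R \<psi> \<in> Q"
    using * by (auto simp: \<Gamma>n_def convex_alt)
  moreover have "ennreal b = ennreal (1 - p) * vh n \<phi> + ennreal p * vh n \<psi>"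
    using * b_pos by (simp add: \<Gamma>n_def ennreal_mult'[symmetric] ennreal_plus[symmetric] algebra_simps del: ennreal_plus)
  moreover have "\<dots> \<le> vh n ((1 - p) *\<^sub>R \<phi> + p *\<^sub>R \<psi>)"
    using * by (intro vh_concave) (auto simp: \<Gamma>n_def)
  ultimately have "(1 - p) *\<^sub>R \<phi> + p *\<^sub>R \<psi> \<in> Q" "ennreal b \<le> vh n ((1 - p) *\<^sub>R \<phi> + p *\<^sub>R \<psi>)"
    by simp_all
  then show "(1 - p) *\<^sub>R \<phi> + p *\<^sub>R \<psi> \<in> \<Gamma>n n"
    by (auto simp: \<Gamma>n_def intro!: vh_eq_bI)
qed

lemma \<Gamma>n_upward:
  assumes "(x, y) \<in> \<Gamma>n n" "x \<le> x'" "y \<le> y'"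
  shows "(x', y') \<in> \<Gamma>n n"
  using assms vh_mono[of "(x, y)" "(x', y')" n] vh_le_b[of n "(x', y')"] by (auto simp: \<Gamma>n_def Q_iff)

lemma G_\<Gamma>n: "n \<ge> 1 \<Longrightarrow> \<phi> \<in> \<Gamma>n n \<Longrightarrow> lam * b \<le> G \<phi>"
  using vh_less_b[of \<phi> "n - 1"] unfolding \<Gamma>n_def by (cases n) (auto simp: not_less[symmetric])

section \<open>The derivative \<open>D\<close> of the coordinate sum along the flow, and
  \<open>xi_star\<close>\<close>

definition D :: "real \<times> real \<Rightarrow> real" where
  "D \<phi> = (lam + 1) * fst \<phi> + (lam - 1) * snd \<phi> + lam * sqrt 2"

lemma G_fl_deriv: "((\<lambda>u. G (fl u \<phi>)) has_real_derivative D (fl u \<phi>)) (at u)"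
  unfolding G_def
  by (rule DERIV_cong[OF DERIV_add[OF fl_fst_deriv fl_snd_deriv]])
     (use sqrt2_split in \<open>simp add: D_def\<close>)

text \<open>With the velocities \<open>x'\<close>, \<open>y'\<close> one has
  \<open>D = x' + y'\<close> and \<open>D' = (lam + 1) * x' + (lam - 1) * y'\<close>, so
  \<open>D' - (lam - 1) * D = 2 * x' \<ge> 0\<close>. Hence the sign of \<open>D\<close> changes at
  most once along the flow, from negative to positive.\<close>

lemma D_fl_mono:
  assumes \<phi>: "\<phi> \<in> Q" and u: "0 \<le> u" "u \<le> v"
  shows "D (fl u \<phi>) * exp (- ((lam - 1) * u)) \<le> D (fl v \<phi>) * exp (- ((lam - 1) * v))"
proof (rule DERIV_nonneg_imp_nondecreasing[OF u(2)])
  fix s assume s: "u \<le> s" "s \<le> v"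
  define x' where "x' = (lam + 1) * fst (fl s \<phi>) + lam * (1 - m) / sqrt 2"
  define y' where "y' = (lam - 1) * snd (fl s \<phi>) + lam * (1 + m) / sqrt 2"
  have "D (fl s \<phi>) = x' + y'"
    unfolding x'_def y'_def D_def using sqrt2_split by simp
  have "((\<lambda>s. D (fl s \<phi>) * exp (- ((lam - 1) * s))) has_real_derivative
      ((lam + 1) * x' + (lam - 1) * y') * exp (- ((lam - 1) * s)) +
      - (lam - 1) * exp (- ((lam - 1) * s)) * D (fl s \<phi>)) (at s)"
    unfolding D_def
    by (auto intro!: derivative_eq_intros fl_fst_deriv[of \<phi> s, folded x'_def] fl_snd_deriv[of \<phi> s, folded y'_def])
  also have "((lam + 1) * x' + (lam - 1) * y') * exp (- ((lam - 1) * s)) +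
      - (lam - 1) * exp (- ((lam - 1) * s)) * D (fl s \<phi>) = 2 * x' * exp (- ((lam - 1) * s))"
    unfolding \<open>D (fl s \<phi>) = x' + y'\<close> by (simp add: algebra_simps)
  finally have "((\<lambda>s. D (fl s \<phi>) * exp (- ((lam - 1) * s))) has_real_derivative
      2 * x' * exp (- ((lam - 1) * s))) (at s)" .
  moreover have "0 \<le> x'"
    using fl_Q[OF \<phi>, of s] s u lam drift_pos(1) unfolding x'_def Q_iff by (intro add_nonneg_nonneg) auto
  ultimately show "\<exists>y. ((\<lambda>s. D (fl s \<phi>) * exp (- ((lam - 1) * s))) has_real_derivative y) (at s) \<and> 0 \<le> y"
    by (intro exI[of _ "2 * x' * exp (- ((lam - 1) * s))"]) auto
qed

text \<open>The sum of the coordinates decreases along the flow until it crosses the line \<open>D = 0\<close>,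
  and increases afterwards.\<close>

lemma G_fl_ge_after:
  assumes \<phi>: "\<phi> \<in> Q" and a: "0 \<le> a" "0 \<le> D (fl a \<phi>)" and u: "a \<le> u"
  shows "G (fl a \<phi>) \<le> G (fl u \<phi>)"
proof (rule DERIV_nonneg_imp_nondecreasing[OF u])
  fix s assume "a \<le> s" "s \<le> u"
  have "0 \<le> D (fl a \<phi>) * exp (- ((lam - 1) * a))" using a by simp
  also have "\<dots> \<le> D (fl s \<phi>) * exp (- ((lam - 1) * s))"
    using \<phi> a \<open>a \<le> s\<close> by (intro D_fl_mono)
  finally have "0 \<le> D (fl s \<phi>)" by (simp add: zero_le_mult_iff not_le[symmetric])
  then show "\<exists>y. ((\<lambda>u. G (fl u \<phi>)) has_real_derivative y) (at s) \<and> 0 \<le> y"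
    using G_fl_deriv by blast
qed

lemma G_fl_ge_before:
  assumes \<phi>: "\<phi> \<in> Q" and a: "D (fl a \<phi>) \<le> 0" and u: "0 \<le> u" "u \<le> a"
  shows "G (fl a \<phi>) \<le> G (fl u \<phi>)"
proof (rule DERIV_nonpos_imp_nonincreasing[OF u(2)])
  fix s assume "u \<le> s" "s \<le> a"
  then have "D (fl s \<phi>) * exp (- ((lam - 1) * s)) \<le> D (fl a \<phi>) * exp (- ((lam - 1) * a))"
    using \<phi> u by (intro D_fl_mono) auto
  also have "\<dots> \<le> 0" using a by (simp add: mult_nonpos_nonneg)
  finally have "D (fl s \<phi>) \<le> 0" by (simp add: mult_le_0_iff not_le[symmetric])
  then show "\<exists>y. ((\<lambda>u. G (fl u \<phi>)) has_real_derivative y) (at s) \<and> y \<le> 0"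
    using G_fl_deriv by blast
qed

lemma kb_eq: "k * b = (lam + \<mu>) / c * sqrt 2"
  by (simp add: k_def b_def)

text \<open>The flow from \<open>(0, xi_star)\<close> reaches \<open>phi_star\<close> at time
  \<open>t_star\<close>. There \<open>D = 0\<close> and \<open>G = k * b\<close>, so this is the
  minimum of \<open>G\<close> along the flow.\<close>

lemma xi_star_path:
  assumes "\<not> (lam \<ge> 1 \<or> lam / (1 - lam) \<ge> (lam + \<mu>) / c)"
  shows "0 \<le> xi_star lam \<mu> c m" "\<And>u. 0 \<le> u \<Longrightarrow> k * b \<le> G (fl u (0, xi_star lam \<mu> c m))"
proof -
  let ?\<xi> = "xi_star lam \<mu> c m" and ?p = "phi_star lam \<mu> c" and ?t = "t_star lam \<mu> c m"
  have l1: "lam < 1" and lt: "lam / (1 - lam) < (lam + \<mu>) / c" using assms by auto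
  have t: "0 \<le> ?t" "x_path lam m (- ?t) (fst ?p) = 0"
    using theI'[OF t_star_ex1[OF lam l1 m(2) lt]] unfolding t_star_def by auto
  have \<xi>: "?\<xi> = y_path lam m (- ?t) (snd ?p)"
    using assms unfolding xi_star_def by (simp only: if_False)
  have pstar_back: "fl (- ?t) ?p = (0, ?\<xi>)"
    by (simp add: fl_def flow_def t \<xi>)
  then have pstar_forth: "fl ?t (0, ?\<xi>) = ?p"
    using fl_add[of ?t "- ?t" ?p] by simp
  define K where "K = (lam + \<mu>) / c"
  have Gp: "G ?p = k * b"
    unfolding kb_eq K_def[symmetric] G_def phi_star_eq fst_conv snd_conv
    by (simp add: K_def[symmetric] add_divide_distrib[symmetric] real_div_sqrt algebra_simps)
       (simp add: field_simps)
  have Dp: "D ?p = 0"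
    unfolding D_def phi_star_eq fst_conv snd_conv K_def[symmetric]
    by (simp add: field_simps)
  \<comment> \<open>The equilibrium of the second coordinate, which attracts for
    \<open>lam < 1\<close>. Running backwards from \<open>snd ?p \<ge> d\<close> moves away from it,
    so \<open>xi_star \<ge> d \<ge> 0\<close>.\<close>
  define d where "d = lam * (1 + m) / sqrt 2 / (1 - lam)"
  have xp: "0 \<le> fst ?p"
  proof -
    have "lam < (1 - lam) * K" using lt l1 by (simp add: K_def pos_divide_less_eq mult.commute)
    then show ?thesis by (simp add: phi_star_eq K_def)
  qed
  have dp: "d \<le> snd ?p"
  proof -
    have "(1 - lam) * snd ?p = (lam + 1) * fst ?p + lam * sqrt 2"
      using Dp by (simp add: D_def algebra_simps)
    moreover have "lam * (1 + m) / sqrt 2 \<le> lam * sqrt 2"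
      using sqrt2_split drift_pos by simp
    moreover have "0 \<le> (lam + 1) * fst ?p" using xp lam by simp
    ultimately have "lam * (1 + m) / sqrt 2 \<le> (1 - lam) * snd ?p" by linarith
    moreover have "0 < 1 - lam" using l1 by simp
    ultimately show ?thesis unfolding d_def by (subst pos_divide_le_eq) (simp_all only: mult.commute)
  qed
  have d: "0 \<le> d" unfolding d_def using l1 less_imp_le[OF drift_pos(2)] by (intro divide_nonneg_nonneg[of "lam * (1 + m) / sqrt 2"]) simp_all
  have "?\<xi> = (snd ?p + lam * (1 + m) / sqrt 2 / (lam - 1)) * exp ((lam - 1) * - ?t) - lam * (1 + m) / sqrt 2 / (lam - 1)"
    unfolding \<xi> y_path_def using l1 by (intro affine_ode_sol_eq) simp
  also have "lam * (1 + m) / sqrt 2 / (lam - 1) = - d"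
    unfolding d_def using minus_divide_right[of "lam * (1 + m) / sqrt 2" "1 - lam"] by simp
  finally have "?\<xi> = (snd ?p - d) * exp ((1 - lam) * ?t) + d" by (simp add: algebra_simps)
  then show \<xi>0: "0 \<le> ?\<xi>" using dp d by simp
  then have q: "(0, ?\<xi>) \<in> Q" by (simp add: Q_iff)
  show "k * b \<le> G (fl u (0, ?\<xi>))" if "0 \<le> u" for u
    using G_fl_ge_after[OF q t(1), of u] G_fl_ge_before[OF q, of ?t u] that
    unfolding pstar_forth Gp Dp by (cases "u \<le> ?t") auto
qed

lemma xi_star_ge: "k * b \<le> xi_star lam \<mu> c m"
proof (cases "lam \<ge> 1 \<or> lam / (1 - lam) \<ge> (lam + \<mu>) / c")
  case True
  then show ?thesis by (simp add: xi_star_def kb_eq)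
next
  case False
  from xi_star_path(2)[OF this, of 0] show ?thesis by (simp add: G_def)
qed

text \<open>By the slack \<open>\<mu> * \<delta>\<close> in \<open>vh_eq_b\<close>, \<open>G\<close>
  need not stay above \<open>k * b\<close> but only above \<open>z\<close>; this leaves room to
  start strictly below \<open>xi_star\<close> on either axis, uniformly in the iterates.\<close>

lemma \<Gamma>inf_axes:
  "\<exists>y. y < xi_star lam \<mu> c m \<and> (0, y) \<in> \<Gamma>inf" "\<exists>x. x < xi_star lam \<mu> c m \<and> (x, 0) \<in> \<Gamma>inf"
proof -
  obtain \<delta> where \<delta>: "0 < \<delta>" "\<delta> \<le> b" "\<And>n \<psi>. \<psi> \<in> Q \<Longrightarrow> ennreal \<delta> \<le> vh n \<psi>"
    using vh_lower_bound by blast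
  let ?\<xi> = "xi_star lam \<mu> c m"
  define z where "z = k * b - \<mu> * \<delta>"
  have z: "0 \<le> z"
  proof -
    have "\<mu> * \<delta> \<le> k * b" using \<delta>(1,2) mu_pos lam by (intro mult_mono) (auto simp: k_def)
    then show ?thesis by (simp add: z_def)
  qed
  have "0 < \<mu> * \<delta>" using \<delta>(1) mu_pos by simp
  then have zlt: "z < ?\<xi>" using xi_star_ge by (simp add: z_def)
  have in_\<Gamma>: "\<phi> \<in> \<Gamma>inf" if "\<phi> \<in> Q" "\<And>u. 0 \<le> u \<Longrightarrow> z \<le> G (fl u \<phi>)" for \<phi>
    using vh_eq_b[OF that(1) \<delta>] that unfolding z_def by (simp add: \<Gamma>inf_def vinf_def)
  have "(z, 0) \<in> \<Gamma>inf"
  proof (rule in_\<Gamma>)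
    fix u :: real assume u: "0 \<le> u"
    have "0 \<le> D (fl 0 (z, 0))" using z lam by (simp add: D_def)
    from G_fl_ge_after[OF _ _ this u] z show "z \<le> G (fl u (z, 0))" by (simp add: Q_iff G_def)
  qed (simp add: Q_iff z)
  then show "\<exists>x. x < ?\<xi> \<and> (x, 0) \<in> \<Gamma>inf" using zlt by blast
  show "\<exists>y. y < ?\<xi> \<and> (0, y) \<in> \<Gamma>inf"
  proof (cases "lam \<ge> 1 \<or> lam / (1 - lam) \<ge> (lam + \<mu>) / c")
    case True
    \<comment> \<open>The case condition says that \<open>(0, k * b)\<close> lies on the side
      \<open>D \<ge> 0\<close>; for \<open>lam < 1\<close> moving down to \<open>(0, z)\<close> only
      increases \<open>D\<close>.\<close>
    have Dz: "0 \<le> D (fl 0 (0, z))"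
    proof (cases "lam \<ge> 1")
      case True
      then show ?thesis using z lam by (simp add: D_def)
    next
      case False
      then have "(1 - lam) * ((lam + \<mu>) / c) \<le> lam"
        using True by (simp add: pos_le_divide_eq mult.commute)
      then have "(1 - lam) * ((lam + \<mu>) / c) * sqrt 2 \<le> lam * sqrt 2" by (rule mult_right_mono) simp
      moreover have "(1 - lam) * z \<le> (1 - lam) * (k * b)"
        using False \<open>0 < \<mu> * \<delta>\<close> by (intro mult_left_mono) (auto simp: z_def)
      ultimately show ?thesis unfolding kb_eq by (simp add: D_def algebra_simps)
    qed
    have "(0, z) \<in> \<Gamma>inf"
    proof (rule in_\<Gamma>)
      fix u :: real assume u: "0 \<le> u"
      from G_fl_ge_after[OF _ _ Dz u] z show "z \<le> G (fl u (0, z))" by (simp add: Q_iff G_def)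
    qed (simp add: Q_iff z)
    then show ?thesis using zlt by blast
  next
    case False
    \<comment> \<open>The flows from \<open>(0, y)\<close> and \<open>(0, xi_star)\<close> differ
      only in the second coordinate, by \<open>\<mu> * \<delta> * exp ((lam - 1) * u)\<close>, which
      never exceeds the slack as \<open>lam < 1\<close>.\<close>
    define y where "y = ?\<xi> - \<mu> * \<delta>"
    have y: "0 \<le> y" "y < ?\<xi>"
      using xi_star_ge z \<open>0 < \<mu> * \<delta>\<close> by (auto simp: y_def z_def)
    have "(0, y) \<in> \<Gamma>inf"
    proof (rule in_\<Gamma>)
      fix u :: real assume u: "0 \<le> u"
      have "G (fl u (0, ?\<xi>)) = G (fl u (0, y)) + \<mu> * \<delta> * exp ((lam - 1) * u)"
        by (simp add: G_def fl_eq y_def algebra_simps)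
      moreover have "exp ((lam - 1) * u) \<le> 1" using False u by (auto simp: mult_nonpos_nonneg)
      then have "\<mu> * \<delta> * exp ((lam - 1) * u) \<le> \<mu> * \<delta> * 1" using \<open>0 < \<mu> * \<delta>\<close> by (intro mult_left_mono) auto
      ultimately show "z \<le> G (fl u (0, y))"
        using xi_star_path(2)[OF False u] by (simp add: z_def)
    qed (simp add: Q_iff y)
    then show ?thesis using y by blast
  qed
qed

lemma upper_region_\<Gamma>inf: "upper_region \<Gamma>inf"
  unfolding upper_region_def
proof (intro conjI allI impI)
  show "\<Gamma>inf \<subseteq> {0..} \<times> {0..}" by (auto simp: \<Gamma>inf_def Q_def)
  show "closed \<Gamma>inf" unfolding \<Gamma>inf_eq by (intro closed_INT ballI closed_\<Gamma>n)
  show "convex \<Gamma>inf" unfolding \<Gamma>inf_eq by (intro convex_INT convex_\<Gamma>n)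
  show "\<exists>y. (0, y) \<in> \<Gamma>inf" "\<exists>x. (x, 0) \<in> \<Gamma>inf" using \<Gamma>inf_axes by auto
qed (auto simp: \<Gamma>inf_eq intro: \<Gamma>n_upward)

lemma upper_region_\<Gamma>n:
  assumes "n \<ge> 1"
  shows "upper_region (\<Gamma>n n)"
  unfolding upper_region_def
proof (intro conjI allI impI)
  show "\<Gamma>n n \<subseteq> {0..} \<times> {0..}" by (auto simp: \<Gamma>n_def Q_def)
  have "\<Gamma>inf \<subseteq> \<Gamma>n n" using assms by (auto simp: \<Gamma>inf_eq)
  then show "\<exists>y. (0, y) \<in> \<Gamma>n n" "\<exists>x. (x, 0) \<in> \<Gamma>n n" using \<Gamma>inf_axes by blast+
qed (auto simp: closed_\<Gamma>n convex_\<Gamma>n intro: \<Gamma>n_upward)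

end

section \<open>Paths driven by a sequence of jump times\<close>

definition jump_times :: "(nat \<Rightarrow> real) \<Rightarrow> bool" where
  "jump_times s \<longleftrightarrow> s 0 = 0 \<and> strict_mono s \<and> filterlim s at_top sequentially"

definition jump_count :: "(nat \<Rightarrow> real) \<Rightarrow> real \<Rightarrow> nat" where
  "jump_count s t = card {n. 1 \<le> n \<and> s n \<le> t}"

text \<open>Jumps after \<open>t\<close>, measured from \<open>t\<close>. Index \<open>0\<close> is
  reset so that the result satisfies \<open>jump_times\<close> again.\<close>

definition shift_times :: "real \<Rightarrow> (nat \<Rightarrow> real) \<Rightarrow> nat \<Rightarrow> real" where
  "shift_times t s n = (if n = 0 then 0 else s (jump_count s t + n) - t)"

definition gaps :: "(nat \<Rightarrow> real) \<Rightarrow> nat \<Rightarrow> real" where "gaps s n = s (Suc n) - s n"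

lemma jump_timesD:
  assumes "jump_times s"
  shows "s 0 = 0" "i < j \<Longrightarrow> s i < s j" "s i \<le> s j \<longleftrightarrow> i \<le> j" "s i < s j \<longleftrightarrow> i < j" "0 \<le> s i"
proof -
  have 1: "s 0 = 0" "strict_mono s" using assms by (auto simp: jump_times_def)
  then show "s 0 = 0" "i < j \<Longrightarrow> s i < s j" "s i \<le> s j \<longleftrightarrow> i \<le> j" "s i < s j \<longleftrightarrow> i < j"
    by (auto simp: strict_mono_less strict_mono_less_eq)
  show "0 \<le> s i" using strict_mono_less_eq[OF 1(2), of 0 i] 1(1) by simp
qed

lemma jump_count_eqI:
  assumes s: "jump_times s" and "s n \<le> t" "t < s (Suc n)"
  shows "jump_count s t = n"
proof -
  have "{i. 1 \<le> i \<and> s i \<le> t} = {1..n}"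
  proof (intro set_eqI iffI)
    fix i assume "i \<in> {i. 1 \<le> i \<and> s i \<le> t}"
    then have "s i < s (Suc n)" "1 \<le> i" using assms by auto
    then show "i \<in> {1..n}" using jump_timesD(4)[OF s] by auto
  next
    fix i assume "i \<in> {1..n}"
    then have "s i \<le> s n" "1 \<le> i" using jump_timesD(3)[OF s] by auto
    then show "i \<in> {i. 1 \<le> i \<and> s i \<le> t}" using assms by auto
  qed
  then show ?thesis by (simp add: jump_count_def)
qed

lemma jump_count_bounds:
  assumes s: "jump_times s" and t: "0 \<le> t"
  shows "s (jump_count s t) \<le> t" "t < s (Suc (jump_count s t))"
proof -
  have "eventually (\<lambda>n. t < s n) sequentially"
    using s by (auto simp: jump_times_def filterlim_at_top_dense)
  then have expo: "\<exists>n. t < s n" by (auto simp: eventually_sequentially)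
  define j where "j = (LEAST n. t < s n)"
  have j: "t < s j" unfolding j_def by (rule LeastI_ex[OF expo])
  then obtain n where n: "j = Suc n" using jump_timesD(1)[OF s] t by (cases j) auto
  have "\<not> t < s n" using not_less_Least[of n "\<lambda>n. t < s n"] n by (simp add: j_def)
  then have "s n \<le> t" "t < s (Suc n)" using j n by auto
  with jump_count_eqI[OF s this] show "s (jump_count s t) \<le> t" "t < s (Suc (jump_count s t))" by auto
qed

lemma jump_count_ge_iff:
  assumes s: "jump_times s" and t: "0 \<le> t"
  shows "n \<le> jump_count s t \<longleftrightarrow> s n \<le> t"
proof
  assume "n \<le> jump_count s t"
  then have "s n \<le> s (jump_count s t)" using jump_timesD(3)[OF s] by simp
  then show "s n \<le> t" using jump_count_bounds[OF s t] by simp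
next
  assume "s n \<le> t"
  then have "s n < s (Suc (jump_count s t))" using jump_count_bounds[OF s t] by simp
  then show "n \<le> jump_count s t" using jump_timesD(4)[OF s] by auto
qed

lemma jump_count_neg: "jump_times s \<Longrightarrow> t < 0 \<Longrightarrow> jump_count s t = 0"
  unfolding jump_count_def using jump_timesD(5) by (auto simp: card_eq_0_iff) (meson leD le_less_trans)

lemma jump_times_shift:
  assumes s: "jump_times s" and t: "0 \<le> t"
  shows "jump_times (shift_times t s)"
  unfolding jump_times_def
proof (intro conjI)
  let ?c = "jump_count s t"
  have pos: "t < s (?c + n)" if "0 < n" for n
    using jump_count_bounds(2)[OF s t] jump_timesD(3)[OF s, of "Suc ?c" "?c + n"] that by auto
  show "strict_mono (shift_times t s)"
    by (rule strict_monoI) (use pos jump_timesD(2)[OF s] in \<open>auto simp: shift_times_def\<close>)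
  have "filterlim (\<lambda>n. s (n + ?c)) at_top sequentially"
    using s by (intro filterlim_compose[OF _ filterlim_add_const_nat_at_top]) (auto simp: jump_times_def)
  then have "filterlim (\<lambda>n. - t + s (n + ?c)) at_top sequentially"
    by (rule filterlim_tendsto_add_at_top[OF tendsto_const])
  moreover have "eventually (\<lambda>n. - t + s (n + ?c) = shift_times t s n) sequentially"
    by (intro eventually_sequentiallyI[of 1]) (auto simp: shift_times_def add.commute)
  ultimately show "filterlim (shift_times t s) at_top sequentially"
    using filterlim_cong[OF refl refl] by fast
qed (simp add: shift_times_def)

lemma jump_count_shift:
  assumes s: "jump_times s" and t: "0 \<le> t" and r: "0 \<le> r"
  shows "jump_count s (t + r) = jump_count s t + jump_count (shift_times t s) r"
proof -
  let ?n = "jump_count (shift_times t s) r" and ?c = "jump_count s t"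
  have "shift_times t s ?n \<le> r" "r < shift_times t s (Suc ?n)"
    using jump_count_bounds[OF jump_times_shift[OF s t] r] .
  then have "s (?c + ?n) \<le> t + r" "t + r < s (Suc (?c + ?n))"
    using jump_count_bounds[OF s t] r by (auto simp: shift_times_def split: if_splits)
  then show ?thesis by (rule jump_count_eqI[OF s])
qed

lemma gaps_pos: "jump_times s \<Longrightarrow> 0 < gaps s n"
  using jump_timesD(2)[of s n "Suc n"] by (simp add: gaps_def)

lemma gaps_0: "jump_times s \<Longrightarrow> gaps s 0 = s (Suc 0)"
  by (simp add: gaps_def jump_timesD)

lemma jump_count_first: "jump_times s \<Longrightarrow> jump_count s (s (Suc 0)) = Suc 0"
  by (rule jump_count_eqI) (auto simp: jump_timesD)

lemma gaps_shift_first: "jump_times s \<Longrightarrow> gaps (shift_times (s (Suc 0)) s) = gaps s \<circ> Suc"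
  by (auto simp: gaps_def shift_times_def jump_count_first fun_eq_iff)

lemma gaps_shift_0: "jump_times s \<Longrightarrow> gaps (shift_times 0 s) = gaps s"
  using jump_count_eqI[of s 0 0] jump_timesD(1)[of s] jump_timesD(2)[of s 0 1]
  by (auto simp: gaps_def shift_times_def fun_eq_iff)

lemma jump_count_measurable:
  assumes [measurable]: "\<And>n. (\<lambda>x. s x n) \<in> borel_measurable M" "t \<in> borel_measurable M"
    and s: "\<And>x. x \<in> space M \<Longrightarrow> jump_times (s x)"
  shows "(\<lambda>x. jump_count (s x) (t x)) \<in> measurable M (count_space UNIV)"
proof (subst measurable_count_space_eq2_countable, intro conjI ballI)
  fix n :: nat
  have "(\<lambda>x. jump_count (s x) (t x)) -` {n} \<inter> space M =
    {x\<in>space M. (t x < 0 \<and> n = 0) \<or> (0 \<le> t x \<and> s x n \<le> t x \<and> t x < s x (Suc n))}"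
  proof (intro set_eqI iffI)
    fix x assume x: "x \<in> (\<lambda>x. jump_count (s x) (t x)) -` {n} \<inter> space M"
    then show "x \<in> {x\<in>space M. (t x < 0 \<and> n = 0) \<or> (0 \<le> t x \<and> s x n \<le> t x \<and> t x < s x (Suc n))}"
      using jump_count_bounds[OF s, of x "t x"] jump_count_neg[OF s, of x "t x"]
      by (cases "t x < 0") auto
  next
    fix x assume x: "x \<in> {x\<in>space M. (t x < 0 \<and> n = 0) \<or> (0 \<le> t x \<and> s x n \<le> t x \<and> t x < s x (Suc n))}"
    then show "x \<in> (\<lambda>x. jump_count (s x) (t x)) -` {n} \<inter> space M"
      using jump_count_eqI[OF s, of x n "t x"] jump_count_neg[OF s, of x "t x"] by auto
  qed
  also have "\<dots> \<in> sets M" by measurable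
  finally show "(\<lambda>x. jump_count (s x) (t x)) -` {n} \<inter> space M \<in> sets M" .
qed auto

lemma shift_times_measurable:
  assumes [measurable]: "\<And>n. (\<lambda>x. s x n) \<in> borel_measurable M" "t \<in> borel_measurable M"
    and s: "\<And>x. x \<in> space M \<Longrightarrow> jump_times (s x)"
  shows "(\<lambda>x. shift_times (t x) (s x) n) \<in> borel_measurable M"
proof -
  note jump_count_measurable[OF assms, measurable]
  have [measurable]: "(\<lambda>x. s x (jump_count (s x) (t x) + n)) \<in> borel_measurable M"
    by (rule measurable_compose_countable[where f = "\<lambda>i x. s x (i + n)" and g = "\<lambda>x. jump_count (s x) (t x)"]) measurable
  show ?thesis unfolding shift_times_def by measurable
qed

context disorder begin

primrec Zj :: "real \<times> real \<Rightarrow> (nat \<Rightarrow> real) \<Rightarrow> nat \<Rightarrow> real \<times> real" where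
  "Zj \<phi> s 0 = \<phi>"
| "Zj \<phi> s (Suc n) = jm (fl (s (Suc n) - s n) (Zj \<phi> s n))"

definition path :: "real \<times> real \<Rightarrow> (nat \<Rightarrow> real) \<Rightarrow> real \<Rightarrow> real \<times> real" where
  "path \<phi> s t = fl (t - s (jump_count s t)) (Zj \<phi> s (jump_count s t))"

lemma Zj_Q: "jump_times s \<Longrightarrow> \<phi> \<in> Q \<Longrightarrow> Zj \<phi> s n \<in> Q"
  by (induction n) (auto intro!: jm_Q fl_Q simp: jump_timesD(3))

lemma path_Q: "jump_times s \<Longrightarrow> \<phi> \<in> Q \<Longrightarrow> 0 \<le> t \<Longrightarrow> path \<phi> s t \<in> Q"
  unfolding path_def using jump_count_bounds(1)[of s t] by (intro fl_Q Zj_Q) auto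

lemma path_before_first:
  assumes "jump_times s" "0 \<le> t" "t < s (Suc 0)"
  shows "path \<phi> s t = fl t \<phi>"
  using jump_count_eqI[of s 0 t] assms jump_timesD(1)[of s] by (simp add: path_def)

lemma path_first: "jump_times s \<Longrightarrow> path \<phi> s (s (Suc 0)) = jm (fl (s (Suc 0)) \<phi>)"
  by (simp add: path_def jump_count_first jump_timesD(1))

text \<open>Index \<open>0\<close> is excluded because the shifted sequence starts at
  \<open>t\<close>, which need not be a jump. At the first jump after \<open>t\<close> the two flow
  pieces before and after \<open>t\<close> merge by \<open>fl_add\<close>.\<close>

lemma Zj_shift:
  assumes s: "jump_times s" and t: "0 \<le> t"
  shows "Zj (path \<phi> s t) (shift_times t s) (Suc n) = Zj \<phi> s (jump_count s t + Suc n)"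
proof (induction n)
  case 0
  show ?case by (simp add: shift_times_def path_def fl_add)
next
  case (Suc n)
  show ?case
    unfolding Zj.simps(2)[of _ _ "Suc n"] Suc by (simp add: shift_times_def)
qed

lemma path_shift:
  assumes s: "jump_times s" and t: "0 \<le> t" and r: "0 \<le> r"
  shows "path (path \<phi> s t) (shift_times t s) r = path \<phi> s (t + r)"
proof (cases "jump_count (shift_times t s) r")
  case 0
  then have c: "jump_count s (t + r) = jump_count s t"
    using jump_count_shift[OF assms] by simp
  show ?thesis
    unfolding path_def[of "path \<phi> s t"] 0 unfolding path_def c by (simp add: fl_add shift_times_def algebra_simps)
next
  case (Suc n)
  then have c: "jump_count s (t + r) = jump_count s t + Suc n"
    using jump_count_shift[OF assms] by simp
  show ?thesis
    unfolding path_def[of "path \<phi> s t"] Suc Zj_shift[OF s t] unfolding path_def[of \<phi>] c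
    by (simp add: shift_times_def algebra_simps)
qed

lemma Zj_measurable:
  assumes [measurable]: "\<And>n. (\<lambda>x. s x n) \<in> borel_measurable M" "f \<in> borel_measurable M"
  shows "(\<lambda>x. Zj (f x) (s x) n) \<in> borel_measurable M"
proof (induction n)
  case (Suc n)
  note Suc[measurable]
  show ?case unfolding Zj.simps by measurable
qed simp

lemma path_measurable:
  assumes [measurable]: "\<And>n. (\<lambda>x. s x n) \<in> borel_measurable M" "t \<in> borel_measurable M" "f \<in> borel_measurable M"
    and s: "\<And>x. x \<in> space M \<Longrightarrow> jump_times (s x)"
  shows "(\<lambda>x. path (f x) (s x) (t x)) \<in> borel_measurable M"
proof -
  have 1: "(\<lambda>x. fl (t x - s x n) (Zj (f x) (s x) n)) \<in> borel_measurable M" for n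
  proof -
    have "(\<lambda>x. t x - s x n) \<in> borel_measurable M" using assms(1,2) by (rule borel_measurable_diff[rotated])
    moreover have "(\<lambda>x. Zj (f x) (s x) n) \<in> borel_measurable M"
      by (rule Zj_measurable[OF assms(1,3)])
    ultimately show ?thesis by (rule fl_measurable)
  qed
  have 2: "(\<lambda>x. jump_count (s x) (t x)) \<in> measurable M (count_space UNIV)"
    using assms(1,2) s by (rule jump_count_measurable)
  show ?thesis
    unfolding path_def by (rule measurable_compose_countable[OF 1 2])
qed

definition cost :: "(real \<times> real \<Rightarrow> ennreal) \<Rightarrow> real \<times> real \<Rightarrow> (nat \<Rightarrow> real) \<Rightarrow> real \<Rightarrow> ennreal" where
  "cost r \<phi> s a = (\<integral>\<^sup>+u\<in>{0..a}. ennreal (exp (- lam * u)) * r (path \<phi> s u) \<partial>lborel)"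

lemma path_measurable_time:
  assumes "jump_times s"
  shows "path \<phi> s \<in> borel_measurable borel"
  by (rule path_measurable[where s = "\<lambda>_. s" and t = "\<lambda>t. t" and f = "\<lambda>_. \<phi>"]) (use assms in auto)

lemma cost_tail:
  assumes [measurable]: "r \<in> borel_measurable borel" and s: "jump_times s" and t: "0 \<le> t"
  shows "(\<integral>\<^sup>+u\<in>{0..a}. (ennreal (exp (- lam * (t + u))) * r (path \<phi> s (t + u))) \<partial>lborel) =
    ennreal (exp (- lam * t)) * cost r (path \<phi> s t) (shift_times t s) a"
proof -
  note path_measurable_time[OF jump_times_shift[OF s t], measurable]
  have "(\<integral>\<^sup>+u\<in>{0..a}. (ennreal (exp (- lam * (t + u))) * r (path \<phi> s (t + u))) \<partial>lborel) =
    (\<integral>\<^sup>+u. ennreal (exp (- lam * t)) * (ennreal (exp (- lam * u)) * r (path (path \<phi> s t) (shift_times t s) u) * indicator {0..a} u) \<partial>lborel)"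
  proof (rule nn_integral_cong)
    fix u
    have "ennreal (exp (- lam * (t + u))) = ennreal (exp (- lam * t)) * ennreal (exp (- lam * u))"
      by (simp add: ennreal_mult'[symmetric] exp_add[symmetric] algebra_simps)
    then show "ennreal (exp (- lam * (t + u))) * r (path \<phi> s (t + u)) * indicator {0..a} u =
      ennreal (exp (- lam * t)) * (ennreal (exp (- lam * u)) * r (path (path \<phi> s t) (shift_times t s) u) * indicator {0..a} u)"
      using path_shift[OF s t, of u \<phi>] by (auto split: split_indicator simp: mult.assoc)
  qed
  also have "\<dots> = ennreal (exp (- lam * t)) * cost r (path \<phi> s t) (shift_times t s) a"
    unfolding cost_def by (rule nn_integral_cmult) measurable
  finally show ?thesis .
qed

lemma cost_shift:
  assumes [measurable]: "r \<in> borel_measurable borel" and s: "jump_times s" and t: "0 \<le> t" and a: "0 \<le> a"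
  shows "cost r \<phi> s (t + a) = cost r \<phi> s t + ennreal (exp (- lam * t)) * cost r (path \<phi> s t) (shift_times t s) a"
proof -
  note path_measurable_time[OF s, measurable]
  have "cost r \<phi> s (t + a) = cost r \<phi> s t + (\<integral>\<^sup>+u\<in>{0..a}. (ennreal (exp (- lam * (t + u))) * r (path \<phi> s (t + u))) \<partial>lborel)"
    unfolding cost_def using t a by (intro nn_integral_Icc_split) auto
  then show ?thesis unfolding cost_tail[OF assms(1) s t] .
qed

text \<open>For \<open>t = s (Suc 0)\<close> the path has already jumped at the right end, so the
  integrands agree only almost everywhere.\<close>

lemma cost_before_first:
  assumes s: "jump_times s" and t: "t \<le> s (Suc 0)"
  shows "cost r \<phi> s t = (\<integral>\<^sup>+u\<in>{0..t}. ennreal (exp (- lam * u)) * r (fl u \<phi>) \<partial>lborel)"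
  unfolding cost_def
  by (rule nn_integral_cong_AE, use AE_lborel_singleton[of "s (Suc 0)"] in eventually_elim)
     (use t path_before_first[OF s] in \<open>auto split: split_indicator\<close>)

section \<open>Expectations over independent exponential gaps\<close>

definition expo :: "real measure" where "expo = density lborel (\<lambda>x. ennreal (exponential_density \<mu> x))"

abbreviation Sq :: "(nat \<Rightarrow> real) measure" where "Sq \<equiv> \<Pi>\<^sub>M i\<in>(UNIV::nat set). expo"

lemma sets_ex [simp, measurable_cong]: "sets expo = sets borel" and space_ex [simp]: "space expo = UNIV"
  by (simp_all add: expo_def)

lemma prob_space_ex: "prob_space expo"
  unfolding expo_def by (rule prob_space_exponential_density[OF mu_pos])

lemma sequence_space_ex: "sequence_space expo"
  by (intro sequence_space.intro product_prob_spaceI prob_space_ex)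

lemma prob_space_Sq: "prob_space Sq"
  by (rule prob_space_PiM[OF prob_space_ex])

lemma nn_integral_ex:
  assumes [measurable]: "f \<in> borel_measurable borel"
  shows "(\<integral>\<^sup>+s. f s \<partial>expo) = (\<integral>\<^sup>+s. ennreal (\<mu> * exp (- \<mu> * s)) * f s * indicator {0..} s \<partial>lborel)"
  unfolding expo_def
  by (subst nn_integral_density)
     (auto intro!: nn_integral_cong simp: exponential_density_def mult.commute split: split_indicator)

lemma emeasure_ex_atLeast:
  assumes "0 \<le> u"
  shows "emeasure expo {u..} = ennreal (exp (- \<mu> * u))" "emeasure expo {u<..} = ennreal (exp (- \<mu> * u))"
proof -
  have "emeasure expo {u..} = (\<integral>\<^sup>+s. indicator {u..} s \<partial>expo)" by simp
  also have "\<dots> = (\<integral>\<^sup>+s. ennreal (\<mu> * exp (- \<mu> * s)) * indicator {u..} s \<partial>lborel)"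
    using assms by (subst nn_integral_ex) (auto intro!: nn_integral_cong split: split_indicator)
  also have "\<dots> = ennreal (0 - (- exp (- \<mu> * u)))"
  proof (rule nn_integral_FTC_atLeast)
    have "filterlim (\<lambda>s. - \<mu> * s) at_bot at_top"
      using mu_pos filterlim_ident by (intro filterlim_tendsto_neg_mult_at_bot[OF tendsto_const]) auto
    then have "((\<lambda>s. exp (- \<mu> * s)) \<longlongrightarrow> 0) at_top" by (rule filterlim_compose[OF exp_at_bot])
    then show "((\<lambda>s. - exp (- \<mu> * s)) \<longlongrightarrow> 0) at_top" using tendsto_minus by fastforce
  qed (use mu_pos in \<open>auto intro!: derivative_eq_intros\<close>)
  finally show *: "emeasure expo {u..} = ennreal (exp (- \<mu> * u))" by simp
  have "emeasure expo {u<..} = emeasure expo {u..}"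
  proof (rule emeasure_eq_AE)
    have "AE x in expo. x \<noteq> u"
      unfolding expo_def by (subst AE_density) (use AE_lborel_singleton[of u] in \<open>auto elim: eventually_mono\<close>)
    then show "AE x in expo. (x \<in> {u<..}) = (x \<in> {u..})" by eventually_elim auto
  qed auto
  then show "emeasure expo {u<..} = ennreal (exp (- \<mu> * u))" using * by simp
qed

lemma nn_integral_Icc_measurable:
  fixes f :: "'a \<Rightarrow> real \<Rightarrow> ennreal"
  assumes f: "(\<lambda>p. f (fst p) (snd p)) \<in> borel_measurable (M \<Otimes>\<^sub>M borel)"
    and t: "t \<in> borel_measurable M"
  shows "(\<lambda>x. \<integral>\<^sup>+u\<in>{0..t x}. f x u \<partial>lborel) \<in> borel_measurable M"
proof -
  have [measurable]: "(\<lambda>p. f (fst p) (snd p)) \<in> borel_measurable (M \<Otimes>\<^sub>M lborel)"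
    using f by (simp cong: measurable_cong_sets)
  note t[measurable]
  have "(\<lambda>x. \<integral>\<^sup>+u\<in>{0..t x}. f x u \<partial>lborel) = (\<lambda>x. \<integral>\<^sup>+u. f x u * (if 0 \<le> u \<and> u \<le> t x then 1 else 0) \<partial>lborel)"
    by (intro ext nn_integral_cong) (auto split: split_indicator)
  also have "\<dots> \<in> borel_measurable M"
    by (rule lborel.borel_measurable_nn_integral) (unfold split_beta', measurable)
  finally show ?thesis .
qed

text \<open>By Fubini, \<open>u\<close> is counted when the exponential time is at least
  \<open>u\<close>, an event of probability \<open>exp (- \<mu> * u)\<close>.\<close>

lemma nn_integral_ex_cumulative:
  assumes [measurable]: "f \<in> borel_measurable borel"
  shows "(\<integral>\<^sup>+s. (\<integral>\<^sup>+u\<in>{0..s}. f u \<partial>lborel) \<partial>expo) = (\<integral>\<^sup>+u\<in>{0..}. (ennreal (exp (- \<mu> * u)) * f u) \<partial>lborel)"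
proof -
  interpret expo: prob_space expo by (rule prob_space_ex)
  interpret P: pair_sigma_finite lborel expo by unfold_locales
  have "(\<integral>\<^sup>+s. (\<integral>\<^sup>+u\<in>{0..s}. f u \<partial>lborel) \<partial>expo) =
    (\<integral>\<^sup>+s. (\<integral>\<^sup>+u. f u * (if 0 \<le> u \<and> u \<le> s then 1 else 0) \<partial>lborel) \<partial>expo)"
    by (intro nn_integral_cong) (auto split: split_indicator)
  also have "\<dots> = (\<integral>\<^sup>+u. (\<integral>\<^sup>+s. f u * (if 0 \<le> u \<and> u \<le> s then 1 else 0) \<partial>expo) \<partial>lborel)"
    by (rule P.Fubini') measurable
  also have "\<dots> = (\<integral>\<^sup>+u\<in>{0..}. (ennreal (exp (- \<mu> * u)) * f u) \<partial>lborel)"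
  proof (rule nn_integral_cong)
    fix u :: real
    have "(\<integral>\<^sup>+s. f u * (if 0 \<le> u \<and> u \<le> s then 1 else 0) \<partial>expo) = (\<integral>\<^sup>+s. f u * indicator {0..} u * indicator {u..} s \<partial>expo)"
      by (intro nn_integral_cong) (auto split: split_indicator)
    also have "\<dots> = f u * indicator {0..} u * emeasure expo {u..}"
      by (simp add: nn_integral_cmult_indicator)
    also have "\<dots> = ennreal (exp (- \<mu> * u)) * f u * indicator {0..} u"
      using emeasure_ex_atLeast[of u] by (auto split: split_indicator simp: mult.commute)
    finally show "(\<integral>\<^sup>+s. f u * (if 0 \<le> u \<and> u \<le> s then 1 else 0) \<partial>expo) = ennreal (exp (- \<mu> * u)) * f u * indicator {0..} u" .
  qed
  finally show ?thesis .
qed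

lemma exp_k: "ennreal (exp (- k * u)) = ennreal (exp (- lam * u)) * ennreal (exp (- \<mu> * u))"
  by (simp add: ennreal_mult'[symmetric] exp_add[symmetric] k_def algebra_simps)

text \<open>The link between probability and \<open>stage\<close>: running costs are weighted with
  the survival probability, the jump cost with the density \<open>\<mu> * exp (- \<mu> * s)\<close>,
  and the terminal cost \<open>q\<close> with the probability of no jump up to
  \<open>t\<close>.\<close>

lemma nn_integral_ex_stage:
  assumes [measurable]: "r \<in> borel_measurable borel" "\<rho> \<in> borel_measurable borel" and t: "0 \<le> t"
  shows "(\<integral>\<^sup>+s. (\<integral>\<^sup>+u\<in>{0..min t s}. (ennreal (exp (- lam * u)) * r u) \<partial>lborel) +
      (if s \<le> t then ennreal (exp (- lam * s)) * \<rho> s else ennreal (exp (- lam * t)) * q) \<partial>expo)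
    = stage r \<rho> t + ennreal (exp (- k * t)) * q"
proof -
  let ?f = "\<lambda>u. ennreal (exp (- lam * u)) * r u * indicator {..t} u"
  have "(\<integral>\<^sup>+s. (\<integral>\<^sup>+u\<in>{0..min t s}. (ennreal (exp (- lam * u)) * r u) \<partial>lborel) +
      (if s \<le> t then ennreal (exp (- lam * s)) * \<rho> s else ennreal (exp (- lam * t)) * q) \<partial>expo) =
    (\<integral>\<^sup>+s. (\<integral>\<^sup>+u\<in>{0..s}. ?f u \<partial>lborel) + (ennreal (exp (- lam * s)) * \<rho> s * indicator {..t} s +
      ennreal (exp (- lam * t)) * q * indicator {t<..} s) \<partial>expo)"
  proof (rule nn_integral_cong)
    fix s
    have "(\<integral>\<^sup>+u\<in>{0..min t s}. (ennreal (exp (- lam * u)) * r u) \<partial>lborel) = (\<integral>\<^sup>+u\<in>{0..s}. ?f u \<partial>lborel)"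
      by (intro nn_integral_cong) (auto split: split_indicator)
    then show "(\<integral>\<^sup>+u\<in>{0..min t s}. (ennreal (exp (- lam * u)) * r u) \<partial>lborel) +
      (if s \<le> t then ennreal (exp (- lam * s)) * \<rho> s else ennreal (exp (- lam * t)) * q) =
      (\<integral>\<^sup>+u\<in>{0..s}. ?f u \<partial>lborel) + (ennreal (exp (- lam * s)) * \<rho> s * indicator {..t} s +
      ennreal (exp (- lam * t)) * q * indicator {t<..} s)"
      by (auto split: split_indicator)
  qed
  also have "\<dots> = (\<integral>\<^sup>+s. (\<integral>\<^sup>+u\<in>{0..s}. ?f u \<partial>lborel) \<partial>expo) +
      ((\<integral>\<^sup>+s. ennreal (exp (- lam * s)) * \<rho> s * indicator {..t} s \<partial>expo) +
       (\<integral>\<^sup>+s. ennreal (exp (- lam * t)) * q * indicator {t<..} s \<partial>expo))"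
  proof -
    have [measurable]: "(\<lambda>s. \<integral>\<^sup>+u\<in>{0..s}. ?f u \<partial>lborel) \<in> borel_measurable expo"
      by (rule nn_integral_Icc_measurable) measurable
    have 2: "(\<integral>\<^sup>+s. ennreal (exp (- lam * s)) * \<rho> s * indicator {..t} s +
        ennreal (exp (- lam * t)) * q * indicator {t<..} s \<partial>expo) =
        (\<integral>\<^sup>+s. ennreal (exp (- lam * s)) * \<rho> s * indicator {..t} s \<partial>expo) +
        (\<integral>\<^sup>+s. ennreal (exp (- lam * t)) * q * indicator {t<..} s \<partial>expo)"
      by (rule nn_integral_add) measurable
    show ?thesis unfolding 2[symmetric] by (rule nn_integral_add) measurable
  qed
  also have "(\<integral>\<^sup>+s. (\<integral>\<^sup>+u\<in>{0..s}. ?f u \<partial>lborel) \<partial>expo) = (\<integral>\<^sup>+u\<in>{0..}. (ennreal (exp (- \<mu> * u)) * ?f u) \<partial>lborel)"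
    by (rule nn_integral_ex_cumulative) measurable
  also have "(\<integral>\<^sup>+s. ennreal (exp (- lam * s)) * \<rho> s * indicator {..t} s \<partial>expo) =
      (\<integral>\<^sup>+s. ennreal (\<mu> * exp (- \<mu> * s)) * (ennreal (exp (- lam * s)) * \<rho> s * indicator {..t} s) * indicator {0..} s \<partial>lborel)"
    by (rule nn_integral_ex) measurable
  also have "(\<integral>\<^sup>+s. ennreal (exp (- lam * t)) * q * indicator {t<..} s \<partial>expo) = ennreal (exp (- k * t)) * q"
    unfolding exp_k using emeasure_ex_atLeast(2)[OF t]
    by (subst nn_integral_cmult_indicator) (simp_all only: sets_ex borel_open open_greaterThan ac_simps)
  also have "(\<integral>\<^sup>+u\<in>{0..}. (ennreal (exp (- \<mu> * u)) * ?f u) \<partial>lborel) +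
     ((\<integral>\<^sup>+s. ennreal (\<mu> * exp (- \<mu> * s)) * (ennreal (exp (- lam * s)) * \<rho> s * indicator {..t} s) * indicator {0..} s \<partial>lborel) +
      ennreal (exp (- k * t)) * q) = stage r \<rho> t + ennreal (exp (- k * t)) * q"
  proof -
    have "(\<integral>\<^sup>+u\<in>{0..}. (ennreal (exp (- \<mu> * u)) * ?f u) \<partial>lborel) +
      (\<integral>\<^sup>+s. ennreal (\<mu> * exp (- \<mu> * s)) * (ennreal (exp (- lam * s)) * \<rho> s * indicator {..t} s) * indicator {0..} s \<partial>lborel)
     = stage r \<rho> t"
      unfolding stage_def exp_k
    proof (subst nn_integral_add[symmetric])
      show "(\<integral>\<^sup>+u. ennreal (exp (- \<mu> * u)) * ?f u * indicator {0..} u +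
          ennreal (\<mu> * exp (- \<mu> * u)) * (ennreal (exp (- lam * u)) * \<rho> u * indicator {..t} u) * indicator {0..} u \<partial>lborel) =
        (\<integral>\<^sup>+u\<in>{0..t}. (ennreal (exp (- lam * u)) * ennreal (exp (- \<mu> * u)) * (r u + ennreal \<mu> * \<rho> u)) \<partial>lborel)"
      proof (rule nn_integral_cong)
        fix u
        have "ennreal (\<mu> * exp (- \<mu> * u)) = ennreal \<mu> * ennreal (exp (- \<mu> * u))"
          using mu_pos by (simp add: ennreal_mult')
        then show "ennreal (exp (- \<mu> * u)) * ?f u * indicator {0..} u +
          ennreal (\<mu> * exp (- \<mu> * u)) * (ennreal (exp (- lam * u)) * \<rho> u * indicator {..t} u) * indicator {0..} u =
          ennreal (exp (- lam * u)) * ennreal (exp (- \<mu> * u)) * (r u + ennreal \<mu> * \<rho> u) * indicator {0..t} u"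
          by (cases "0 \<le> u"; cases "u \<le> t") (simp_all add: distrib_left ac_simps)
      qed
    qed measurable
    then show ?thesis by (simp add: add.assoc[symmetric])
  qed
  finally show ?thesis .
qed

text \<open>An i.i.d. sequence is an independent first entry put in front of another such sequence;
  this allows recursion over the jumps.\<close>

lemma nn_integral_Sq_split:
  assumes [measurable]: "f \<in> borel_measurable Sq"
  shows "(\<integral>\<^sup>+d. f d \<partial>Sq) = (\<integral>\<^sup>+s. (\<integral>\<^sup>+d. f (case_nat s d) \<partial>Sq) \<partial>expo)"
proof -
  interpret S: prob_space Sq by (rule prob_space_Sq)
  interpret expo: sequence_space expo by (rule sequence_space_ex)
  have [measurable]: "(\<lambda>(s, d). case_nat s d) \<in> measurable (expo \<Otimes>\<^sub>M Sq) Sq"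
    by measurable
  have "(\<integral>\<^sup>+d. f d \<partial>Sq) = (\<integral>\<^sup>+d. f d \<partial>distr (expo \<Otimes>\<^sub>M Sq) Sq (\<lambda>(s, d). case_nat s d))"
    using expo.PiM_iter by simp
  also have "\<dots> = (\<integral>\<^sup>+p. f (case_nat (fst p) (snd p)) \<partial>(expo \<Otimes>\<^sub>M Sq))"
    by (subst nn_integral_distr) (auto simp: case_prod_beta)
  also have "\<dots> = (\<integral>\<^sup>+s. (\<integral>\<^sup>+d. f (case_nat s d) \<partial>Sq) \<partial>expo)"
    by (subst S.nn_integral_fst[symmetric]) auto
  finally show ?thesis .
qed

text \<open>As a function of the gaps \<open>d\<close> between jumps: the cost up to the horizon \<open>h\<close> with running
  cost \<open>r\<close> and terminal cost \<open>q\<close>, where nothing is charged after the \<open>n\<close>-th jump.\<close>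

primrec horizon_cost :: "nat \<Rightarrow> (real \<times> real \<Rightarrow> ennreal) \<Rightarrow> (real \<times> real \<Rightarrow> ennreal) \<Rightarrow> real \<times> real \<Rightarrow> real \<Rightarrow> (nat \<Rightarrow> real) \<Rightarrow> ennreal" where
  "horizon_cost 0 r q = (\<lambda>\<phi> h d. 0)"
| "horizon_cost (Suc n) r q = (\<lambda>\<phi> h d. (\<integral>\<^sup>+u\<in>{0..min h (d 0)}. (ennreal (exp (- lam * u)) * r (fl u \<phi>)) \<partial>lborel) +
    (if d 0 \<le> h then ennreal (exp (- lam * d 0)) * horizon_cost n r q (jm (fl (d 0) \<phi>)) (h - d 0) (\<lambda>i. d (Suc i))
     else ennreal (exp (- lam * h)) * q (fl h \<phi>)))"

text \<open>State, horizon and gaps all depend on \<open>x\<close>, because the recursion changes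
  the three of them together.\<close>

lemma Yn_measurable:
  assumes [measurable]: "r \<in> borel_measurable borel" "q \<in> borel_measurable borel"
    and "f \<in> borel_measurable M" "h \<in> borel_measurable M" "\<And>i. (\<lambda>x. d x i) \<in> borel_measurable M"
  shows "(\<lambda>x. horizon_cost n r q (f x) (h x) (d x)) \<in> borel_measurable M"
  using assms(3-)
proof (induction n arbitrary: f h d)
  case (Suc n)
  note Suc.prems(1,2)[measurable]
  have [measurable]: "(\<lambda>x. d x 0) \<in> borel_measurable M" by (rule Suc.prems(3))
  have [measurable]: "(\<lambda>x. horizon_cost n r q (jm (fl (d x 0) (f x))) (h x - d x 0) (\<lambda>i. d x (Suc i))) \<in> borel_measurable M"
    by (rule Suc.IH) (measurable, rule Suc.prems(3))
  have [measurable]: "(\<lambda>x. \<integral>\<^sup>+u\<in>{0..min (h x) (d x 0)}. (ennreal (exp (- lam * u)) * r (fl u (f x))) \<partial>lborel) \<in> borel_measurable M"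
    by (rule nn_integral_Icc_measurable) measurable
  show ?case unfolding horizon_cost.simps by measurable
qed simp

lemma nn_integral_Yn:
  assumes [measurable]: "r \<in> borel_measurable borel" "q \<in> borel_measurable borel" and h: "0 \<le> h"
  shows "(\<integral>\<^sup>+d. horizon_cost (Suc n) r q \<phi> h d \<partial>Sq) =
    stage (\<lambda>u. r (fl u \<phi>)) (\<lambda>u. \<integral>\<^sup>+d. horizon_cost n r q (jm (fl u \<phi>)) (h - u) d \<partial>Sq) h + ennreal (exp (- k * h)) * q (fl h \<phi>)"
proof -
  interpret S: prob_space Sq by (rule prob_space_Sq)
  have "(\<integral>\<^sup>+d. horizon_cost (Suc n) r q \<phi> h d \<partial>Sq) = (\<integral>\<^sup>+s. (\<integral>\<^sup>+d. horizon_cost (Suc n) r q \<phi> h (case_nat s d) \<partial>Sq) \<partial>expo)"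
    by (rule nn_integral_Sq_split, rule Yn_measurable) measurable
  also have "\<dots> = (\<integral>\<^sup>+s. (\<integral>\<^sup>+u\<in>{0..min h s}. (ennreal (exp (- lam * u)) * r (fl u \<phi>)) \<partial>lborel) +
      (if s \<le> h then ennreal (exp (- lam * s)) * (\<integral>\<^sup>+d. horizon_cost n r q (jm (fl s \<phi>)) (h - s) d \<partial>Sq)
       else ennreal (exp (- lam * h)) * q (fl h \<phi>)) \<partial>expo)"
  proof (rule nn_integral_cong)
    fix s
    have [measurable]: "(\<lambda>d. horizon_cost n r q (jm (fl s \<phi>)) (h - s) d) \<in> borel_measurable Sq"
      by (rule Yn_measurable) measurable
    show "(\<integral>\<^sup>+d. horizon_cost (Suc n) r q \<phi> h (case_nat s d) \<partial>Sq) =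
      (\<integral>\<^sup>+u\<in>{0..min h s}. (ennreal (exp (- lam * u)) * r (fl u \<phi>)) \<partial>lborel) +
      (if s \<le> h then ennreal (exp (- lam * s)) * (\<integral>\<^sup>+d. horizon_cost n r q (jm (fl s \<phi>)) (h - s) d \<partial>Sq)
       else ennreal (exp (- lam * h)) * q (fl h \<phi>))"
      by (auto simp: nn_integral_add nn_integral_cmult S.emeasure_space_1)
  qed
  also have "\<dots> = stage (\<lambda>u. r (fl u \<phi>)) (\<lambda>u. \<integral>\<^sup>+d. horizon_cost n r q (jm (fl u \<phi>)) (h - u) d \<partial>Sq) h + ennreal (exp (- k * h)) * q (fl h \<phi>)"
  proof (rule nn_integral_ex_stage)
    have "(\<lambda>(u, d). horizon_cost n r q (jm (fl u \<phi>)) (h - u) d) \<in> borel_measurable (borel \<Otimes>\<^sub>M Sq)"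
      unfolding case_prod_beta by (rule Yn_measurable) measurable
    then show "(\<lambda>u. \<integral>\<^sup>+d. horizon_cost n r q (jm (fl u \<phi>)) (h - u) d \<partial>Sq) \<in> borel_measurable borel"
      by measurable
  qed (use h in measurable)
  finally show ?thesis .
qed

abbreviation Ge :: "real \<times> real \<Rightarrow> ennreal" where "Ge \<equiv> \<lambda>\<psi>. ennreal (G \<psi>)"

text \<open>Induction by restarting the path at its first jump. The inequality serves the lower
  bound in \<open>vinf_step\<close>, the equality for large \<open>n\<close> the moment bound
  \<open>U_moment\<close>.\<close>

lemma Yn_path:
  assumes [measurable]: "r \<in> borel_measurable borel" and "jump_times s" "0 \<le> h"
  shows "horizon_cost n r q \<phi> h (gaps s) \<le> cost r \<phi> s h + ennreal (exp (- lam * h)) * q (path \<phi> s h) \<and>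
    (h < s n \<longrightarrow> horizon_cost n r q \<phi> h (gaps s) = cost r \<phi> s h + ennreal (exp (- lam * h)) * q (path \<phi> s h))"
  using assms(2,3)
proof (induction n arbitrary: \<phi> s h)
  case 0
  then show ?case using jump_timesD(1)[of s] by simp
next
  case (Suc n)
  note s = \<open>jump_times s\<close>
  let ?s1 = "s (Suc 0)"
  have s1: "0 \<le> ?s1" using jump_timesD(5)[OF s] .
  show ?case
  proof (cases "?s1 \<le> h")
    case False
    then have h: "h \<le> ?s1" "min h ?s1 = h" by auto
    have "horizon_cost (Suc n) r q \<phi> h (gaps s) = cost r \<phi> s h + ennreal (exp (- lam * h)) * q (path \<phi> s h)"
      using False Suc.prems
      by (simp add: gaps_0[OF s] h(2) cost_before_first[OF s h(1)] path_before_first[OF s])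
    then show ?thesis by simp
  next
    case True
    define a where "a = h - ?s1"
    have a: "0 \<le> a" "h = ?s1 + a" using True by (auto simp: a_def)
    let ?s' = "shift_times ?s1 s" and ?\<psi> = "jm (fl ?s1 \<phi>)"
    have s': "jump_times ?s'" by (rule jump_times_shift[OF s s1])
    have e: "ennreal (exp (- lam * h)) = ennreal (exp (- lam * ?s1)) * ennreal (exp (- lam * a))"
      by (simp add: a(2) ennreal_mult'[symmetric] exp_add[symmetric] algebra_simps)
    have p: "path \<phi> s h = path ?\<psi> ?s' a"
      unfolding a(2) path_shift[OF s s1 a(1), symmetric] path_first[OF s] ..
    have L: "cost r \<phi> s h + ennreal (exp (- lam * h)) * q (path \<phi> s h) =
      cost r \<phi> s ?s1 + ennreal (exp (- lam * ?s1)) * (cost r ?\<psi> ?s' a + ennreal (exp (- lam * a)) * q (path ?\<psi> ?s' a))"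
      unfolding p e unfolding a(2) cost_shift[OF assms(1) s s1 a(1)] path_first[OF s]
      by (simp add: distrib_left add.assoc mult.assoc)
    have Y: "horizon_cost (Suc n) r q \<phi> h (gaps s) = cost r \<phi> s ?s1 + ennreal (exp (- lam * ?s1)) * horizon_cost n r q ?\<psi> a (gaps ?s')"
      using True unfolding gaps_shift_first[OF s] comp_def
      by (simp add: gaps_0[OF s] cost_before_first[OF s] a_def min_absorb2)
    have "?s' n = s (Suc n) - ?s1" if "n \<noteq> 0"
      using that by (simp add: shift_times_def jump_count_first[OF s])
    then have "h < s (Suc n) \<longrightarrow> a < ?s' n"
      using True by (cases "n = 0") (auto simp: a_def)
    then show ?thesis
      unfolding L Y using Suc.IH[OF s' a(1), of ?\<psi>] by (auto intro!: add_left_mono mult_left_mono)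
  qed
qed

text \<open>The martingale identity \<open>stage_U\<close> iterated over the jumps; it becomes an
  inequality as nothing is charged after the \<open>n\<close>-th jump.\<close>

lemma nn_integral_Yn_U:
  assumes "\<phi> \<in> Q" "0 \<le> h"
  shows "(\<integral>\<^sup>+d. horizon_cost n (\<lambda>_. 0) (\<lambda>\<psi>. ennreal (U \<psi>)) \<phi> h d \<partial>Sq) \<le> ennreal (U \<phi>)"
  using assms
proof (induction n arbitrary: \<phi> h)
  case (Suc n)
  have "(\<integral>\<^sup>+d. horizon_cost (Suc n) (\<lambda>_. 0) (\<lambda>\<psi>. ennreal (U \<psi>)) \<phi> h d \<partial>Sq) =
    stage (\<lambda>u. 0) (\<lambda>u. \<integral>\<^sup>+d. horizon_cost n (\<lambda>_. 0) (\<lambda>\<psi>. ennreal (U \<psi>)) (jm (fl u \<phi>)) (h - u) d \<partial>Sq) h + ennreal (exp (- k * h)) * ennreal (U (fl h \<phi>))"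
    using Suc.prems by (intro nn_integral_Yn) measurable
  also have "\<dots> \<le> stage (\<lambda>u. 0) (\<lambda>u. ennreal (U (jm (fl u \<phi>)))) h + ennreal (exp (- k * h)) * ennreal (U (fl h \<phi>))"
    using Suc.prems by (intro add_right_mono stage_mono Suc.IH jm_Q fl_Q) auto
  also have "\<dots> = ennreal (U \<phi>)" by (rule stage_U[OF Suc.prems])
  finally show ?case .
qed simp

lemma stage_0_const_le:
  assumes "0 \<le> a" "0 \<le> t"
  shows "stage (\<lambda>_. 0) (\<lambda>_. ennreal a) t \<le> ennreal (a * (\<mu> / k))"
proof -
  have "stage (\<lambda>_. ennreal 0) (\<lambda>_. ennreal a) t = ennreal ((0 + \<mu> * a) / k * (1 - exp (- k * t)))"
    using assms by (intro stage_const) auto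
  also have "\<dots> \<le> ennreal ((0 + \<mu> * a) / k * 1)"
    using assms k_pos mu_pos by (intro ennreal_leI mult_left_mono) auto
  finally show ?thesis by (simp add: mult.commute)
qed

lemma stage_add_const_le:
  assumes [measurable]: "r \<in> borel_measurable borel" "\<rho> \<in> borel_measurable borel" and a: "0 \<le> a" "0 \<le> t"
  shows "stage r (\<lambda>u. \<rho> u + ennreal a) t \<le> stage r \<rho> t + ennreal (a * (\<mu> / k))"
proof -
  have "stage (\<lambda>u. r u + 0) (\<lambda>u. \<rho> u + ennreal a) t = stage r \<rho> t + stage (\<lambda>_. 0) (\<lambda>_. ennreal a) t"
    by (rule stage_add) measurable
  also have "\<dots> \<le> stage r \<rho> t + ennreal (a * (\<mu> / k))"
    by (intro add_left_mono stage_0_const_le a)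
  finally show ?thesis by simp
qed

text \<open>\<open>vinf_le_stage\<close> iterated over the jumps. After the last one
  \<open>vinf\<close> is estimated by \<open>b\<close>, and each stage damps this error by the
  expected discount \<open>\<mu> / k\<close> over a gap.\<close>

lemma vinf_le_Yn:
  assumes "\<phi> \<in> Q" "0 \<le> h"
  shows "vinf \<phi> \<le> (\<integral>\<^sup>+d. horizon_cost n Ge vinf \<phi> h d \<partial>Sq) + ennreal (b * (\<mu> / k) ^ n)"
  using assms
proof (induction n arbitrary: \<phi> h)
  case 0
  then show ?case using vinf_le_b by simp
next
  case (Suc n)
  let ?\<rho> = "\<lambda>u. \<integral>\<^sup>+d. horizon_cost n Ge vinf (jm (fl u \<phi>)) (h - u) d \<partial>Sq"
  interpret S: prob_space Sq by (rule prob_space_Sq)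
  have "(\<lambda>(u, d). horizon_cost n Ge vinf (jm (fl u \<phi>)) (h - u) d) \<in> borel_measurable (borel \<Otimes>\<^sub>M Sq)"
    unfolding case_prod_beta by (rule Yn_measurable) measurable
  then have [measurable]: "?\<rho> \<in> borel_measurable borel"
    by measurable
  have a: "0 \<le> b * (\<mu> / k) ^ n" using b_pos mu_pos k_pos by simp
  have "vinf \<phi> \<le> stage (\<lambda>u. Ge (fl u \<phi>)) (\<lambda>u. vinf (jm (fl u \<phi>))) h + ennreal (exp (- k * h)) * vinf (fl h \<phi>)"
    by (rule vinf_le_stage[OF Suc.prems])
  also have "\<dots> \<le> stage (\<lambda>u. Ge (fl u \<phi>)) (\<lambda>u. ?\<rho> u + ennreal (b * (\<mu> / k) ^ n)) h + ennreal (exp (- k * h)) * vinf (fl h \<phi>)"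
    using Suc.prems by (intro add_right_mono stage_mono order_refl Suc.IH jm_Q fl_Q) auto
  also have "\<dots> \<le> (stage (\<lambda>u. Ge (fl u \<phi>)) ?\<rho> h + ennreal (b * (\<mu> / k) ^ n * (\<mu> / k))) + ennreal (exp (- k * h)) * vinf (fl h \<phi>)"
    using Suc.prems a by (intro add_right_mono stage_add_const_le) measurable
  also have "\<dots> = (\<integral>\<^sup>+d. horizon_cost (Suc n) Ge vinf \<phi> h d \<partial>Sq) + ennreal (b * (\<mu> / k) ^ Suc n)"
    using Suc.prems by (subst nn_integral_Yn) (measurable, simp_all add: ac_simps)
  finally show ?case .
qed

section \<open>Nearly optimal policies\<close>

text \<open>The index counts the remaining stages: with \<open>Suc n\<close> of them left, the
  policy waits for \<open>R n \<phi>\<close> or the next jump, and with none left it stops at once.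
  This mirrors the recursion of \<open>vh\<close>.\<close>

primrec policy_cost :: "(nat \<Rightarrow> real \<times> real \<Rightarrow> real) \<Rightarrow> nat \<Rightarrow> real \<times> real \<Rightarrow> (nat \<Rightarrow> real) \<Rightarrow> ennreal" where
  "policy_cost R 0 = (\<lambda>\<phi> d. ennreal b)"
| "policy_cost R (Suc n) = (\<lambda>\<phi> d.
    (\<integral>\<^sup>+u\<in>{0..min (R n \<phi>) (d 0)}. (ennreal (exp (- lam * u)) * Ge (fl u \<phi>)) \<partial>lborel) +
    (if d 0 \<le> R n \<phi> then ennreal (exp (- lam * d 0)) * policy_cost R n (jm (fl (d 0) \<phi>)) (\<lambda>i. d (Suc i))
     else ennreal (exp (- lam * R n \<phi>)) * ennreal b))"

primrec policy_time :: "(nat \<Rightarrow> real \<times> real \<Rightarrow> real) \<Rightarrow> nat \<Rightarrow> real \<times> real \<Rightarrow> (nat \<Rightarrow> real) \<Rightarrow> real" where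
  "policy_time R 0 = (\<lambda>\<phi> d. 0)"
| "policy_time R (Suc n) = (\<lambda>\<phi> d. if d 0 \<le> R n \<phi>
    then d 0 + policy_time R n (jm (fl (d 0) \<phi>)) (\<lambda>i. d (Suc i)) else R n \<phi>)"

lemma policy_cost_measurable:
  assumes R: "\<And>n. R n \<in> borel_measurable borel"
    and "f \<in> borel_measurable M" "\<And>i. (\<lambda>x. d x i) \<in> borel_measurable M"
  shows "(\<lambda>x. policy_cost R n (f x) (d x)) \<in> borel_measurable M"
  using assms(2-)
proof (induction n arbitrary: f d)
  case (Suc n)
  note Suc.prems(1)[measurable] R[of n, measurable]
  have [measurable]: "(\<lambda>x. d x 0) \<in> borel_measurable M" by (rule Suc.prems(2))
  have [measurable]: "(\<lambda>x. policy_cost R n (jm (fl (d x 0) (f x))) (\<lambda>i. d x (Suc i))) \<in> borel_measurable M"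
    by (rule Suc.IH) (measurable, rule Suc.prems(2))
  have [measurable]: "(\<lambda>x. \<integral>\<^sup>+u\<in>{0..min (R n (f x)) (d x 0)}. (ennreal (exp (- lam * u)) * Ge (fl u (f x))) \<partial>lborel) \<in> borel_measurable M"
    by (rule nn_integral_Icc_measurable) measurable
  show ?case unfolding policy_cost.simps by measurable
qed simp

lemma policy_time_measurable:
  assumes R: "\<And>n. R n \<in> borel_measurable borel"
    and "f \<in> borel_measurable M" "\<And>i. (\<lambda>x. d x i) \<in> borel_measurable M"
  shows "(\<lambda>x. policy_time R n (f x) (d x)) \<in> borel_measurable M"
  using assms(2-)
proof (induction n arbitrary: f d)
  case (Suc n)
  note Suc.prems(1)[measurable] R[of n, measurable]
  have [measurable]: "(\<lambda>x. d x 0) \<in> borel_measurable M" by (rule Suc.prems(2))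
  have [measurable]: "(\<lambda>x. policy_time R n (jm (fl (d x 0) (f x))) (\<lambda>i. d x (Suc i))) \<in> borel_measurable M"
    by (rule Suc.IH) (measurable, rule Suc.prems(2))
  show ?case unfolding policy_time.simps by measurable
qed simp

lemma policy_time_nonneg:
  assumes "\<And>n \<phi>. 0 \<le> R n \<phi>" "\<And>i. 0 \<le> d i"
  shows "0 \<le> policy_time R n \<phi> d"
  using assms(2) by (induction n arbitrary: \<phi> d) (simp_all add: assms(1))

text \<open>A form of Galmarino's test: whether the policy has stopped by \<open>t\<close> depends
  only on the gaps completed by \<open>t\<close>. Gap sequences may differ once both partial sums
  exceed \<open>t\<close>.\<close>

lemma policy_time_agree:
  assumes R: "\<And>n \<phi>. 0 \<le> R n \<phi>" and "\<And>i. 0 \<le> d i" "\<And>i. 0 \<le> d' i"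
    and "\<And>i. (\<forall>j\<le>i. d j = d' j) \<or> (t < (\<Sum>j\<le>i. d j) \<and> t < (\<Sum>j\<le>i. d' j))"
  shows "policy_time R n \<phi> d \<le> t \<longleftrightarrow> policy_time R n \<phi> d' \<le> t"
  using assms(2-)
proof (induction n arbitrary: \<phi> d d' t)
  case (Suc n)
  show ?case
  proof (cases "d 0 = d' 0")
    case True
    have "policy_time R n \<psi> (\<lambda>i. d (Suc i)) \<le> t - d 0 \<longleftrightarrow> policy_time R n \<psi> (\<lambda>i. d' (Suc i)) \<le> t - d 0" for \<psi>
    proof (rule Suc.IH)
      fix i
      show "(\<forall>j\<le>i. d (Suc j) = d' (Suc j)) \<or> (t - d 0 < (\<Sum>j\<le>i. d (Suc j)) \<and> t - d 0 < (\<Sum>j\<le>i. d' (Suc j)))"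
        using Suc.prems(3)[of "Suc i"] True unfolding sum.atMost_Suc_shift by auto
    qed (use Suc.prems in auto)
    then show ?thesis using True by (simp add: le_diff_eq add.commute)
  next
    case False
    then have t: "t < d 0" "t < d' 0" using Suc.prems(3)[of 0] by auto
    have "0 \<le> policy_time R n \<psi> (\<lambda>i. d (Suc i))" "0 \<le> policy_time R n \<psi> (\<lambda>i. d' (Suc i))" for \<psi>
      by (intro policy_time_nonneg R Suc.prems)+
    then have "t < d 0 + policy_time R n \<psi> (\<lambda>i. d (Suc i))" "t < d' 0 + policy_time R n \<psi> (\<lambda>i. d' (Suc i))" for \<psi>
      using t by (simp_all add: add_strict_increasing2 add_pos_nonneg less_le_trans)
    then show ?thesis using t by (auto simp: not_le[symmetric])
  qed
qed simp

text \<open>Restarting at the first jump, as in \<open>Yn_path\<close>, identifies the recursive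
  cost with the cost of the path stopped at \<open>policy_time\<close>.\<close>

lemma policy_cost_path:
  assumes R: "\<And>n \<phi>. 0 \<le> R n \<phi>" and "jump_times s"
  shows "policy_cost R n \<phi> (gaps s) = cost Ge \<phi> s (policy_time R n \<phi> (gaps s)) +
    ennreal (exp (- lam * policy_time R n \<phi> (gaps s))) * ennreal b"
  using assms(2)
proof (induction n arbitrary: \<phi> s)
  case 0
  have "cost Ge \<phi> s 0 = (\<integral>\<^sup>+u\<in>{0}. (ennreal (exp (- lam * u)) * Ge (path \<phi> s u)) \<partial>lborel)"
    by (simp add: cost_def)
  also have "\<dots> = 0" by (rule nn_integral_null_set) (simp add: null_sets_def)
  finally show ?case by simp
next
  case (Suc n)
  note s = \<open>jump_times s\<close>
  let ?s1 = "s (Suc 0)"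
  have s1: "0 \<le> ?s1" using jump_timesD(5)[OF s] .
  show ?case
  proof (cases "?s1 \<le> R n \<phi>")
    case False
    then have h: "R n \<phi> \<le> ?s1" "min (R n \<phi>) ?s1 = R n \<phi>" by auto
    show ?thesis
      using False by (simp add: gaps_0[OF s] h(2) cost_before_first[OF s h(1)])
  next
    case True
    let ?s' = "shift_times ?s1 s" and ?\<psi> = "jm (fl ?s1 \<phi>)"
    let ?a = "policy_time R n ?\<psi> (gaps ?s')"
    have s': "jump_times ?s'" by (rule jump_times_shift[OF s s1])
    have a: "0 \<le> ?a" by (intro policy_time_nonneg R less_imp_le gaps_pos s')
    have T: "policy_time R (Suc n) \<phi> (gaps s) = ?s1 + ?a"
      using True unfolding gaps_shift_first[OF s] comp_def by (simp add: gaps_0[OF s])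
    have e: "ennreal (exp (- lam * (?s1 + ?a))) = ennreal (exp (- lam * ?s1)) * ennreal (exp (- lam * ?a))"
      by (simp add: ennreal_mult'[symmetric] exp_add[symmetric] algebra_simps)
    have "policy_cost R (Suc n) \<phi> (gaps s) = cost Ge \<phi> s ?s1 + ennreal (exp (- lam * ?s1)) * policy_cost R n ?\<psi> (gaps ?s')"
      using True unfolding gaps_shift_first[OF s] comp_def
      by (simp add: gaps_0[OF s] cost_before_first[OF s] min_absorb2)
    also have "\<dots> = cost Ge \<phi> s (?s1 + ?a) + ennreal (exp (- lam * (?s1 + ?a))) * ennreal b"
      unfolding Suc.IH[OF s'] e
      by (subst cost_shift[OF _ s s1 a]) (simp_all add: path_first[OF s] distrib_left add.assoc mult.assoc)
    finally show ?thesis unfolding T .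
  qed
qed

lemma nn_integral_policy_cost:
  assumes R: "\<And>n. R n \<in> borel_measurable borel" "\<And>n \<phi>. 0 \<le> R n \<phi>"
  shows "(\<integral>\<^sup>+d. policy_cost R (Suc n) \<phi> d \<partial>Sq) = F (\<lambda>\<psi>. \<integral>\<^sup>+d. policy_cost R n \<psi> d \<partial>Sq) (R n \<phi>) \<phi>"
proof -
  interpret S: prob_space Sq by (rule prob_space_Sq)
  have "(\<integral>\<^sup>+d. policy_cost R (Suc n) \<phi> d \<partial>Sq) = (\<integral>\<^sup>+s. (\<integral>\<^sup>+d. policy_cost R (Suc n) \<phi> (case_nat s d) \<partial>Sq) \<partial>expo)"
    by (rule nn_integral_Sq_split, rule policy_cost_measurable[OF R(1)]) measurable
  also have "\<dots> = (\<integral>\<^sup>+s. (\<integral>\<^sup>+u\<in>{0..min (R n \<phi>) s}. (ennreal (exp (- lam * u)) * Ge (fl u \<phi>)) \<partial>lborel) +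
      (if s \<le> R n \<phi> then ennreal (exp (- lam * s)) * (\<integral>\<^sup>+d. policy_cost R n (jm (fl s \<phi>)) d \<partial>Sq)
       else ennreal (exp (- lam * R n \<phi>)) * ennreal b) \<partial>expo)"
  proof (rule nn_integral_cong)
    fix s
    have [measurable]: "(\<lambda>d. policy_cost R n (jm (fl s \<phi>)) d) \<in> borel_measurable Sq"
      by (rule policy_cost_measurable[OF R(1)]) measurable
    show "(\<integral>\<^sup>+d. policy_cost R (Suc n) \<phi> (case_nat s d) \<partial>Sq) =
      (\<integral>\<^sup>+u\<in>{0..min (R n \<phi>) s}. (ennreal (exp (- lam * u)) * Ge (fl u \<phi>)) \<partial>lborel) +
      (if s \<le> R n \<phi> then ennreal (exp (- lam * s)) * (\<integral>\<^sup>+d. policy_cost R n (jm (fl s \<phi>)) d \<partial>Sq)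
       else ennreal (exp (- lam * R n \<phi>)) * ennreal b)"
      by (auto simp: nn_integral_add nn_integral_cmult S.emeasure_space_1)
  qed
  also have "\<dots> = stage (\<lambda>u. Ge (fl u \<phi>)) (\<lambda>u. \<integral>\<^sup>+d. policy_cost R n (jm (fl u \<phi>)) d \<partial>Sq) (R n \<phi>)
      + ennreal (exp (- k * R n \<phi>)) * ennreal b"
  proof (rule nn_integral_ex_stage)
    have "(\<lambda>(u, d). policy_cost R n (jm (fl u \<phi>)) d) \<in> borel_measurable (borel \<Otimes>\<^sub>M Sq)"
      unfolding case_prod_beta by (rule policy_cost_measurable[OF R(1)]) measurable
    then show "(\<lambda>u. \<integral>\<^sup>+d. policy_cost R n (jm (fl u \<phi>)) d \<partial>Sq) \<in> borel_measurable borel"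
      by measurable
  qed (use R(2) in measurable)
  finally show ?thesis
    unfolding F_def using b_pos by (simp add: ennreal_mult'' mult.commute)
qed

text \<open>Each stage chooses a waiting time within \<open>e\<close> of the infimum; the errors add
  up to at most \<open>n * e\<close> because passing through a stage multiplies them by at most
  \<open>\<mu> / k \<le> 1\<close>.\<close>

lemma policy_exists:
  fixes e :: real
  assumes e: "0 < e"
  shows "\<exists>R. (\<forall>n. R n \<in> borel_measurable borel) \<and> (\<forall>n \<phi>. 0 \<le> R n \<phi>) \<and>
    (\<forall>n. \<forall>\<phi>\<in>Q. (\<integral>\<^sup>+d. policy_cost R n \<phi> d \<partial>Sq) \<le> vh n \<phi> + ennreal (n * e))"
proof -
  define A where "A = \<rat> \<inter> {0::real..}"
  have A: "countable A" "A \<noteq> {}"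
    using countable_rat by (auto simp: A_def intro: countable_subset[rotated] exI[of _ 0])
  define a where "a = from_nat_into A"
  have range_a: "range a = A" using A by (simp add: a_def range_from_nat_into)
  \<comment> \<open>Measurable selection without a selection theorem: the first nonnegative
    rational, in a fixed enumeration, that is optimal up to \<open>e\<close>.\<close>
  define R where "R = (\<lambda>n \<phi>. a (LEAST i. F (vh n) (a i) \<phi> \<le> vh (Suc n) \<phi> + ennreal e))"
  have R_meas: "R n \<in> borel_measurable borel" for n
  proof -
    have [measurable]: "Measurable.pred borel (\<lambda>\<phi>. F (vh n) (a i) \<phi> \<le> vh (Suc n) \<phi> + ennreal e)" for i
      by measurable
    have "(\<lambda>\<phi>. LEAST i. F (vh n) (a i) \<phi> \<le> vh (Suc n) \<phi> + ennreal e) \<in> measurable borel (count_space UNIV)"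
      by measurable
    then show ?thesis unfolding R_def by (rule measurable_compose) simp
  qed
  have "a i \<in> A" for i using range_a by auto
  then have R_pos: "0 \<le> R n \<phi>" for n \<phi>
    unfolding R_def A_def by auto
  have R_le: "F (vh n) (R n \<phi>) \<phi> \<le> vh (Suc n) \<phi> + ennreal e" for n \<phi>
  proof -
    have "vh (Suc n) \<phi> < vh (Suc n) \<phi> + ennreal e"
      using e vh_le_b[of "Suc n" \<phi>] by (cases "vh (Suc n) \<phi>") (auto simp: ennreal_plus[symmetric] ennreal_less_iff top_unique simp del: ennreal_plus vh.simps)
    moreover have "vh (Suc n) \<phi> = (INF q\<in>A. F (vh n) q \<phi>)"
      unfolding A_def using INF_F_rat[OF vh_measurable vh_le_b] by simp
    ultimately obtain q where "q \<in> A" "F (vh n) q \<phi> < vh (Suc n) \<phi> + ennreal e"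
      by (auto simp only: INF_less_iff)
    then have "\<exists>i. F (vh n) (a i) \<phi> \<le> vh (Suc n) \<phi> + ennreal e"
      using range_a by (metis imageE less_imp_le)
    then show ?thesis unfolding R_def by (rule LeastI_ex)
  qed
  have "(\<integral>\<^sup>+d. policy_cost R n \<phi> d \<partial>Sq) \<le> vh n \<phi> + ennreal (n * e)" if "\<phi> \<in> Q" for n \<phi>
    using that
  proof (induction n arbitrary: \<phi>)
    case 0
    interpret S: prob_space Sq by (rule prob_space_Sq)
    show ?case by (simp add: S.emeasure_space_1)
  next
    case (Suc n)
    have "(\<integral>\<^sup>+d. policy_cost R (Suc n) \<phi> d \<partial>Sq) = F (\<lambda>\<psi>. \<integral>\<^sup>+d. policy_cost R n \<psi> d \<partial>Sq) (R n \<phi>) \<phi>"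
      by (rule nn_integral_policy_cost[OF R_meas R_pos])
    also have "\<dots> \<le> F (\<lambda>\<psi>. vh n \<psi> + ennreal (n * e)) (R n \<phi>) \<phi>"
      by (intro F_mono Suc)
    also have "\<dots> \<le> F (vh n) (R n \<phi>) \<phi> + ennreal (n * e * (\<mu> / k))"
    proof -
      have "stage (\<lambda>u. Ge (fl u \<phi>)) (\<lambda>u. vh n (jm (fl u \<phi>)) + ennreal (n * e)) (R n \<phi>) \<le>
          stage (\<lambda>u. Ge (fl u \<phi>)) (\<lambda>u. vh n (jm (fl u \<phi>))) (R n \<phi>) + ennreal (n * e * (\<mu> / k))"
        using e R_pos by (intro stage_add_const_le) auto
      then have "F (\<lambda>\<psi>. vh n \<psi> + ennreal (n * e)) (R n \<phi>) \<phi> \<le>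
          (stage (\<lambda>u. Ge (fl u \<phi>)) (\<lambda>u. vh n (jm (fl u \<phi>))) (R n \<phi>) + ennreal (n * e * (\<mu> / k))) +
          ennreal (b * exp (- k * R n \<phi>))"
        unfolding F_def by (rule add_right_mono)
      then show ?thesis unfolding F_def by (simp only: ac_simps)
    qed
    also have "\<dots> \<le> (vh (Suc n) \<phi> + ennreal e) + ennreal (n * e)"
    proof (intro add_mono R_le ennreal_leI)
      have "\<mu> / k \<le> 1" using k_pos lam by (simp add: k_def)
      then show "n * e * (\<mu> / k) \<le> n * e" using e by (intro mult_left_le) auto
    qed
    also have "\<dots> = vh (Suc n) \<phi> + ennreal (Suc n * e)"
      using e by (simp add: add.assoc ennreal_plus[symmetric] algebra_simps del: ennreal_plus vh.simps)
    finally show ?case .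
  qed
  with R_meas R_pos show ?thesis by blast
qed

end

section \<open>Gaps of the Poisson process after a fixed time\<close>

locale poisson_disorder = disorder lam \<mu> c m for lam \<mu> c m +
  fixes M :: "'a measure" and N :: "real \<Rightarrow> 'a \<Rightarrow> nat" and \<sigma> :: "nat \<Rightarrow> 'a \<Rightarrow> real"
  assumes poisson: "poisson_process M \<mu> N \<sigma>"
begin

sublocale prob_space M
  using poisson by (simp add: poisson_process_def)

definition jumps :: "'a \<Rightarrow> nat \<Rightarrow> real" where "jumps \<omega> n = \<sigma> n \<omega>"

definition Ft :: "real \<Rightarrow> 'a measure" where "Ft t = natural_sigma M N t"

definition gaps_after :: "real \<Rightarrow> 'a \<Rightarrow> nat \<Rightarrow> real" where "gaps_after t \<omega> = gaps (shift_times t (jumps \<omega>))"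

lemma jump_times_sq: "\<omega> \<in> space M \<Longrightarrow> jump_times (jumps \<omega>)"
  using poisson by (simp add: poisson_process_def jump_times_def jumps_def[abs_def])

lemma N_eq: "\<omega> \<in> space M \<Longrightarrow> 0 \<le> t \<Longrightarrow> N t \<omega> = jump_count (jumps \<omega>) t"
  using poisson by (simp add: poisson_process_def jump_count_def jumps_def)

lemma space_Ft [simp]: "space (Ft t) = space M"
  by (simp add: Ft_def natural_sigma_def space_measure_of_conv)

lemma Ft_gen: "{N s -` A \<inter> space M |s A. 0 \<le> s \<and> s \<le> t} \<subseteq> Pow (space M)"
  by auto

lemma N_measurable_Ft: "0 \<le> s \<Longrightarrow> s \<le> t \<Longrightarrow> N s \<in> measurable (Ft t) (count_space UNIV)"
  unfolding measurable_def Ft_def natural_sigma_def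
  by (auto simp: sets_measure_of[OF Ft_gen] space_measure_of_conv intro!: sigma_sets.Basic)

lemma Ft_subset: "sets (Ft t) \<subseteq> sets M"
proof -
  have "N s \<in> measurable M (count_space UNIV)" if "0 \<le> s" for s
    using poisson that by (auto simp: poisson_process_def)
  then have "{N s -` A \<inter> space M |s A. 0 \<le> s \<and> s \<le> t} \<subseteq> sets M"
    by (auto simp: measurable_def)
  then show ?thesis
    unfolding Ft_def natural_sigma_def sets_measure_of[OF Ft_gen] by (rule sets.sigma_sets_subset)
qed

lemma Ft_mono: "s \<le> t \<Longrightarrow> sets (Ft s) \<subseteq> sets (Ft t)"
  unfolding Ft_def natural_sigma_def sets_measure_of[OF Ft_gen] by (rule sigma_sets_subseteq) force

lemma N_measurable: "0 \<le> s \<Longrightarrow> N s \<in> measurable M (count_space UNIV)"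
  using poisson by (auto simp: poisson_process_def)

lemma sq_le_Ft:
  assumes "a \<le> t"
  shows "{\<omega>\<in>space M. jumps \<omega> n \<le> a} \<in> sets (Ft t)"
proof (cases "0 \<le> a")
  case True
  have "{\<omega>\<in>space M. jumps \<omega> n \<le> a} = {\<omega>\<in>space (Ft t). n \<le> N a \<omega>}"
    using True jump_count_ge_iff[OF jump_times_sq True] by (auto simp: N_eq)
  also have "\<dots> \<in> sets (Ft t)"
    using N_measurable_Ft[OF True assms] by measurable
  finally show ?thesis .
next
  case False
  then have "{\<omega>\<in>space M. jumps \<omega> n \<le> a} = {}"
    using jump_timesD(5)[OF jump_times_sq] by (auto simp: not_le) (meson le_less_trans not_le)
  then show ?thesis by (simp only: sets.empty_sets)
qed

lemma sq_measurable [measurable]: "(\<lambda>\<omega>. jumps \<omega> n) \<in> borel_measurable M"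
  by (rule borel_measurableI_le) (use sq_le_Ft Ft_subset in blast)

lemma gt_measurable [measurable]: "(\<lambda>\<omega>. gaps_after t \<omega> i) \<in> borel_measurable M"
proof -
  have [measurable]: "(\<lambda>\<omega>. shift_times t (jumps \<omega>) n) \<in> borel_measurable M" for n
    by (rule shift_times_measurable[where t = "\<lambda>_. t"]) (auto intro: jump_times_sq)
  show ?thesis unfolding gaps_after_def gaps_def by measurable
qed

lemma gt_pos: "\<omega> \<in> space M \<Longrightarrow> 0 \<le> t \<Longrightarrow> 0 < gaps_after t \<omega> i"
  unfolding gaps_after_def by (intro gaps_pos jump_times_shift jump_times_sq)

lemma gt_0_le_iff:
  assumes \<omega>: "\<omega> \<in> space M" and t: "0 \<le> t" and a: "0 \<le> a"
  shows "gaps_after t \<omega> 0 \<le> a \<longleftrightarrow> N t \<omega> \<noteq> N (t + a) \<omega>"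
proof -
  let ?s = "shift_times t (jumps \<omega>)"
  have s: "jump_times ?s" by (intro jump_times_shift jump_times_sq \<omega> t)
  have "gaps_after t \<omega> 0 \<le> a \<longleftrightarrow> ?s (Suc 0) \<le> a" unfolding gaps_after_def gaps_0[OF s] ..
  also have "\<dots> \<longleftrightarrow> Suc 0 \<le> jump_count ?s a" by (rule jump_count_ge_iff[OF s a, symmetric])
  also have "\<dots> \<longleftrightarrow> N t \<omega> \<noteq> N (t + a) \<omega>"
    using jump_count_shift[OF jump_times_sq[OF \<omega>] t a] \<omega> t a by (auto simp: N_eq)
  finally show ?thesis .
qed

lemma gt_0_le_Ft:
  assumes t: "0 \<le> t" and a: "0 \<le> a" "t + a \<le> t'"
  shows "{\<omega>\<in>space M. gaps_after t \<omega> 0 \<le> a} \<in> sets (Ft t')"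
proof -
  have "{\<omega>\<in>space M. gaps_after t \<omega> 0 \<le> a} = {\<omega>\<in>space (Ft t'). real (N t \<omega>) \<noteq> real (N (t + a) \<omega>)}"
    using gt_0_le_iff t a by auto
  also have "\<dots> \<in> sets (Ft t')"
  proof -
    have [measurable]: "(\<lambda>\<omega>. real (N s \<omega>)) \<in> borel_measurable (Ft t')" if "0 \<le> s" "s \<le> t'" for s
      by (rule measurable_compose[OF N_measurable_Ft[OF that]]) simp
    then have [measurable]: "(\<lambda>\<omega>. real (N t \<omega>)) \<in> borel_measurable (Ft t')"
      "(\<lambda>\<omega>. real (N (t + a) \<omega>)) \<in> borel_measurable (Ft t')"
      using t a by auto
    show ?thesis by measurable
  qed
  finally show ?thesis .
qed

text \<open>For \<open>a > 0\<close> the event says that \<open>N\<close> has no increment from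
  \<open>t\<close> to \<open>t + a\<close>, which is independent of the past; for
  \<open>a \<le> 0\<close> both factors on the gap side are \<open>1\<close>.\<close>

lemma prob_gt_0:
  assumes t: "0 \<le> t" and A: "A \<in> sets (Ft t)"
  shows "prob (A \<inter> {\<omega>\<in>space M. a < gaps_after t \<omega> 0}) = prob A * measure expo {a<..}"
proof (cases "0 < a")
  case False
  have "{\<omega>\<in>space M. a < gaps_after t \<omega> 0} = space M"
    using False gt_pos[OF _ t, of _ 0] by force
  moreover have "A \<inter> space M = A" using A Ft_subset sets.sets_into_space by blast
  moreover have "measure expo {a<..} = 1"
  proof -
    interpret expo: prob_space expo by (rule prob_space_ex)
    have "1 = emeasure expo {0<..}" using emeasure_ex_atLeast(2)[of 0] by simp
    also have "\<dots> \<le> emeasure expo {a<..}" using False by (intro emeasure_mono) auto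
    finally show ?thesis using expo.prob_le_1[of "{a<..}"] by (simp add: expo.emeasure_eq_measure)
  qed
  ultimately show ?thesis by simp
next
  case True
  let ?D = "\<lambda>\<omega>. N (t + a) \<omega> - N t \<omega>"
  have ind: "indep_set (sets (Ft t)) {?D -` B \<inter> space M |B. True}"
    and dis: "distr M (count_space UNIV) ?D = measure_pmf (poisson_pmf (\<mu> * (t + a - t)))"
    using poisson t True unfolding poisson_process_def Ft_def by auto
  have D: "{\<omega>\<in>space M. a < gaps_after t \<omega> 0} = ?D -` {0} \<inter> space M"
  proof -
    have "a < gaps_after t \<omega> 0 \<longleftrightarrow> ?D \<omega> = 0" if \<omega>: "\<omega> \<in> space M" for \<omega>
    proof -
      have "N t \<omega> \<le> N (t + a) \<omega>"
        using jump_count_shift[OF jump_times_sq[OF \<omega>] t, of a] True t \<omega> by (simp add: N_eq)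
      moreover have "gaps_after t \<omega> 0 \<le> a \<longleftrightarrow> N t \<omega> \<noteq> N (t + a) \<omega>"
        using gt_0_le_iff[OF \<omega> t, of a] True by simp
      ultimately show ?thesis by (cases "N t \<omega> = N (t + a) \<omega>") simp_all
    qed
    then show ?thesis by auto
  qed
  have [measurable]: "N t \<in> measurable M (count_space UNIV)" "N (t + a) \<in> measurable M (count_space UNIV)"
    using t True by (auto intro!: N_measurable)
  have [measurable]: "?D \<in> measurable M (count_space UNIV)"
    by measurable
  have "prob (?D -` {0} \<inter> space M) = measure (distr M (count_space UNIV) ?D) {0}"
    by (simp add: measure_distr)
  also have "\<dots> = exp (- \<mu> * a)"
    unfolding dis using mu_pos True by (simp add: measure_pmf_single)
  also have "\<dots> = measure expo {a<..}"
    using emeasure_ex_atLeast(2)[of a] True by (simp add: measure_def)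
  finally show ?thesis
    unfolding D using indep_setD[OF ind A, of "?D -` {0} \<inter> space M"] by auto
qed

text \<open>The hypotheses place \<open>u\<close> between the first and the second jump after
  \<open>t\<close>, so seen from \<open>u\<close> only the gap in progress is shortened.\<close>

lemma gt_after_first_jump:
  assumes \<omega>: "\<omega> \<in> space M" and t: "0 \<le> t" and u: "t + gaps_after t \<omega> 0 \<le> u" "u < t + gaps_after t \<omega> 0 + gaps_after t \<omega> (Suc 0)"
  shows "gaps_after u \<omega> i = (if i = 0 then t + gaps_after t \<omega> 0 + gaps_after t \<omega> (Suc 0) - u else gaps_after t \<omega> (Suc i))"
proof -
  let ?s = "jumps \<omega>" and ?c = "jump_count (jumps \<omega>) t"
  have s: "jump_times ?s" by (rule jump_times_sq[OF \<omega>])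
  have g: "gaps_after t \<omega> 0 = ?s (Suc ?c) - t" "\<And>i. gaps_after t \<omega> (Suc i) = ?s (?c + Suc (Suc i)) - ?s (?c + Suc i)"
    by (simp_all add: gaps_after_def gaps_def shift_times_def)
  have "jump_count ?s u = Suc ?c"
    using u by (intro jump_count_eqI[OF s]) (simp_all add: g)
  then show ?thesis by (auto simp: g gaps_after_def gaps_def shift_times_def)
qed

text \<open>The first jump after \<open>t\<close> is rounded up to a multiple of \<open>h\<close>, where the induction hypothesis
  applies, and \<open>h\<close> tends to \<open>0\<close>; this replaces the strong Markov property.\<close>

lemma prob_gt:
  assumes "0 \<le> t" "A \<in> sets (Ft t)"
  shows "prob (A \<inter> {\<omega>\<in>space M. \<forall>i<n. \<alpha> i < gaps_after t \<omega> i}) = prob A * (\<Prod>i<n. measure expo {\<alpha> i<..})"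
  using assms
proof (induction n arbitrary: t A \<alpha>)
  case 0
  then have "A \<inter> space M = A" using Ft_subset sets.sets_into_space by blast
  then show ?case by simp
next
  case (Suc n)
  note t = \<open>0 \<le> t\<close> and A = \<open>A \<in> sets (Ft t)\<close>
  have AM: "A \<in> sets M" using A Ft_subset by blast
  define \<alpha>' where "\<alpha>' = (\<lambda>i. \<alpha> (Suc i))"
  define P' where "P' = (\<Prod>i<n. measure expo {\<alpha>' i<..})"
  \<comment> \<open>\<open>t + h * \<kappa> h \<omega>\<close> is the first grid point at or after
    the first jump; \<open>S h\<close> observes the later gaps from there instead of from the
    jump.\<close>
  define \<kappa> where "\<kappa> = (\<lambda>h \<omega>. nat \<lceil>gaps_after t \<omega> 0 / h\<rceil>)"
  define S where "S = (\<lambda>h. {\<omega>\<in>A. \<alpha> 0 < gaps_after t \<omega> 0 \<and> (\<forall>i<n. \<alpha>' i < gaps_after (t + h * \<kappa> h \<omega>) \<omega> i)})"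
  have S: "prob (S h) = prob A * measure expo {\<alpha> 0<..} * P'" "S h \<in> sets M" if h: "0 < h" for h
  proof -
    \<comment> \<open>The events \<open>B i\<close> fix the grid point \<open>t + h * i\<close>.
      They belong to the past of this deterministic time, so the induction hypothesis factors each
      \<open>B i \<inter> E i\<close>.\<close>
    define B where "B = (\<lambda>i. {\<omega>\<in>A. \<alpha> 0 < gaps_after t \<omega> 0 \<and> \<kappa> h \<omega> = i})"
    define E where "E = (\<lambda>i. {\<omega>\<in>space M. \<forall>j<n. \<alpha>' j < gaps_after (t + h * real i) \<omega> j})"
    have B: "B i \<in> sets (Ft (t + h * i))" for i
    proof (cases i)
      case 0
      have "0 < \<kappa> h \<omega>" if "\<omega> \<in> A" for \<omega>
        using gt_pos[OF _ t, of \<omega> 0] that h sets.sets_into_space[OF AM] by (auto simp: \<kappa>_def)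
      then have "B i = {}" using 0 by (auto simp: B_def)
      then show ?thesis by simp
    next
      case (Suc j)
      define x where "x = max (\<alpha> 0) (h * j)"
      have x: "0 \<le> x" using h by (simp add: x_def max.coboundedI2)
      have "\<kappa> h \<omega> = i \<longleftrightarrow> h * j < gaps_after t \<omega> 0 \<and> gaps_after t \<omega> 0 \<le> h * i" for \<omega>
      proof -
        have "\<kappa> h \<omega> = i \<longleftrightarrow> \<lceil>gaps_after t \<omega> 0 / h\<rceil> = int i"
          using Suc by (auto simp: \<kappa>_def)
        also have "\<dots> \<longleftrightarrow> real j < gaps_after t \<omega> 0 / h \<and> gaps_after t \<omega> 0 / h \<le> real i"
          unfolding ceiling_eq_iff using Suc by auto
        finally show ?thesis using h by (simp add: pos_less_divide_eq pos_divide_le_eq mult.commute)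
      qed
      then have "B i = A \<inter> {\<omega>\<in>space M. gaps_after t \<omega> 0 \<le> h * i} - {\<omega>\<in>space M. gaps_after t \<omega> 0 \<le> x}"
        using sets.sets_into_space[OF AM] by (auto simp: B_def x_def)
      \<comment> \<open>The level is cut at \<open>h * i\<close> to keep the event observable by
        \<open>t + h * i\<close>; the difference of sets does not change, since it only contains
        gaps up to \<open>h * i\<close>.\<close>
      moreover have "{\<omega>\<in>space M. gaps_after t \<omega> 0 \<le> min x (h * i)} \<in> sets (Ft (t + h * i))"
        using x h t by (intro gt_0_le_Ft) auto
      moreover have "{\<omega>\<in>space M. gaps_after t \<omega> 0 \<le> h * i} \<in> sets (Ft (t + h * i))"
        using h t by (intro gt_0_le_Ft) auto
      moreover have "A \<in> sets (Ft (t + h * i))" using Ft_mono[of t "t + h * i"] A h by auto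
      moreover have "A \<inter> {\<omega>\<in>space M. gaps_after t \<omega> 0 \<le> h * i} - {\<omega>\<in>space M. gaps_after t \<omega> 0 \<le> x} =
        A \<inter> {\<omega>\<in>space M. gaps_after t \<omega> 0 \<le> h * i} - {\<omega>\<in>space M. gaps_after t \<omega> 0 \<le> min x (h * i)}" by auto
      ultimately show ?thesis by (simp only: sets.Int sets.Diff)
    qed
    have BM: "B i \<in> sets M" for i using B Ft_subset by blast
    have EM: "E i \<in> sets M" for i unfolding E_def by measurable
    have "S h = (\<Union>i. B i \<inter> E i)"
      using sets.sets_into_space[OF AM] by (auto simp: S_def B_def E_def)
    then show "S h \<in> sets M" using BM EM by auto
    have "(\<lambda>i. prob (B i \<inter> E i)) sums prob (\<Union>i. B i \<inter> E i)"
      using BM EM by (intro finite_measure_UNION) (auto simp: disjoint_family_on_def B_def)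
    moreover have "prob (B i \<inter> E i) = prob (B i) * P'" for i
      unfolding E_def P'_def using t h by (intro Suc.IH B) auto
    moreover have "(\<lambda>i. prob (B i)) sums prob (\<Union>i. B i)"
      using BM by (intro finite_measure_UNION) (auto simp: disjoint_family_on_def B_def)
    then have "(\<lambda>i. prob (B i) * P') sums (prob (\<Union>i. B i) * P')"
      by (rule sums_mult2)
    moreover have "(\<Union>i. B i) = A \<inter> {\<omega>\<in>space M. \<alpha> 0 < gaps_after t \<omega> 0}"
      using sets.sets_into_space[OF AM] by (auto simp: B_def)
    ultimately have "prob (\<Union>i. B i \<inter> E i) = prob A * measure expo {\<alpha> 0<..} * P'"
      using prob_gt_0[OF t A, of "\<alpha> 0"] by (auto dest: sums_unique2)
    then show "prob (S h) = prob A * measure expo {\<alpha> 0<..} * P'"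
      using \<open>S h = (\<Union>i. B i \<inter> E i)\<close> by simp
  qed
  define T where "T = A \<inter> {\<omega>\<in>space M. \<forall>i<Suc n. \<alpha> i < gaps_after t \<omega> i}"
  have T: "T \<in> sets M" unfolding T_def using AM by measurable
  define h where "h = (\<lambda>j. 1 / real (Suc j))"
  have h: "0 < h j" for j by (simp add: h_def)
  have "(\<lambda>j. \<integral>\<omega>. indicator (S (h j)) \<omega> \<partial>M) \<longlonglongrightarrow> (\<integral>\<omega>. (indicator T \<omega> :: real) \<partial>M)"
  proof (rule integral_dominated_convergence[where w = "\<lambda>_. 1"])
    show "AE \<omega> in M. (\<lambda>j. indicator (S (h j)) \<omega>) \<longlonglongrightarrow> (indicator T \<omega> :: real)"
    proof (rule AE_I2)
      fix \<omega> assume \<omega>: "\<omega> \<in> space M"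
      let ?g = "gaps_after t \<omega>"
      \<comment> \<open>For a mesh below \<open>d\<close> the grid point precedes the second jump,
        and shortening the next gap by less than the mesh does not affect whether it exceeds
        \<open>\<alpha> 1\<close>: if it does, the surplus is larger, and if not, shortening cannot
        help.\<close>
      define d where "d = (if \<alpha> 1 < ?g 1 then min (?g 1) (?g 1 - \<alpha> 1) else ?g 1)"
      have d: "0 < d" using gt_pos[OF \<omega> t, of 1] by (auto simp: d_def)
      have "eventually (\<lambda>j. h j < d) sequentially"
        unfolding h_def using order_tendstoD(2)[OF LIMSEQ_Suc[OF lim_1_over_n] d] by simp
      moreover have "indicator (S (h j)) \<omega> = (indicator T \<omega> :: real)" if j: "h j < d" for j
      proof -
        define u where "u = t + h j * \<kappa> (h j) \<omega>"
        have "real (\<kappa> (h j) \<omega>) = of_int \<lceil>?g 0 / h j\<rceil>"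
        proof -
          have "0 < ?g 0 / h j" using gt_pos[OF \<omega> t, of 0] h[of j] by simp
          then have "0 \<le> \<lceil>?g 0 / h j\<rceil>" by simp
          then show ?thesis by (simp add: \<kappa>_def)
        qed
        then have K: "?g 0 / h j \<le> real (\<kappa> (h j) \<omega>)" "real (\<kappa> (h j) \<omega>) < ?g 0 / h j + 1"
          by linarith+
        have "(?g 0 / h j + 1) * h j = ?g 0 + h j" using h[of j] by (simp add: distrib_right)
        then have "?g 0 \<le> h j * real (\<kappa> (h j) \<omega>)" "h j * real (\<kappa> (h j) \<omega>) < ?g 0 + h j"
          using K(1) mult_strict_right_mono[OF K(2) h[of j]] h[of j]
          by (simp_all add: pos_divide_le_eq mult.commute)
        then have u: "t + ?g 0 \<le> u" "u < t + ?g 0 + h j" by (auto simp: u_def)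
        have "h j < ?g 1" using j by (auto simp: d_def split: if_splits)
        then have gu: "gaps_after u \<omega> i = (if i = 0 then t + ?g 0 + ?g 1 - u else ?g (Suc i))" for i
          using gt_after_first_jump[OF \<omega> t, of u i] u by simp
        have "\<alpha>' 0 < gaps_after u \<omega> 0 \<longleftrightarrow> \<alpha> 1 < ?g 1"
          using u j unfolding gu by (auto simp: d_def \<alpha>'_def split: if_splits)
        then have "\<alpha>' i < gaps_after u \<omega> i \<longleftrightarrow> \<alpha> (Suc i) < ?g (Suc i)" for i
          by (cases "i = 0") (simp_all add: gu \<alpha>'_def)
        then have "\<omega> \<in> S (h j) \<longleftrightarrow> \<omega> \<in> T"
          unfolding S_def T_def using \<omega> by (auto simp: All_less_Suc2 u_def[symmetric])
        then show ?thesis by (simp add: indicator_def)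
      qed
      ultimately have "eventually (\<lambda>j. indicator (S (h j)) \<omega> = (indicator T \<omega> :: real)) sequentially"
        by (auto elim: eventually_mono)
      then show "(\<lambda>j. indicator (S (h j)) \<omega>) \<longlonglongrightarrow> (indicator T \<omega> :: real)"
        by (rule tendsto_eventually)
    qed
  qed (use T S(2)[OF h] in \<open>auto split: split_indicator\<close>)
  then have "(\<lambda>j. prob (S (h j))) \<longlonglongrightarrow> prob T"
    using T S(2)[OF h] by simp
  then have "prob T = prob A * measure expo {\<alpha> 0<..} * P'"
    unfolding S(1)[OF h] by (simp add: LIMSEQ_const_iff)
  then show ?case
    unfolding T_def P'_def \<alpha>'_def by (simp add: prod.lessThan_Suc_shift del: prod.lessThan_Suc)
qed

section \<open>Independence of the gaps from the past\<close>

definition tails :: "(nat \<Rightarrow> real) set set" where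
  "tails = range (\<lambda>(n, \<alpha>). {d. \<forall>i<n. \<alpha> i < d i})"

lemma tailsI: "{d. \<forall>i<n. \<alpha> i < d i} \<in> tails"
  unfolding tails_def by (rule range_eqI[of _ _ "(n, \<alpha>)"]) simp

lemma Int_stable_tails: "Int_stable tails"
proof (rule Int_stableI)
  fix X Y assume "X \<in> tails" "Y \<in> tails"
  then obtain n \<alpha> n' \<alpha>' where X: "X = {d. \<forall>i<n. \<alpha> i < d i}" and Y: "Y = {d. \<forall>i<n'. \<alpha>' i < d i}"
    unfolding tails_def by auto
  let ?\<beta> = "\<lambda>i. if i < n \<and> i < n' then max (\<alpha> i) (\<alpha>' i) else if i < n then \<alpha> i else \<alpha>' i"
  have "X \<inter> Y = {d. \<forall>i<max n n'. ?\<beta> i < d i}"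
    unfolding X Y by (auto simp: less_max_iff_disj)
  then show "X \<inter> Y \<in> tails" by (simp only: tailsI)
qed

text \<open>\<open>tails\<close> is the intersection-stable system on which \<open>prob_gt\<close>
  computes probabilities, so it only remains to see that it generates the product
  sigma-algebra.\<close>

lemma sets_Sq: "sets Sq = sigma_sets UNIV tails"
proof -
  have "{d. \<forall>i<n. \<alpha> i < d i} \<in> sets Sq" for n \<alpha>
  proof -
    have "{d\<in>space Sq. \<forall>i<n. \<alpha> i < d i} \<in> sets Sq" by measurable
    then show ?thesis by (simp add: space_PiM)
  qed
  then have "tails \<subseteq> sets Sq" by (auto simp: tails_def)
  then have "sigma_sets (space Sq) tails \<subseteq> sets Sq" by (rule sets.sigma_sets_subset)
  moreover have "sets Sq \<subseteq> sets (sigma UNIV tails)"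
  proof -
    have "(\<lambda>d. d i) \<in> borel_measurable (sigma UNIV tails)" for i :: nat
    proof (rule borel_measurableI_greater)
      fix a :: real
      \<comment> \<open>A set in \<open>tails\<close> bounds all coordinates below some index, so
        the ones before \<open>i\<close> get the bounds \<open>- real q\<close>, which become
        vacuous in the union over \<open>q\<close>.\<close>
      have "{d \<in> space (sigma UNIV tails). a < d i} = (\<Union>q::nat. {d. \<forall>j<Suc i. (if j = i then a else - real q) < d j})"
      proof (intro set_eqI iffI)
        fix d assume d: "d \<in> {d \<in> space (sigma UNIV tails). a < d i}"
        obtain q :: nat where q: "Max ((\<lambda>j. \<bar>d j\<bar>) ` {..i}) < real q" using reals_Archimedean2 by blast
        have "\<bar>d j\<bar> < real q" if "j \<le> i" for j
          using q that by (meson Max_ge atMost_iff finite_atMost finite_imageI image_eqI le_less_trans)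
        then have "- real q < d j" if "j \<le> i" for j using that by (meson abs_less_iff minus_less_iff)
        then show "d \<in> (\<Union>q::nat. {d. \<forall>j<Suc i. (if j = i then a else - real q) < d j})"
          using d by (intro UN_I[of q]) auto
      qed (auto simp: space_measure_of_conv)
      also have "\<dots> \<in> sets (sigma UNIV tails)"
      proof -
        have T: "X \<in> sets (sigma UNIV tails)" if "X \<in> tails" for X using that by simp
        show ?thesis by (intro sets.countable_UN image_subsetI T tailsI)
      qed
      finally show "{d \<in> space (sigma UNIV tails). a < d i} \<in> sets (sigma UNIV tails)" .
    qed
    then have "(\<lambda>d. d) \<in> measurable (sigma UNIV tails) Sq"
      by (intro measurable_PiM_single') (auto simp: measurable_cong_sets[OF refl sets_ex] space_measure_of_conv)
    then show ?thesis
      using measurable_sets[of "\<lambda>d. d" "sigma UNIV tails" Sq] by (fastforce simp: space_measure_of_conv)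
  qed
  ultimately show ?thesis by (auto simp: space_PiM)
qed

lemma emeasure_Sq_tail: "emeasure Sq {d. \<forall>i<n. \<alpha> i < d i} = ennreal (\<Prod>i<n. measure expo {\<alpha> i<..})"
proof -
  interpret expo: prob_space expo by (rule prob_space_ex)
  have "{d. \<forall>i<n. \<alpha> i < d i} = prod_emb UNIV (\<lambda>_. expo) {..<n} (\<Pi>\<^sub>E i\<in>{..<n}. {\<alpha> i<..})"
    by (auto simp: prod_emb_iff restrict_PiE_iff Pi_iff)
  then have "emeasure Sq {d. \<forall>i<n. \<alpha> i < d i} = (\<Prod>i<n. emeasure expo {\<alpha> i<..})"
    by (simp only:) (intro emeasure_PiM_emb, auto intro: prob_space_ex)
  then show ?thesis by (simp add: expo.emeasure_eq_measure prod_ennreal)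
qed

lemma gt_measurable_Sq [measurable]: "gaps_after t \<in> measurable M Sq"
  by (rule measurable_PiM_single') (auto simp: measurable_cong_sets[OF refl sets_ex])

text \<open>For fixed \<open>A\<close>, both sides are finite measures in \<open>B\<close> that
  agree on \<open>tails\<close>.\<close>

lemma gt_law_Ft:
  assumes t: "0 \<le> t" and A: "A \<in> sets (Ft t)" and B: "B \<in> sets Sq"
  shows "emeasure M (A \<inter> gaps_after t -` B) = emeasure M A * emeasure Sq B"
proof -
  have AM: "A \<in> sets M" using A Ft_subset by blast
  interpret S: prob_space Sq by (rule prob_space_Sq)
  let ?M1 = "distr (density M (indicator A)) Sq (gaps_after t)" and ?M2 = "scale_measure (emeasure M A) Sq"
  have 1: "emeasure ?M1 X = emeasure M (A \<inter> gaps_after t -` X)" if "X \<in> sets Sq" for X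
  proof -
    have "emeasure ?M1 X = (\<integral>\<^sup>+\<omega>. indicator A \<omega> * indicator (gaps_after t -` X \<inter> space M) \<omega> \<partial>M)"
      using AM that by (simp add: emeasure_distr emeasure_density)
    also have "\<dots> = (\<integral>\<^sup>+\<omega>. indicator (A \<inter> (gaps_after t -` X \<inter> space M)) \<omega> \<partial>M)"
      by (intro nn_integral_cong) (auto split: split_indicator)
    also have "\<dots> = emeasure M (A \<inter> (gaps_after t -` X \<inter> space M))"
      using AM that by (intro nn_integral_indicator) auto
    also have "A \<inter> (gaps_after t -` X \<inter> space M) = A \<inter> gaps_after t -` X" using sets.sets_into_space[OF AM] by auto
    finally show ?thesis .
  qed
  have "?M1 = ?M2"
  proof (rule measure_eqI_generator_eq[OF Int_stable_tails, where \<Omega> = UNIV and A = "\<lambda>_. UNIV"])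
    fix X assume "X \<in> tails"
    then obtain n \<alpha> where X: "X = {d. \<forall>i<n. \<alpha> i < d i}" by (auto simp: tails_def)
    have XS: "X \<in> sets Sq" unfolding sets_Sq by (rule sigma_sets.Basic) fact
    have "A \<inter> gaps_after t -` X = A \<inter> {\<omega>\<in>space M. \<forall>i<n. \<alpha> i < gaps_after t \<omega> i}"
      using sets.sets_into_space[OF AM] by (auto simp: X)
    then have "emeasure M (A \<inter> gaps_after t -` X) = ennreal (prob A * (\<Prod>i<n. measure expo {\<alpha> i<..}))"
      using prob_gt[OF t A] by (simp add: emeasure_eq_measure)
    also have "\<dots> = emeasure M A * emeasure Sq X"
      unfolding X emeasure_Sq_tail by (simp add: emeasure_eq_measure ennreal_mult')
    finally show "emeasure ?M1 X = emeasure ?M2 X" using 1[OF XS] by simp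
  next
    show "range (\<lambda>_. UNIV) \<subseteq> tails" using tailsI[of 0] by auto
    show "emeasure ?M1 UNIV \<noteq> \<infinity>" using 1[of UNIV] sets.top[of Sq] by (simp add: space_PiM emeasure_eq_measure)
  qed (auto simp: sets_Sq)
  then show ?thesis using 1[OF B] by simp
qed

text \<open>Null sets are added, but no right limit is taken: an event in
  \<open>augmented_filtration M N t\<close> lies in \<open>aug u\<close> for every
  \<open>u > t\<close>, which is all that the grid argument uses.\<close>

definition aug :: "real \<Rightarrow> 'a measure" where
  "aug t = sigma (space M) (sets (Ft t) \<union> null_sets M)"

lemma space_aug [simp]: "space (aug t) = space M"
  by (simp add: aug_def space_measure_of_conv)

lemma sets_aug: "sets (aug t) = sigma_sets (space M) (sets (Ft t) \<union> null_sets M)"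
proof -
  have "sets (Ft t) \<union> null_sets M \<subseteq> sets M" using Ft_subset by auto
  also have "sets M \<subseteq> Pow (space M)" by (rule sets.space_closed)
  finally show ?thesis unfolding aug_def by (rule sets_measure_of)
qed

lemma aug_subset: "sets (aug t) \<subseteq> sets M"
  unfolding sets_aug using Ft_subset by (intro sets.sigma_sets_subset) auto

lemma Ft_subset_aug: "sets (Ft t) \<subseteq> sets (aug t)"
  unfolding sets_aug by auto

text \<open>The sets that agree almost everywhere with one in \<open>Ft t\<close> form a
  sigma-algebra containing the generators. Independence thus carries over from \<open>Ft t\<close>
  to \<open>aug t\<close>.\<close>

lemma aug_AE_Ft:
  assumes "A \<in> sets (aug t)"
  shows "\<exists>A'\<in>sets (Ft t). AE \<omega> in M. \<omega> \<in> A \<longleftrightarrow> \<omega> \<in> A'"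
  using assms unfolding sets_aug
proof (induction rule: sigma_sets.induct)
  case (Basic a)
  then show ?case
  proof
    assume "a \<in> null_sets M"
    then show ?thesis by (intro bexI[of _ "{}"]) (auto dest: AE_not_in)
  qed auto
next
  case Empty
  then show ?case by (intro bexI[of _ "{}"]) auto
next
  case (Compl a)
  then obtain A' where A': "A' \<in> sets (Ft t)" "AE \<omega> in M. \<omega> \<in> a \<longleftrightarrow> \<omega> \<in> A'" by blast
  have "AE \<omega> in M. \<omega> \<in> space M - a \<longleftrightarrow> \<omega> \<in> space M - A'" using A'(2) by eventually_elim auto
  moreover have "space M - A' \<in> sets (Ft t)" using sets.compl_sets[OF A'(1)] by simp
  ultimately show ?case by blast
next
  case (Union a)
  then have "\<forall>i. \<exists>A'\<in>sets (Ft t). AE \<omega> in M. \<omega> \<in> a i \<longleftrightarrow> \<omega> \<in> A'" by blast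
  then obtain A' where A': "\<And>i. A' i \<in> sets (Ft t)" "\<And>i. AE \<omega> in M. \<omega> \<in> a i \<longleftrightarrow> \<omega> \<in> A' i" by metis
  have "AE \<omega> in M. \<forall>i. \<omega> \<in> a i \<longleftrightarrow> \<omega> \<in> A' i" using A'(2) by (simp add: AE_all_countable)
  then have "AE \<omega> in M. \<omega> \<in> \<Union> (range a) \<longleftrightarrow> \<omega> \<in> \<Union> (range A')" by eventually_elim auto
  moreover have "\<Union> (range A') \<in> sets (Ft t)" using A'(1) by auto
  ultimately show ?case by blast
qed

lemma gt_law_aug:
  assumes t: "0 \<le> t" and A: "A \<in> sets (aug t)" and B: "B \<in> sets Sq"
  shows "emeasure M (A \<inter> gaps_after t -` B) = emeasure M A * emeasure Sq B"
proof -
  obtain A' where A': "A' \<in> sets (Ft t)" "AE \<omega> in M. \<omega> \<in> A \<longleftrightarrow> \<omega> \<in> A'" using aug_AE_Ft[OF A] by blast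
  have M: "A \<in> sets M" "A' \<in> sets M" using A A' Ft_subset aug_subset by auto
  have eq: "X \<inter> gaps_after t -` B = X \<inter> (gaps_after t -` B \<inter> space M)" if "X \<in> sets M" for X
    using sets.sets_into_space[OF that] by auto
  have "emeasure M (A \<inter> gaps_after t -` B) = emeasure M (A' \<inter> gaps_after t -` B)"
    unfolding eq[OF M(1)] eq[OF M(2)]
    using A'(2) M measurable_sets[OF gt_measurable_Sq B] by (intro emeasure_eq_AE) (auto elim: eventually_mono)
  also have "\<dots> = emeasure M A' * emeasure Sq B" by (rule gt_law_Ft[OF t A'(1) B])
  also have "emeasure M A' = emeasure M A" using A'(2) M by (intro emeasure_eq_AE) auto
  finally show ?thesis .
qed

text \<open>The freezing lemma: what is known at time \<open>t\<close> is independent of the gaps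
  after \<open>t\<close>, so the joint law is a product and the gaps can be integrated out with
  \<open>X\<close> fixed.\<close>

lemma nn_integral_gt:
  assumes t: "0 \<le> t" and X: "X \<in> measurable (aug t) S'" and H: "H \<in> borel_measurable (S' \<Otimes>\<^sub>M Sq)"
  shows "(\<integral>\<^sup>+\<omega>. H (X \<omega>, gaps_after t \<omega>) \<partial>M) = (\<integral>\<^sup>+\<omega>. (\<integral>\<^sup>+d. H (X \<omega>, d) \<partial>Sq) \<partial>M)"
proof -
  interpret S: prob_space Sq by (rule prob_space_Sq)
  have XM [measurable]: "X \<in> measurable M S'"
    using X aug_subset[of t] by (auto simp: measurable_def)
  interpret DX: prob_space "distr M S' X" by (rule prob_space_distr[OF XM])
  have "distr M S' X \<Otimes>\<^sub>M Sq = distr M (S' \<Otimes>\<^sub>M Sq) (\<lambda>\<omega>. (X \<omega>, gaps_after t \<omega>))"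
  proof (rule pair_measure_eqI)
    fix A B assume A: "A \<in> sets (distr M S' X)" and B: "B \<in> sets Sq"
    then have A': "A \<in> sets S'" by simp
    have "(\<lambda>\<omega>. (X \<omega>, gaps_after t \<omega>)) -` (A \<times> B) \<inter> space M = (X -` A \<inter> space M) \<inter> gaps_after t -` B" by auto
    moreover have "X -` A \<inter> space M \<in> sets (aug t)" using measurable_sets[OF X A'] by simp
    ultimately show "emeasure (distr M S' X) A * emeasure Sq B = emeasure (distr M (S' \<Otimes>\<^sub>M Sq) (\<lambda>\<omega>. (X \<omega>, gaps_after t \<omega>))) (A \<times> B)"
      using gt_law_aug[OF t _ B] A' B by (simp add: emeasure_distr)
  qed (auto simp: S.sigma_finite_measure_axioms DX.sigma_finite_measure_axioms cong: sets_pair_measure_cong)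
  then have "(\<integral>\<^sup>+\<omega>. H (X \<omega>, gaps_after t \<omega>) \<partial>M) = (\<integral>\<^sup>+p. H p \<partial>(distr M S' X \<Otimes>\<^sub>M Sq))"
    using H by (simp add: nn_integral_distr)
  also have "\<dots> = (\<integral>\<^sup>+x. (\<integral>\<^sup>+d. H (x, d) \<partial>Sq) \<partial>distr M S' X)"
    using H by (intro S.nn_integral_fst[symmetric]) (simp cong: measurable_cong_sets)
  also have "\<dots> = (\<integral>\<^sup>+\<omega>. (\<integral>\<^sup>+d. H (X \<omega>, d) \<partial>Sq) \<partial>M)"
    using H by (intro nn_integral_distr) (auto intro!: S.borel_measurable_nn_integral_fst)
  finally show ?thesis .
qed

section \<open>Reduction of the model to the value iteration\<close>

lemma Phi_eq_path:
  assumes "\<omega> \<in> space M" "0 \<le> t"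
  shows "Phi lam \<mu> m N \<sigma> \<phi> t \<omega> = path \<phi> (jumps \<omega>) t"
proof -
  have "Phi_at_jump lam \<mu> m \<sigma> \<phi> n \<omega> = Zj \<phi> (jumps \<omega>) n" for n
    by (induction n) (simp_all add: fl_def jm_def jumps_def)
  then show ?thesis
    unfolding Phi_def path_def Let_def N_eq[OF assms] by (simp add: fl_def jumps_def)
qed

lemma running_cost_eq: "running_cost lam c \<phi> = G \<phi> - lam * b"
  by (simp add: running_cost_def G_def b_def)

lemma gt_0: "\<omega> \<in> space M \<Longrightarrow> gaps_after 0 \<omega> = gaps (jumps \<omega>)"
  unfolding gaps_after_def by (rule gaps_shift_0[OF jump_times_sq])

text \<open>The freezing identity at time \<open>0\<close> with a trivial past, a one-point
  space.\<close>

lemma nn_integral_gaps: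
  assumes [measurable]: "H \<in> borel_measurable Sq"
  shows "(\<integral>\<^sup>+\<omega>. H (gaps (jumps \<omega>)) \<partial>M) = (\<integral>\<^sup>+d. H d \<partial>Sq)"
proof -
  have "(\<integral>\<^sup>+\<omega>. H (gaps (jumps \<omega>)) \<partial>M) = (\<integral>\<^sup>+\<omega>. H (gaps_after 0 \<omega>) \<partial>M)"
    by (intro nn_integral_cong) (simp add: gt_0)
  also have "\<dots> = (\<integral>\<^sup>+\<omega>. (\<lambda>p. H (snd p)) ((), gaps_after 0 \<omega>) \<partial>M)" by simp
  also have "\<dots> = (\<integral>\<^sup>+\<omega>. (\<integral>\<^sup>+d. (\<lambda>p. H (snd p)) ((), d) \<partial>Sq) \<partial>M)"
    by (rule nn_integral_gt[where S' = "count_space UNIV"]) auto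
  also have "\<dots> = (\<integral>\<^sup>+d. H d \<partial>Sq)" by (simp add: emeasure_space_1)
  finally show ?thesis .
qed

lemma nn_integral_first_jump:
  assumes [measurable]: "f \<in> borel_measurable borel"
  shows "(\<integral>\<^sup>+\<omega>. f (\<sigma> 1 \<omega>) \<partial>M) = (\<integral>\<^sup>+s. f s \<partial>expo)"
proof -
  interpret S: prob_space Sq by (rule prob_space_Sq)
  have "(\<integral>\<^sup>+\<omega>. f (\<sigma> 1 \<omega>) \<partial>M) = (\<integral>\<^sup>+\<omega>. f (gaps (jumps \<omega>) 0) \<partial>M)"
    by (intro nn_integral_cong) (simp add: gaps_0[OF jump_times_sq], simp add: jumps_def)
  also have "\<dots> = (\<integral>\<^sup>+d. f (d 0) \<partial>Sq)" by (rule nn_integral_gaps) measurable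
  also have "\<dots> = (\<integral>\<^sup>+s. f s \<partial>expo)"
    by (subst nn_integral_Sq_split) (measurable, simp add: S.emeasure_space_1)
  finally show ?thesis .
qed

definition flow_cost :: "real \<times> real \<Rightarrow> real \<Rightarrow> ennreal" where
  "flow_cost \<phi> a = (\<integral>\<^sup>+u\<in>{0..a}. (ennreal (exp (- lam * u)) * Ge (fl u \<phi>)) \<partial>lborel)"

lemma Cf_measurable [measurable]: "flow_cost \<phi> \<in> borel_measurable borel"
  unfolding flow_cost_def by (rule nn_integral_Icc_measurable) measurable

text \<open>The constant \<open>lam * b\<close> integrates to
  \<open>b * (1 - exp (- lam * a))\<close>, which together with the discounted stopping cost
  produces the shift by \<open>b\<close>.\<close>

lemma Cf_real:
  assumes \<phi>: "\<phi> \<in> Q" and a: "0 \<le> a"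
  shows "flow_cost \<phi> a < \<infinity>"
    "(LINT u:{0..a}|lborel. exp (- lam * u) * (G (fl u \<phi>) - lam * b)) = enn2real (flow_cost \<phi> a) - b * (1 - exp (- lam * a))"
proof -
  let ?f = "\<lambda>u. exp (- lam * u) * G (fl u \<phi>)" and ?g = "\<lambda>u. exp (- lam * u) * (lam * b)"
  have int: "set_integrable lborel {0..a} ?f" "set_integrable lborel {0..a} ?g"
    by (intro borel_integrable_atLeastAtMost' continuous_intros G_fl_continuous)+
  have nn: "0 \<le> ?f u" if "0 \<le> u" for u
    using G_nonneg[OF fl_Q[OF \<phi> that]] by simp
  have "flow_cost \<phi> a = (\<integral>\<^sup>+u. ennreal (indicator {0..a} u *\<^sub>R ?f u) \<partial>lborel)"
    unfolding flow_cost_def by (intro nn_integral_cong) (auto split: split_indicator simp: ennreal_mult')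
  also have "\<dots> = ennreal (LINT u:{0..a}|lborel. ?f u)"
    unfolding set_lebesgue_integral_def
    by (rule nn_integral_eq_integral) (use int nn in \<open>auto simp: set_integrable_def split: split_indicator\<close>)
  finally have C: "flow_cost \<phi> a = ennreal (LINT u:{0..a}|lborel. ?f u)" .
  then show "flow_cost \<phi> a < \<infinity>" by simp
  have "0 \<le> (LINT u:{0..a}|lborel. ?f u)"
    unfolding set_lebesgue_integral_def
    by (rule integral_nonneg_AE) (use nn in \<open>auto split: split_indicator\<close>)
  then have f: "(LINT u:{0..a}|lborel. ?f u) = enn2real (flow_cost \<phi> a)" using C by simp
  have "(LINT u:{0..a}|lborel. ?g u) = (\<integral>u. ?g u * indicator {0..a} u \<partial>lborel)"
    unfolding set_lebesgue_integral_def by (simp add: mult.commute)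
  also have "\<dots> = (- b * exp (- lam * a)) - (- b * exp (- lam * 0))"
    by (rule integral_FTC_Icc_nonneg) (use a lam b_pos in \<open>auto intro!: derivative_eq_intros\<close>)
  finally have g: "(LINT u:{0..a}|lborel. ?g u) = b * (1 - exp (- lam * a))" by (simp add: algebra_simps)
  have "(LINT u:{0..a}|lborel. exp (- lam * u) * (G (fl u \<phi>) - lam * b)) = (LINT u:{0..a}|lborel. ?f u - ?g u)"
    by (simp add: algebra_simps)
  also have "\<dots> = enn2real (flow_cost \<phi> a) - b * (1 - exp (- lam * a))"
    using set_integral_diff(2)[OF int] f g by simp
  finally show "(LINT u:{0..a}|lborel. exp (- lam * u) * (G (fl u \<phi>) - lam * b)) = enn2real (flow_cost \<phi> a) - b * (1 - exp (- lam * a))" .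
qed

lemma LINT_Phi:
  assumes \<omega>: "\<omega> \<in> space M" and a: "a \<le> \<sigma> 1 \<omega>"
  shows "(LINT u:{0..a}|lborel. exp (- lam * u) * running_cost lam c (Phi lam \<mu> m N \<sigma> \<phi> u \<omega>)) =
    (LINT u:{0..a}|lborel. exp (- lam * u) * (G (fl u \<phi>) - lam * b))"
  unfolding set_lebesgue_integral_def
proof (rule integral_cong_AE)
  have [measurable]: "path \<phi> (jumps \<omega>) \<in> borel_measurable borel" by (rule path_measurable_time[OF jump_times_sq[OF \<omega>]])
  have "(\<lambda>u. indicator {0..a} u *\<^sub>R (exp (- lam * u) * running_cost lam c (Phi lam \<mu> m N \<sigma> \<phi> u \<omega>))) =
    (\<lambda>u. indicator {0..a} u *\<^sub>R (exp (- lam * u) * (G (path \<phi> (jumps \<omega>) u) - lam * b)))"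
    by (auto simp: fun_eq_iff running_cost_eq Phi_eq_path[OF \<omega>] split: split_indicator)
  then show "(\<lambda>u. indicator {0..a} u *\<^sub>R (exp (- lam * u) * running_cost lam c (Phi lam \<mu> m N \<sigma> \<phi> u \<omega>))) \<in> borel_measurable lborel"
    by simp
  show "AE u in lborel. indicator {0..a} u *\<^sub>R (exp (- lam * u) * running_cost lam c (Phi lam \<mu> m N \<sigma> \<phi> u \<omega>)) =
      indicator {0..a} u *\<^sub>R (exp (- lam * u) * (G (fl u \<phi>) - lam * b))"
    using AE_lborel_singleton[of "\<sigma> 1 \<omega>"]
  proof eventually_elim
    fix u assume "u \<noteq> \<sigma> 1 \<omega>"
    then show "indicator {0..a} u *\<^sub>R (exp (- lam * u) * running_cost lam c (Phi lam \<mu> m N \<sigma> \<phi> u \<omega>)) =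
      indicator {0..a} u *\<^sub>R (exp (- lam * u) * (G (fl u \<phi>) - lam * b))"
      using a path_before_first[OF jump_times_sq[OF \<omega>], of u \<phi>]
      by (auto split: split_indicator simp: running_cost_eq Phi_eq_path[OF \<omega>] jumps_def)
  qed
qed measurable

lemma Phi_first_jump:
  assumes "\<omega> \<in> space M"
  shows "Phi lam \<mu> m N \<sigma> \<phi> (\<sigma> 1 \<omega>) \<omega> = jm (fl (\<sigma> 1 \<omega>) \<phi>)"
  using Phi_eq_path[OF assms, of "\<sigma> 1 \<omega>" \<phi>] path_first[OF jump_times_sq[OF assms], of \<phi>]
    jump_timesD(5)[OF jump_times_sq[OF assms], of 1] by (simp add: jumps_def)

lemma sigma1_nonneg: "\<omega> \<in> space M \<Longrightarrow> 0 \<le> \<sigma> 1 \<omega>"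
  using jump_timesD(5)[OF jump_times_sq, of \<omega> 1] by (simp add: jumps_def)

lemma sigma1_measurable [measurable]: "\<sigma> 1 \<in> borel_measurable M"
  using sq_measurable[of 1] by (simp add: jumps_def)

text \<open>\<open>F_ext\<close> extends \<open>F\<close> to the waiting time \<open>\<infinity>\<close>.\<close>

definition F_ext :: "(real \<times> real \<Rightarrow> ennreal) \<Rightarrow> ennreal \<Rightarrow> real \<times> real \<Rightarrow> ennreal" where
  "F_ext w t \<phi> = (\<integral>\<^sup>+s. flow_cost \<phi> (if t = \<infinity> then s else min (enn2real t) s) +
      (if ennreal s \<le> t then ennreal (exp (- lam * s)) * w (jm (fl s \<phi>))
       else ennreal (exp (- lam * enn2real t)) * ennreal b) \<partial>expo)"

lemma AE_ex_nonneg: "AE s in expo. 0 \<le> s"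
  unfolding expo_def by (subst AE_density) (auto simp: exponential_density_def)

lemma Fx_real:
  assumes [measurable]: "w \<in> borel_measurable borel" and t: "0 \<le> t"
  shows "F_ext w (ennreal t) \<phi> = F w t \<phi>"
proof -
  have "F_ext w (ennreal t) \<phi> = (\<integral>\<^sup>+s. flow_cost \<phi> (min t s) +
      (if s \<le> t then ennreal (exp (- lam * s)) * w (jm (fl s \<phi>))
       else ennreal (exp (- lam * t)) * ennreal b) \<partial>expo)"
    unfolding F_ext_def using t by (intro nn_integral_cong) simp
  also have "\<dots> = stage (\<lambda>u. Ge (fl u \<phi>)) (\<lambda>u. w (jm (fl u \<phi>))) t + ennreal (exp (- k * t)) * ennreal b"
    unfolding flow_cost_def by (rule nn_integral_ex_stage) (use t in measurable)
  also have "\<dots> = F w t \<phi>"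
    unfolding F_def using b_pos by (simp add: ennreal_mult'[symmetric] mult.commute)
  finally show ?thesis .
qed

text \<open>Cutting an infinite wait at \<open>t\<close> adds at most the stopping cost on the event
  of no jump before \<open>t\<close>, which vanishes as \<open>t\<close> grows. Hence the infimum
  over real waiting times already covers \<open>\<infinity>\<close>.\<close>

lemma Fx_infinity_ge:
  assumes [measurable]: "w \<in> borel_measurable borel" and t: "0 \<le> t"
  shows "F w t \<phi> \<le> F_ext w \<infinity> \<phi> + ennreal (b * exp (- k * t))"
proof -
  have "F w t \<phi> = (\<integral>\<^sup>+s. flow_cost \<phi> (min t s) +
      (if s \<le> t then ennreal (exp (- lam * s)) * w (jm (fl s \<phi>))
       else ennreal (exp (- lam * t)) * ennreal b) \<partial>expo)"
    unfolding Fx_real[OF assms, symmetric] F_ext_def using t by (intro nn_integral_cong) simp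
  also have "\<dots> \<le> (\<integral>\<^sup>+s. (flow_cost \<phi> s + ennreal (exp (- lam * s)) * w (jm (fl s \<phi>))) +
      ennreal (exp (- lam * t)) * ennreal b * indicator {t<..} s \<partial>expo)"
  proof (intro nn_integral_mono)
    fix s
    have "flow_cost \<phi> (min t s) \<le> flow_cost \<phi> s"
      unfolding flow_cost_def by (intro nn_integral_mono) (auto split: split_indicator)
    then show "flow_cost \<phi> (min t s) + (if s \<le> t then ennreal (exp (- lam * s)) * w (jm (fl s \<phi>)) else ennreal (exp (- lam * t)) * ennreal b)
      \<le> (flow_cost \<phi> s + ennreal (exp (- lam * s)) * w (jm (fl s \<phi>))) + ennreal (exp (- lam * t)) * ennreal b * indicator {t<..} s"
      by (auto split: split_indicator intro!: add_mono add_increasing2)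
  qed
  also have "\<dots> = (\<integral>\<^sup>+s. flow_cost \<phi> s + ennreal (exp (- lam * s)) * w (jm (fl s \<phi>)) \<partial>expo) +
      (\<integral>\<^sup>+s. ennreal (exp (- lam * t)) * ennreal b * indicator {t<..} s \<partial>expo)"
    by (rule nn_integral_add) measurable
  also have "(\<integral>\<^sup>+s. ennreal (exp (- lam * t)) * ennreal b * indicator {t<..} s \<partial>expo) = ennreal (b * exp (- k * t))"
  proof -
    have "(\<integral>\<^sup>+s. ennreal (exp (- lam * t)) * ennreal b * indicator {t<..} s \<partial>expo) = ennreal b * ennreal (exp (- k * t))"
      unfolding exp_k using emeasure_ex_atLeast(2)[OF t]
      by (subst nn_integral_cmult_indicator) (simp_all only: sets_ex borel_open open_greaterThan ac_simps)
    then show ?thesis using b_pos by (simp add: ennreal_mult'[symmetric])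
  qed
  finally show ?thesis by (simp add: F_ext_def)
qed

text \<open>Monotone limit of the bounds \<open>stage_G_le\<close>, which are uniform in the
  horizon; the jump term is at most \<open>b\<close>.\<close>

lemma Fx_infinity_finite:
  assumes [measurable]: "w \<in> borel_measurable borel" and w: "\<And>\<psi>. w \<psi> \<le> ennreal b" and \<phi>: "\<phi> \<in> Q"
  shows "F_ext w \<infinity> \<phi> < \<infinity>"
proof -
  interpret expo: prob_space expo by (rule prob_space_ex)
  have "(\<integral>\<^sup>+s. flow_cost \<phi> s \<partial>expo) = (\<integral>\<^sup>+u\<in>{0..}. (ennreal (exp (- \<mu> * u)) * (ennreal (exp (- lam * u)) * Ge (fl u \<phi>))) \<partial>lborel)"
    unfolding flow_cost_def by (rule nn_integral_ex_cumulative) measurable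
  also have "\<dots> = (\<integral>\<^sup>+u. (SUP i::nat. ennreal (exp (- k * u)) * (Ge (fl u \<phi>) + ennreal \<mu> * 0) * indicator {0..real i} u) \<partial>lborel)"
  proof (rule nn_integral_cong)
    fix u :: real
    obtain i0 :: nat where i0: "u \<le> real i0" using real_arch_simple by blast
    let ?c = "ennreal (exp (- k * u)) * (Ge (fl u \<phi>) + ennreal \<mu> * 0)"
    have "(SUP i::nat. ?c * indicator {0..real i} u) = ?c * indicator {0..} u"
    proof (rule antisym)
      show "?c * indicator {0..} u \<le> (SUP i::nat. ?c * indicator {0..real i} u)"
        using i0 by (intro SUP_upper2[of i0]) (auto split: split_indicator)
    qed (auto intro!: SUP_least split: split_indicator)
    then show "ennreal (exp (- \<mu> * u)) * (ennreal (exp (- lam * u)) * Ge (fl u \<phi>)) * indicator {0..} u =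
      (SUP i::nat. ?c * indicator {0..real i} u)"
      unfolding exp_k by (simp add: ac_simps)
  qed
  also have "\<dots> = (SUP i::nat. stage (\<lambda>u. Ge (fl u \<phi>)) (\<lambda>_. 0) (real i))"
    unfolding stage_def
    by (rule nn_integral_monotone_convergence_SUP)
       (auto simp: incseq_def le_fun_def split: split_indicator)
  also have "\<dots> \<le> ennreal (U \<phi> / (\<mu> - 1))"
    by (intro SUP_least stage_G_le \<phi>) simp
  finally have C: "(\<integral>\<^sup>+s. flow_cost \<phi> s \<partial>expo) \<le> ennreal (U \<phi> / (\<mu> - 1))" .
  have "F_ext w \<infinity> \<phi> = (\<integral>\<^sup>+s. flow_cost \<phi> s \<partial>expo) + (\<integral>\<^sup>+s. ennreal (exp (- lam * s)) * w (jm (fl s \<phi>)) \<partial>expo)"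
    unfolding F_ext_def by (simp add: nn_integral_add)
  also have "\<dots> \<le> ennreal (U \<phi> / (\<mu> - 1)) + (\<integral>\<^sup>+s. ennreal b \<partial>expo)"
  proof (intro add_mono C nn_integral_mono_AE)
    show "AE s in expo. ennreal (exp (- lam * s)) * w (jm (fl s \<phi>)) \<le> ennreal b"
      using AE_ex_nonneg
    proof eventually_elim
      fix s :: real assume "0 \<le> s"
      then have "ennreal (exp (- lam * s)) * w (jm (fl s \<phi>)) \<le> 1 * ennreal b"
        using lam by (intro mult_mono w) (auto simp flip: ennreal_1 intro!: ennreal_leI)
      then show "ennreal (exp (- lam * s)) * w (jm (fl s \<phi>)) \<le> ennreal b" by simp
    qed
  qed
  also have "\<dots> < \<infinity>" using expo.emeasure_space_1 by simp
  finally show ?thesis .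
qed

text \<open>The shift is checked pathwise: the running cost yields
  \<open>- b * (1 - exp (- lam * a))\<close>, and the terminal part completes it to
  \<open>- b\<close>, either through \<open>v = w - b\<close> at a jump or through the stopping
  cost. All terms are finite, so Bochner and nonnegative integrals match.\<close>

lemma J_op_eq:
  assumes w: "w \<in> borel_measurable borel" "\<And>\<psi>. w \<psi> \<le> ennreal b"
    and v: "\<And>\<psi>. \<psi> \<in> Q \<Longrightarrow> v \<psi> = enn2real (w \<psi>) - b" and \<phi>: "\<phi> \<in> Q"
  shows "J_op lam \<mu> c m M N \<sigma> v t \<phi> = enn2real (F_ext w t \<phi>) - b"
proof -
  note w(1)[measurable]
  define H where "H = (\<lambda>s. flow_cost \<phi> (if t = \<infinity> then s else min (enn2real t) s) +
      (if ennreal s \<le> t then ennreal (exp (- lam * s)) * w (jm (fl s \<phi>))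
       else ennreal (exp (- lam * enn2real t)) * ennreal b))"
  have [measurable]: "H \<in> borel_measurable borel" unfolding H_def by measurable
  have fin: "F_ext w t \<phi> < \<infinity>"
  proof (cases t)
    case (real r)
    have "F w r \<phi> \<le> F_ext w \<infinity> \<phi> + ennreal (b * exp (- k * r))"
      using real by (intro Fx_infinity_ge w)
    then show ?thesis
      using Fx_infinity_finite[OF w \<phi>] real Fx_real[OF w(1), of r \<phi>] by (auto simp: less_top[symmetric] top_unique)
  qed (use Fx_infinity_finite[OF w \<phi>] in simp)
  have wfin: "w \<psi> < \<infinity>" for \<psi> using w(2)[of \<psi>] by (auto simp: less_top[symmetric] top_unique)
  have pt: "(LINT u:{u. 0 \<le> u \<and> ennreal u \<le> min t (ennreal (\<sigma> 1 \<omega>))}|lborel.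
              exp (- lam * u) * running_cost lam c (Phi lam \<mu> m N \<sigma> \<phi> u \<omega>))
          + (if ennreal (\<sigma> 1 \<omega>) \<le> t
             then exp (- lam * \<sigma> 1 \<omega>) * v (Phi lam \<mu> m N \<sigma> \<phi> (\<sigma> 1 \<omega>) \<omega>) else 0) = enn2real (H (\<sigma> 1 \<omega>)) - b \<and> H (\<sigma> 1 \<omega>) < \<infinity>"
    if \<omega>: "\<omega> \<in> space M" for \<omega>
  proof -
    let ?s = "\<sigma> 1 \<omega>"
    have s: "0 \<le> ?s" by (rule sigma1_nonneg[OF \<omega>])
    define a where "a = (if t = \<infinity> then ?s else min (enn2real t) ?s)"
    have a: "0 \<le> a" "a \<le> ?s" using s by (auto simp: a_def)
    have set: "{u. 0 \<le> u \<and> ennreal u \<le> min t (ennreal ?s)} = {0..a}"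
      using s by (cases t) (auto simp: a_def min_def top_unique)
    show ?thesis
    proof (cases "ennreal ?s \<le> t")
      case True
      then have as: "a = ?s" using s by (cases t) (auto simp: a_def)
      have \<psi>: "jm (fl ?s \<phi>) \<in> Q" by (intro jm_Q fl_Q \<phi> s)
      have "enn2real (H ?s) = enn2real (flow_cost \<phi> ?s) + exp (- lam * ?s) * enn2real (w (jm (fl ?s \<phi>)))"
        unfolding H_def a_def[symmetric] as using True Cf_real(1)[OF \<phi> s] wfin[of "jm (fl ?s \<phi>)"]
        by (simp add: enn2real_plus enn2real_mult ennreal_mult_less_top)
      moreover have "H ?s < \<infinity>"
        unfolding H_def a_def[symmetric] as using True Cf_real(1)[OF \<phi> s] wfin[of "jm (fl ?s \<phi>)"]
        by (simp add: ennreal_mult_less_top)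
      ultimately show ?thesis
        unfolding set LINT_Phi[OF \<omega> a(2)] Cf_real(2)[OF \<phi> a(1)] Phi_first_jump[OF \<omega>] v[OF \<psi>]
        using True by (simp add: as algebra_simps)
    next
      case False
      then have at: "a = enn2real t" "t \<noteq> \<infinity>" using s by (cases t; auto simp: a_def)+
      have "enn2real (H ?s) = enn2real (flow_cost \<phi> a) + exp (- lam * a) * b"
        unfolding H_def a_def[symmetric] using False Cf_real(1)[OF \<phi> a(1)] b_pos
        by (simp add: enn2real_plus enn2real_mult ennreal_mult_less_top at(1))
      moreover have "H ?s < \<infinity>"
        unfolding H_def a_def[symmetric] using False Cf_real(1)[OF \<phi> a(1)]
        by (simp add: ennreal_mult_less_top)
      ultimately show ?thesis
        unfolding set LINT_Phi[OF \<omega> a(2)] Cf_real(2)[OF \<phi> a(1)]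
        using False by (simp add: algebra_simps)
    qed
  qed
  have nn: "(\<integral>\<^sup>+\<omega>. H (\<sigma> 1 \<omega>) \<partial>M) = F_ext w t \<phi>"
    unfolding F_ext_def H_def[symmetric] by (rule nn_integral_first_jump) measurable
  have "(\<integral>\<^sup>+\<omega>. ennreal (enn2real (H (\<sigma> 1 \<omega>))) \<partial>M) = F_ext w t \<phi>"
    unfolding nn[symmetric] using pt by (intro nn_integral_cong) (simp add: ennreal_enn2real)
  then have nn': "(\<integral>\<^sup>+\<omega>. ennreal (enn2real (H (\<sigma> 1 \<omega>))) \<partial>M) = ennreal (enn2real (F_ext w t \<phi>))"
    using fin by (simp add: ennreal_enn2real)
  have meas: "(\<lambda>\<omega>. enn2real (H (\<sigma> 1 \<omega>))) \<in> borel_measurable M" by measurable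
  have has: "integrable M (\<lambda>\<omega>. enn2real (H (\<sigma> 1 \<omega>)))"
    by (rule integrableI_nn_integral_finite[OF meas _ nn']) simp
  have int: "(\<integral>\<omega>. enn2real (H (\<sigma> 1 \<omega>)) \<partial>M) = enn2real (F_ext w t \<phi>)"
    unfolding integral_eq_nn_integral[OF meas AE_I2[OF enn2real_nonneg]] nn' by simp
  have "J_op lam \<mu> c m M N \<sigma> v t \<phi> = (\<integral>\<omega>. enn2real (H (\<sigma> 1 \<omega>)) - b \<partial>M)"
    unfolding J_op_def using pt by (intro Bochner_Integration.integral_cong) auto
  also have "\<dots> = enn2real (F_ext w t \<phi>) - b"
    using has int by (simp add: prob_space)
  finally show ?thesis .
qed

text \<open>The induction hypothesis is needed on \<open>Q\<close> only, as jumps from flows in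
  \<open>Q\<close> stay there. In contrast to \<open>vh\<close>, the infimum ranges over
  \<open>\<infinity>\<close> too, which \<open>Fx_infinity_ge\<close> absorbs.\<close>

lemma v_seq_eq: "\<phi> \<in> Q \<Longrightarrow> v_seq lam \<mu> c m M N \<sigma> n \<phi> = enn2real (vh n \<phi>) - b"
proof (induction n arbitrary: \<phi>)
  case 0
  then show ?case using b_pos by simp
next
  case (Suc n)
  note \<phi> = \<open>\<phi> \<in> Q\<close>
  let ?J = "\<lambda>u. enn2real (F_ext (vh n) u \<phi>) - b"
  have J: "J_op lam \<mu> c m M N \<sigma> (v_seq lam \<mu> c m M N \<sigma> n) u \<phi> = ?J u" for u
    by (rule J_op_eq[OF vh_measurable vh_le_b Suc.IH \<phi>])
  have fin: "F_ext (vh n) u \<phi> < \<infinity>" for u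
  proof (cases u)
    case (real r)
    have "F (vh n) r \<phi> \<le> F_ext (vh n) \<infinity> \<phi> + ennreal (b * exp (- k * r))"
      using real by (intro Fx_infinity_ge) auto
    then show ?thesis
      using Fx_infinity_finite[OF vh_measurable vh_le_b \<phi>, of n] real Fx_real[OF vh_measurable, of r n \<phi>]
      by (auto simp: less_top[symmetric] top_unique)
  qed (use Fx_infinity_finite[OF vh_measurable vh_le_b \<phi>, of n] in simp)
  have ge: "vh (Suc n) \<phi> \<le> F_ext (vh n) u \<phi>" for u
  proof (cases u)
    case (real r)
    then show ?thesis using vh_le_F[of r n \<phi>] Fx_real[OF vh_measurable, of r n \<phi>] by simp
  next
    case top
    have "vh (Suc n) \<phi> \<le> F_ext (vh n) \<infinity> \<phi> + ennreal (b * exp (- k * real i))" for i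
      using order_trans[OF vh_le_F Fx_infinity_ge[OF vh_measurable], of "real i" n \<phi>] by simp
    moreover have "(\<lambda>i. F_ext (vh n) \<infinity> \<phi> + ennreal (b * exp (- k * real i))) \<longlonglongrightarrow> F_ext (vh n) \<infinity> \<phi> + ennreal (b * 0)"
    proof (intro tendsto_intros tendsto_add tendsto_ennrealI tendsto_mult)
      have "filterlim (\<lambda>i. - k * real i) at_bot sequentially"
        using k_pos filterlim_real_sequentially by (intro filterlim_tendsto_neg_mult_at_bot[OF tendsto_const]) auto
      then show "(\<lambda>i. exp (- k * real i)) \<longlonglongrightarrow> 0" by (rule filterlim_compose[OF exp_at_bot])
    qed
    ultimately have "vh (Suc n) \<phi> \<le> F_ext (vh n) \<infinity> \<phi> + ennreal (b * 0)" by (intro LIMSEQ_le_const) auto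
    then show ?thesis using top by simp
  qed
  have le: "enn2real (vh (Suc n) \<phi>) - b \<le> ?J u" for u
    using enn2real_mono[OF ge[of u]] fin[of u] by simp
  then have bdd: "bdd_below (range ?J)" by (rule bdd_belowI2)
  have "(INF u\<in>{0..}. ?J u) = enn2real (vh (Suc n) \<phi>) - b"
  proof (rule antisym)
    show "enn2real (vh (Suc n) \<phi>) - b \<le> (INF u\<in>{0..}. ?J u)"
      using le by (intro cINF_greatest) auto
    show "(INF u\<in>{0..}. ?J u) \<le> enn2real (vh (Suc n) \<phi>) - b"
    proof (rule field_le_epsilon)
      fix e :: real assume e: "0 < e"
      have *: "x < x + ennreal e" if "x \<le> ennreal b" for x
        using that e by (cases x) (auto simp: ennreal_plus[symmetric] ennreal_less_iff top_unique simp del: ennreal_plus)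
      have "(INF t\<in>{0..}. F (vh n) t \<phi>) < vh (Suc n) \<phi> + ennreal e"
        using *[OF vh_le_b[of "Suc n"]] by simp
      then obtain t where t: "0 \<le> t" "F (vh n) t \<phi> \<le> vh (Suc n) \<phi> + ennreal e"
        unfolding INF_less_iff by (meson atLeast_iff less_imp_le)
      have vfin: "vh (Suc n) \<phi> < \<infinity>" using vh_le_b[of "Suc n" \<phi>] by (auto simp: less_top[symmetric] top_unique simp del: vh.simps)
      have "(INF u\<in>{0..}. ?J u) \<le> ?J (ennreal t)"
        by (intro cINF_lower bdd_below_mono[OF bdd]) auto
      also have "\<dots> \<le> enn2real (vh (Suc n) \<phi> + ennreal e) - b"
        unfolding Fx_real[OF vh_measurable t(1)] using t(2) vfin
        by (intro diff_right_mono enn2real_mono) (auto simp del: vh.simps)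
      also have "\<dots> = enn2real (vh (Suc n) \<phi>) - b + e"
        using e vfin by (subst enn2real_plus) (auto simp del: vh.simps)
      finally show "(INF u\<in>{0..}. ?J u) \<le> enn2real (vh (Suc n) \<phi>) - b + e" .
    qed
  qed
  then show ?case unfolding v_seq.simps J_inf_def J .
qed

lemma stopping_region_n_eq: "stopping_region_n lam \<mu> c m M N \<sigma> n = \<Gamma>n n"
proof -
  have *: "enn2real (vh n \<phi>) - b = 0 \<longleftrightarrow> vh n \<phi> = ennreal b" for \<phi>
    using vh_le_b[of n \<phi>] b_pos by (cases "vh n \<phi>") (auto simp: top_unique)
  then show ?thesis
    unfolding stopping_region_n_def \<Gamma>n_def Q_def[symmetric]
    by (intro Collect_cong conj_cong refl) (simp only: v_seq_eq *)
qed

end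

section \<open>Extended integrals as differences of nonnegative integrals\<close>

lemma e2ennreal_diff:
  assumes "q < \<infinity>"
  shows "e2ennreal (enn2ereal p - enn2ereal q) = p - q" "e2ennreal (- (enn2ereal p - enn2ereal q)) = q - p"
proof -
  obtain q' where q: "q = ennreal q'" "0 \<le> q'" using assms by (cases q) auto
  have "e2ennreal (enn2ereal p - enn2ereal q) = p - q \<and> e2ennreal (- (enn2ereal p - enn2ereal q)) = q - p"
  proof (cases p)
    case (real p')
    then show ?thesis using q by (simp add: ennreal.rep_eq max_def ennreal_minus e2ennreal_ereal)
  next
    case top
    then show ?thesis using q by (simp add: ennreal_top_minus e2ennreal_neg top_ereal_def)
  qed
  then show "e2ennreal (enn2ereal p - enn2ereal q) = p - q" "e2ennreal (- (enn2ereal p - enn2ereal q)) = q - p" by auto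
qed

text \<open>Subtraction in \<open>ennreal\<close> is truncated, so \<open>p - q\<close> and
  \<open>q - p\<close> are the positive and negative parts of \<open>f\<close>. Integrating
  \<open>(p - q) + q = (q - p) + p\<close> and cancelling the finite integrals gives the
  claim.\<close>

lemma ext_integral_diff:
  assumes [measurable]: "p \<in> borel_measurable M" "q \<in> borel_measurable M"
    and fin: "(\<integral>\<^sup>+x. q x \<partial>M) < \<infinity>" "\<And>x. x \<in> space M \<Longrightarrow> q x < \<infinity>"
    and f: "\<And>x. x \<in> space M \<Longrightarrow> f x = enn2ereal (p x) - enn2ereal (q x)"
  shows "ext_integral M f = enn2ereal (\<integral>\<^sup>+x. p x \<partial>M) - enn2ereal (\<integral>\<^sup>+x. q x \<partial>M)"
proof -
  let ?A = "\<integral>\<^sup>+x. p x - q x \<partial>M" and ?B = "\<integral>\<^sup>+x. q x - p x \<partial>M"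
  have 1: "(\<integral>\<^sup>+x. e2ennreal (f x) \<partial>M) = ?A"
    using f fin by (intro nn_integral_cong) (simp add: e2ennreal_diff)
  have 2: "(\<integral>\<^sup>+x. e2ennreal (- f x) \<partial>M) = ?B"
    by (intro nn_integral_cong) (simp only: f e2ennreal_diff(2)[OF fin(2)])
  have "?A + (\<integral>\<^sup>+x. q x \<partial>M) = (\<integral>\<^sup>+x. (p x - q x) + q x \<partial>M)" by (simp add: nn_integral_add)
  also have "\<dots> = (\<integral>\<^sup>+x. (q x - p x) + p x \<partial>M)"
  proof (rule nn_integral_cong)
    fix x assume "x \<in> space M"
    then show "(p x - q x) + q x = (q x - p x) + p x"
      using fin(2)[of x] by (cases "p x \<le> q x") (auto simp: diff_add_cancel_ennreal diff_eq_0_iff_ennreal not_le less_imp_le intro: le_less_trans)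
  qed
  also have "\<dots> = ?B + (\<integral>\<^sup>+x. p x \<partial>M)" by (simp add: nn_integral_add)
  finally have eq: "?A + (\<integral>\<^sup>+x. q x \<partial>M) = ?B + (\<integral>\<^sup>+x. p x \<partial>M)" .
  have "?B \<le> (\<integral>\<^sup>+x. q x \<partial>M)" by (intro nn_integral_mono) (simp add: diff_le_self_ennreal)
  then have "?B < \<infinity>" using fin(1) by simp
  then show ?thesis
    unfolding ext_integral_def 1 2 using eq fin(1)
    by (cases ?A; cases ?B; cases "\<integral>\<^sup>+x. p x \<partial>M"; cases "\<integral>\<^sup>+x. q x \<partial>M")
       (auto simp: ennreal_plus[symmetric] ennreal.rep_eq max_def top_unique simp del: ennreal_plus)
qed

context poisson_disorder begin

text \<open>The case distinction is essential: \<open>enn2real\<close> sends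
  \<open>\<infinity>\<close> to \<open>0\<close>, which would give the discount \<open>1\<close> for
  never stopping.\<close>

definition disc :: "ennreal \<Rightarrow> real" where "disc t = (if t = \<infinity> then 0 else exp (- lam * enn2real t))"

lemma disc_bounds: "0 \<le> disc t" "disc t \<le> 1"
  using lam by (auto simp: disc_def)

lemma disc_measurable [measurable]: "disc \<in> borel_measurable borel"
  unfolding disc_def[abs_def] by measurable

lemma disc_ennreal [simp]: "0 \<le> t \<Longrightarrow> disc (ennreal t) = exp (- lam * t)"
  by (simp add: disc_def)

definition tcost :: "real \<times> real \<Rightarrow> ('a \<Rightarrow> ennreal) \<Rightarrow> 'a \<Rightarrow> ennreal" where
  "tcost \<phi> \<tau> \<omega> = (\<integral>\<^sup>+u. ennreal (exp (- lam * u)) * Ge (path \<phi> (jumps \<omega>) u) * indicator {u. 0 \<le> u \<and> ennreal u \<le> \<tau> \<omega>} u \<partial>lborel)"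

lemma joint_path_measurable:
  "(\<lambda>p. path \<phi> (jumps (fst p)) (snd p)) \<in> borel_measurable (M \<Otimes>\<^sub>M borel)"
  by (rule path_measurable) (auto intro: jump_times_sq simp: space_pair_measure)

lemma joint_path_measurable_lborel [measurable]:
  "(\<lambda>p. path \<phi> (jumps (fst p)) (snd p)) \<in> borel_measurable (M \<Otimes>\<^sub>M lborel)"
  using joint_path_measurable by (simp cong: measurable_cong_sets)

lemma path_at_measurable [measurable]: "(\<lambda>\<omega>. path \<phi> (jumps \<omega>) t) \<in> borel_measurable M"
  by (rule path_measurable) (auto intro: jump_times_sq)

lemma tcost_measurable [measurable]:
  assumes [measurable]: "\<tau> \<in> borel_measurable M"
  shows "tcost \<phi> \<tau> \<in> borel_measurable M"
proof -
  have "tcost \<phi> \<tau> = (\<lambda>\<omega>. \<integral>\<^sup>+u. ennreal (exp (- lam * u)) * Ge (path \<phi> (jumps \<omega>) u) * (if 0 \<le> u \<and> ennreal u \<le> \<tau> \<omega> then 1 else 0) \<partial>lborel)"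
    unfolding tcost_def[abs_def] by (intro ext nn_integral_cong) (auto split: split_indicator)
  also have "\<dots> \<in> borel_measurable M"
    by (rule lborel.borel_measurable_nn_integral) (unfold split_beta', measurable)
  finally show ?thesis .
qed

lemma stopping_time_measurable:
  assumes "\<tau> \<in> stopping_times M N"
  shows "\<tau> \<in> borel_measurable M"
    "0 \<le> t \<Longrightarrow> t < u \<Longrightarrow> {\<omega>\<in>space M. \<tau> \<omega> \<le> ennreal t} \<in> sets (aug u)"
proof -
  show *: "{\<omega>\<in>space M. \<tau> \<omega> \<le> ennreal t} \<in> sets (aug u)" if "0 \<le> t" "t < u" for t u
    using assms that unfolding stopping_times_def augmented_filtration_def sets_aug Ft_def by auto
  show "\<tau> \<in> borel_measurable M"
  proof (rule borel_measurableI_le)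
    fix y
    show "{\<omega>\<in>space M. \<tau> \<omega> \<le> y} \<in> sets M"
    proof (cases y)
      case (real r)
      then show ?thesis using *[of r "r + 1"] aug_subset by auto
    qed simp
  qed
qed

lemma nn_integral_discount:
  "(\<integral>\<^sup>+u. ennreal (exp (- lam * u) * (lam * b)) * indicator {u. 0 \<le> u \<and> ennreal u \<le> t} u \<partial>lborel) = ennreal (b * (1 - disc t))"
proof (cases t)
  case (real r)
  have "(\<integral>\<^sup>+u. ennreal (exp (- lam * u) * (lam * b)) * indicator {u. 0 \<le> u \<and> ennreal u \<le> t} u \<partial>lborel) =
    (\<integral>\<^sup>+u. ennreal (exp (- lam * u) * (lam * b)) * indicator {0..r} u \<partial>lborel)"
    using real by (intro nn_integral_cong) (auto split: split_indicator)
  also have "\<dots> = ennreal ((- b * exp (- lam * r)) - (- b * exp (- lam * 0)))"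
    by (rule nn_integral_FTC_Icc) (use real lam b_pos in \<open>auto intro!: derivative_eq_intros\<close>)
  finally show ?thesis using real by (simp add: algebra_simps)
next
  case top
  have "(\<integral>\<^sup>+u. ennreal (exp (- lam * u) * (lam * b)) * indicator {u. 0 \<le> u \<and> ennreal u \<le> t} u \<partial>lborel) =
    (\<integral>\<^sup>+u. ennreal (exp (- lam * u) * (lam * b)) * indicator {0..} u \<partial>lborel)"
    using top by (intro nn_integral_cong) (auto split: split_indicator)
  also have "\<dots> = ennreal (0 - (- b * exp (- lam * 0)))"
  proof (rule nn_integral_FTC_atLeast)
    have "filterlim (\<lambda>s. - lam * s) at_bot at_top"
      using lam filterlim_ident by (intro filterlim_tendsto_neg_mult_at_bot[OF tendsto_const]) auto
    then have "((\<lambda>s. exp (- lam * s)) \<longlongrightarrow> 0) at_top" by (rule filterlim_compose[OF exp_at_bot])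
    then show "((\<lambda>s. - b * exp (- lam * s)) \<longlongrightarrow> 0) at_top" by (rule tendsto_mult_right_zero)
  qed (use lam b_pos in \<open>auto intro!: derivative_eq_intros\<close>)
  finally show ?thesis using top by (simp add: disc_def)
qed

lemma expected_cost_eq:
  assumes \<tau>: "\<tau> \<in> stopping_times M N" and \<phi>: "\<phi> \<in> Q"
  shows "expected_cost lam \<mu> c m M N \<sigma> \<tau> \<phi> =
    enn2ereal (\<integral>\<^sup>+\<omega>. tcost \<phi> \<tau> \<omega> \<partial>M) - enn2ereal (\<integral>\<^sup>+\<omega>. ennreal (b * (1 - disc (\<tau> \<omega>))) \<partial>M)"
  unfolding expected_cost_def
proof (rule ext_integral_diff)
  note stopping_time_measurable(1)[OF \<tau>, measurable]
  show "tcost \<phi> \<tau> \<in> borel_measurable M" "(\<lambda>\<omega>. ennreal (b * (1 - disc (\<tau> \<omega>)))) \<in> borel_measurable M" by measurable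
  have "(\<integral>\<^sup>+\<omega>. ennreal (b * (1 - disc (\<tau> \<omega>))) \<partial>M) \<le> (\<integral>\<^sup>+\<omega>. ennreal b \<partial>M)"
    using b_pos disc_bounds by (intro nn_integral_mono ennreal_leI mult_left_le) auto
  also have "\<dots> < \<infinity>" by (simp add: emeasure_space_1)
  finally show "(\<integral>\<^sup>+\<omega>. ennreal (b * (1 - disc (\<tau> \<omega>))) \<partial>M) < \<infinity>" .
  fix \<omega> assume \<omega>: "\<omega> \<in> space M"
  have [measurable]: "path \<phi> (jumps \<omega>) \<in> borel_measurable borel" by (rule path_measurable_time[OF jump_times_sq[OF \<omega>]])
  have [measurable]: "{u. 0 \<le> u \<and> ennreal u \<le> \<tau> \<omega>} \<in> sets borel" by measurable
  show "ext_integral lborel (\<lambda>t. ereal (indicator {t. 0 \<le> t \<and> ennreal t \<le> \<tau> \<omega>} t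
              * (exp (- lam * t) * running_cost lam c (Phi lam \<mu> m N \<sigma> \<phi> t \<omega>)))) =
    enn2ereal (tcost \<phi> \<tau> \<omega>) - enn2ereal (ennreal (b * (1 - disc (\<tau> \<omega>))))"
    unfolding tcost_def nn_integral_discount[symmetric]
  proof (rule ext_integral_diff)
    show "(\<integral>\<^sup>+u. ennreal (exp (- lam * u) * (lam * b)) * indicator {u. 0 \<le> u \<and> ennreal u \<le> \<tau> \<omega>} u \<partial>lborel) < \<infinity>"
      unfolding nn_integral_discount by simp
    fix t
    show "ereal (indicator {t. 0 \<le> t \<and> ennreal t \<le> \<tau> \<omega>} t * (exp (- lam * t) * running_cost lam c (Phi lam \<mu> m N \<sigma> \<phi> t \<omega>))) =
      enn2ereal (ennreal (exp (- lam * t)) * Ge (path \<phi> (jumps \<omega>) t) * indicator {u. 0 \<le> u \<and> ennreal u \<le> \<tau> \<omega>} t) -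
      enn2ereal (ennreal (exp (- lam * t) * (lam * b)) * indicator {u. 0 \<le> u \<and> ennreal u \<le> \<tau> \<omega>} t)"
    proof (cases "0 \<le> t \<and> ennreal t \<le> \<tau> \<omega>")
      case True
      then have "0 \<le> G (path \<phi> (jumps \<omega>) t)" by (intro G_nonneg path_Q jump_times_sq \<omega> \<phi>) auto
      then show ?thesis
        using True lam b_pos by (simp add: Phi_eq_path[OF \<omega>] running_cost_eq ennreal_mult'[symmetric] algebra_simps)
    qed auto
  qed (auto split: split_indicator)
qed (use b_pos in simp)

text \<open>The expected cost shifted by \<open>b\<close>: unlike \<open>expected_cost\<close> it is
  a single integral of a nonnegative function.\<close>

definition total_cost :: "real \<times> real \<Rightarrow> ('a \<Rightarrow> ennreal) \<Rightarrow> ennreal" where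
  "total_cost \<phi> \<tau> = (\<integral>\<^sup>+\<omega>. tcost \<phi> \<tau> \<omega> + ennreal (b * disc (\<tau> \<omega>)) \<partial>M)"

text \<open>The discount terms \<open>b * (1 - disc (\<tau> \<omega>))\<close> and
  \<open>b * disc (\<tau> \<omega>)\<close> have finite integrals adding up to \<open>b\<close>, so
  they can be cancelled. The sign is all that the stopping region depends on.\<close>

lemma expected_cost_sign:
  assumes \<tau>: "\<tau> \<in> stopping_times M N" and \<phi>: "\<phi> \<in> Q"
  shows "ennreal b \<le> total_cost \<phi> \<tau> \<Longrightarrow> 0 \<le> expected_cost lam \<mu> c m M N \<sigma> \<tau> \<phi>"
    "total_cost \<phi> \<tau> < ennreal b \<Longrightarrow> expected_cost lam \<mu> c m M N \<sigma> \<tau> \<phi> < 0"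
proof -
  note stopping_time_measurable(1)[OF \<tau>, measurable]
  let ?C = "\<integral>\<^sup>+\<omega>. tcost \<phi> \<tau> \<omega> \<partial>M" and ?E = "\<integral>\<^sup>+\<omega>. ennreal (b * (1 - disc (\<tau> \<omega>))) \<partial>M" and ?D = "\<integral>\<^sup>+\<omega>. ennreal (b * disc (\<tau> \<omega>)) \<partial>M"
  have "?E + ?D = (\<integral>\<^sup>+\<omega>. ennreal (b * (1 - disc (\<tau> \<omega>))) + ennreal (b * disc (\<tau> \<omega>)) \<partial>M)"
    by (rule nn_integral_add[symmetric]) measurable
  also have "\<dots> = (\<integral>\<^sup>+\<omega>. ennreal b \<partial>M)"
    using b_pos disc_bounds by (intro nn_integral_cong) (simp add: ennreal_plus[symmetric] algebra_simps mult_left_le del: ennreal_plus)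
  finally have ED: "?E + ?D = ennreal b" by (simp add: emeasure_space_1)
  have T: "total_cost \<phi> \<tau> = ?C + ?D" unfolding total_cost_def by (rule nn_integral_add) measurable
  show "0 \<le> expected_cost lam \<mu> c m M N \<sigma> \<tau> \<phi>" if "ennreal b \<le> total_cost \<phi> \<tau>"
  proof -
    have "?E + ?D \<le> ?C + ?D" using that unfolding ED T .
    then have "?E \<le> ?C"
      using ED by (cases ?E; cases ?D; cases ?C) (auto simp: ennreal_plus[symmetric] top_unique simp del: ennreal_plus)
    then show ?thesis
      unfolding expected_cost_eq[OF assms] using ED
      by (cases ?E; cases ?C) (auto simp: ennreal.rep_eq top_unique)
  qed
  show "expected_cost lam \<mu> c m M N \<sigma> \<tau> \<phi> < 0" if "total_cost \<phi> \<tau> < ennreal b"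
  proof -
    have "?C + ?D < ?E + ?D" using that unfolding ED T .
    then have "?C < ?E"
      using ED by (cases ?E; cases ?D; cases ?C) (auto simp: ennreal_plus[symmetric] ennreal_less_iff top_unique simp del: ennreal_plus)
    then show ?thesis
      unfolding expected_cost_eq[OF assms] using ED
      by (cases ?E; cases ?C) (auto simp: ennreal.rep_eq ennreal_less_iff top_unique)
  qed
qed

text \<open>The jumps as visible at time \<open>t\<close>: a later jump is replaced by
  \<open>t + 1\<close>, a value recognisable as lying beyond \<open>t\<close>. This keeps the
  sequence measurable with respect to \<open>Ft t\<close>.\<close>

definition trunc :: "real \<Rightarrow> 'a \<Rightarrow> nat \<Rightarrow> real" where
  "trunc t \<omega> n = (if jumps \<omega> n \<le> t then jumps \<omega> n else t + 1)"

lemma trunc_measurable [measurable]: "(\<lambda>\<omega>. trunc t \<omega> n) \<in> borel_measurable (Ft t)"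
proof (rule borel_measurableI_le)
  fix y
  show "{\<omega> \<in> space (Ft t). trunc t \<omega> n \<le> y} \<in> sets (Ft t)"
  proof (cases "t + 1 \<le> y")
    case True
    then have "{\<omega> \<in> space (Ft t). trunc t \<omega> n \<le> y} = space (Ft t)" by (auto simp: trunc_def)
    then show ?thesis by (metis sets.top)
  next
    case False
    then have "{\<omega> \<in> space (Ft t). trunc t \<omega> n \<le> y} = {\<omega> \<in> space M. jumps \<omega> n \<le> min y t}"
      by (auto simp: trunc_def)
    also have "\<dots> \<in> sets (Ft t)" by (rule sq_le_Ft) simp
    finally show ?thesis .
  qed
qed

lemma Zj_cong: "(\<And>i. i \<le> n \<Longrightarrow> s i = s' i) \<Longrightarrow> Zj \<phi> s n = Zj \<phi> s' n"
  by (induction n) auto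

text \<open>The state at \<open>t\<close> is built from the jumps with index at most
  \<open>N t \<omega>\<close>, and on these \<open>trunc\<close> changes nothing.\<close>

lemma path_Ft:
  assumes t: "0 \<le> t"
  shows "(\<lambda>\<omega>. path \<phi> (jumps \<omega>) t) \<in> borel_measurable (Ft t)"
proof -
  have eq: "path \<phi> (jumps \<omega>) t = fl (t - trunc t \<omega> (N t \<omega>)) (Zj \<phi> (trunc t \<omega>) (N t \<omega>))" if \<omega>: "\<omega> \<in> space (Ft t)" for \<omega>
  proof -
    have \<omega>: "\<omega> \<in> space M" using \<omega> by simp
    have "jumps \<omega> i \<le> t" if "i \<le> jump_count (jumps \<omega>) t" for i
      using jump_count_ge_iff[OF jump_times_sq[OF \<omega>] t] that by simp
    then have "trunc t \<omega> i = jumps \<omega> i" if "i \<le> N t \<omega>" for i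
      using that by (simp add: trunc_def N_eq[OF \<omega> t])
    then show ?thesis
      unfolding path_def N_eq[OF \<omega> t, symmetric] by (simp add: Zj_cong[of "N t \<omega>" "trunc t \<omega>" "jumps \<omega>"])
  qed
  have "(\<lambda>\<omega>. fl (t - trunc t \<omega> n) (Zj \<phi> (trunc t \<omega>) n)) \<in> borel_measurable (Ft t)" for n
  proof -
    have [measurable]: "(\<lambda>\<omega>. Zj \<phi> (trunc t \<omega>) n) \<in> borel_measurable (Ft t)"
      by (rule Zj_measurable) measurable
    show ?thesis by measurable
  qed
  then have "(\<lambda>\<omega>. fl (t - trunc t \<omega> (N t \<omega>)) (Zj \<phi> (trunc t \<omega>) (N t \<omega>))) \<in> borel_measurable (Ft t)"
    by (rule measurable_compose_countable[where f = "\<lambda>n \<omega>. fl (t - trunc t \<omega> n) (Zj \<phi> (trunc t \<omega>) n)"])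
       (rule N_measurable_Ft[OF t order_refl])
  then show ?thesis by (subst measurable_cong[OF eq])
qed

lemma measurable_Ft_aug: "f \<in> measurable (Ft t) S' \<Longrightarrow> f \<in> measurable (aug t) S'"
  using Ft_subset_aug[of t] by (auto simp: measurable_def)

section \<open>The value function\<close>

text \<open>Only an inequality is obtained: for each path the truncated horizon costs are eventually
  constant in \<open>n\<close>, and Fatou's lemma transfers the bound
  \<open>nn_integral_Yn_U\<close> to the limit.\<close>

lemma U_moment:
  assumes \<phi>: "\<phi> \<in> Q" and u: "0 \<le> u"
  shows "(\<integral>\<^sup>+\<omega>. ennreal (exp (- lam * u)) * ennreal (U (path \<phi> (jumps \<omega>) u)) \<partial>M) \<le> ennreal (U \<phi>)"
proof -
  let ?Un = "\<lambda>\<psi>. ennreal (U \<psi>)"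
  let ?f = "\<lambda>n \<omega>. horizon_cost n (\<lambda>_. 0) ?Un \<phi> u (gaps (jumps \<omega>))"
  have [measurable]: "?f n \<in> borel_measurable M" for n
    by (rule Yn_measurable) (auto simp: gaps_def)
  have "(\<integral>\<^sup>+\<omega>. ennreal (exp (- lam * u)) * ?Un (path \<phi> (jumps \<omega>) u) \<partial>M) = (\<integral>\<^sup>+\<omega>. liminf (\<lambda>n. ?f n \<omega>) \<partial>M)"
  proof (rule nn_integral_cong)
    fix \<omega> assume \<omega>: "\<omega> \<in> space M"
    note s = jump_times_sq[OF \<omega>]
    have "eventually (\<lambda>n. u < jumps \<omega> n) sequentially"
      using s by (auto simp: jump_times_def filterlim_at_top_dense)
    then have "eventually (\<lambda>n. ?f n \<omega> = ennreal (exp (- lam * u)) * ?Un (path \<phi> (jumps \<omega>) u)) sequentially"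
    proof eventually_elim
      fix n assume "u < jumps \<omega> n"
      then show "?f n \<omega> = ennreal (exp (- lam * u)) * ?Un (path \<phi> (jumps \<omega>) u)"
        using Yn_path[of "\<lambda>_. 0", OF _ s u, of n ?Un \<phi>] by (simp add: cost_def)
    qed
    then have "(\<lambda>n. ?f n \<omega>) \<longlonglongrightarrow> ennreal (exp (- lam * u)) * ?Un (path \<phi> (jumps \<omega>) u)"
      by (rule tendsto_eventually)
    then show "ennreal (exp (- lam * u)) * ?Un (path \<phi> (jumps \<omega>) u) = liminf (\<lambda>n. ?f n \<omega>)"
      by (simp add: lim_imp_Liminf)
  qed
  also have "\<dots> \<le> liminf (\<lambda>n. \<integral>\<^sup>+\<omega>. ?f n \<omega> \<partial>M)"
    by (rule nn_integral_liminf) measurable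
  also have "\<dots> \<le> liminf (\<lambda>n. ennreal (U \<phi>))"
  proof (intro Liminf_mono always_eventually allI)
    fix n
    have "(\<integral>\<^sup>+\<omega>. ?f n \<omega> \<partial>M) = (\<integral>\<^sup>+d. horizon_cost n (\<lambda>_. 0) ?Un \<phi> u d \<partial>Sq)"
      by (rule nn_integral_gaps, rule Yn_measurable) measurable
    also have "\<dots> \<le> ennreal (U \<phi>)" by (rule nn_integral_Yn_U[OF \<phi> u])
    finally show "(\<integral>\<^sup>+\<omega>. ?f n \<omega> \<partial>M) \<le> ennreal (U \<phi>)" .
  qed
  also have "\<dots> = ennreal (U \<phi>)" by (simp add: Liminf_const)
  finally show ?thesis .
qed

text \<open>The submartingale inequality over one grid step, on an event \<open>A\<close> known at
  time \<open>t\<close>. With the state at \<open>t\<close> frozen, \<open>vinf_le_Yn\<close>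
  applies to the gaps after \<open>t\<close>, \<open>Yn_path\<close> returns to the actual path, and
  the error disappears as \<open>n\<close> grows.\<close>

lemma vinf_step:
  assumes \<phi>: "\<phi> \<in> Q" and t: "0 \<le> t" and h: "0 \<le> h" and A: "A \<in> sets (aug t)"
  shows "(\<integral>\<^sup>+\<omega>. indicator A \<omega> * vinf (path \<phi> (jumps \<omega>) t) \<partial>M) \<le>
    (\<integral>\<^sup>+\<omega>. indicator A \<omega> * (cost Ge (path \<phi> (jumps \<omega>) t) (shift_times t (jumps \<omega>)) h +
      ennreal (exp (- lam * h)) * vinf (path \<phi> (jumps \<omega>) (t + h))) \<partial>M)" (is "?L \<le> ?R")
proof (rule LIMSEQ_le_const)
  have AM [measurable]: "A \<in> sets M" using A aug_subset by blast
  interpret S: prob_space Sq by (rule prob_space_Sq)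
  have "\<mu> / k < 1" using k_pos lam by (simp add: k_def)
  then have "(\<lambda>n. (\<mu> / k) ^ n) \<longlonglongrightarrow> 0" using mu_pos k_pos by (intro LIMSEQ_realpow_zero) auto
  then have "(\<lambda>n. ?R + ennreal (b * (\<mu> / k) ^ n)) \<longlonglongrightarrow> ?R + ennreal (b * 0)"
    by (intro tendsto_add tendsto_const tendsto_ennrealI tendsto_mult)
  then show "(\<lambda>n. ?R + ennreal (b * (\<mu> / k) ^ n)) \<longlonglongrightarrow> ?R" by simp
  have "?L \<le> ?R + ennreal (b * (\<mu> / k) ^ n)" for n
  proof -
    let ?H = "\<lambda>p. ennreal (fst (fst p)) * horizon_cost n Ge vinf (snd (fst p)) h (snd p)"
    let ?X = "\<lambda>\<omega>. (indicator A \<omega> :: real, path \<phi> (jumps \<omega>) t)"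
    have H: "?H \<in> borel_measurable ((borel \<Otimes>\<^sub>M borel) \<Otimes>\<^sub>M Sq)"
    proof -
      have [measurable]: "(\<lambda>p. horizon_cost n Ge vinf (snd (fst p)) h (snd p)) \<in> borel_measurable ((borel \<Otimes>\<^sub>M borel) \<Otimes>\<^sub>M Sq)"
        by (rule Yn_measurable) measurable
      show ?thesis by measurable
    qed
    have X: "?X \<in> measurable (aug t) (borel \<Otimes>\<^sub>M borel)"
      using A path_Ft[OF t, THEN measurable_Ft_aug] by (intro measurable_Pair) auto
    have [measurable]: "(\<lambda>\<omega>. \<integral>\<^sup>+d. horizon_cost n Ge vinf (path \<phi> (jumps \<omega>) t) h d \<partial>Sq) \<in> borel_measurable M"
    proof (rule S.borel_measurable_nn_integral)
      show "(\<lambda>(\<omega>, d). horizon_cost n Ge vinf (path \<phi> (jumps \<omega>) t) h d) \<in> borel_measurable (M \<Otimes>\<^sub>M Sq)"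
        unfolding case_prod_beta by (rule Yn_measurable) measurable
    qed
    have "?L \<le> (\<integral>\<^sup>+\<omega>. indicator A \<omega> * (\<integral>\<^sup>+d. horizon_cost n Ge vinf (path \<phi> (jumps \<omega>) t) h d \<partial>Sq) + ennreal (b * (\<mu> / k) ^ n) \<partial>M)"
    proof (rule nn_integral_mono)
      fix \<omega> assume \<omega>: "\<omega> \<in> space M"
      have "vinf (path \<phi> (jumps \<omega>) t) \<le> (\<integral>\<^sup>+d. horizon_cost n Ge vinf (path \<phi> (jumps \<omega>) t) h d \<partial>Sq) + ennreal (b * (\<mu> / k) ^ n)"
        by (intro vinf_le_Yn path_Q jump_times_sq \<omega> \<phi> t h)
      then show "indicator A \<omega> * vinf (path \<phi> (jumps \<omega>) t) \<le>
        indicator A \<omega> * (\<integral>\<^sup>+d. horizon_cost n Ge vinf (path \<phi> (jumps \<omega>) t) h d \<partial>Sq) + ennreal (b * (\<mu> / k) ^ n)"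
        by (auto split: split_indicator)
    qed
    also have "\<dots> = (\<integral>\<^sup>+\<omega>. indicator A \<omega> * (\<integral>\<^sup>+d. horizon_cost n Ge vinf (path \<phi> (jumps \<omega>) t) h d \<partial>Sq) \<partial>M) + ennreal (b * (\<mu> / k) ^ n)"
      by (subst nn_integral_add) (auto simp: emeasure_space_1)
    also have "(\<integral>\<^sup>+\<omega>. indicator A \<omega> * (\<integral>\<^sup>+d. horizon_cost n Ge vinf (path \<phi> (jumps \<omega>) t) h d \<partial>Sq) \<partial>M) = (\<integral>\<^sup>+\<omega>. (\<integral>\<^sup>+d. ?H (?X \<omega>, d) \<partial>Sq) \<partial>M)"
    proof (rule nn_integral_cong)
      fix \<omega>
      have "(\<lambda>d. horizon_cost n Ge vinf (path \<phi> (jumps \<omega>) t) h d) \<in> borel_measurable Sq"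
        by (rule Yn_measurable) measurable
      then show "indicator A \<omega> * (\<integral>\<^sup>+d. horizon_cost n Ge vinf (path \<phi> (jumps \<omega>) t) h d \<partial>Sq) = (\<integral>\<^sup>+d. ?H (?X \<omega>, d) \<partial>Sq)"
        by (subst nn_integral_cmult[symmetric]) (auto split: split_indicator)
    qed
    also have "\<dots> = (\<integral>\<^sup>+\<omega>. ?H (?X \<omega>, gaps_after t \<omega>) \<partial>M)"
      by (rule nn_integral_gt[OF t X H, symmetric])
    also have "\<dots> \<le> ?R"
    proof (rule nn_integral_mono)
      fix \<omega> assume \<omega>: "\<omega> \<in> space M"
      note s = jump_times_sq[OF \<omega>]
      have "horizon_cost n Ge vinf (path \<phi> (jumps \<omega>) t) h (gaps_after t \<omega>) \<le>
        cost Ge (path \<phi> (jumps \<omega>) t) (shift_times t (jumps \<omega>)) h + ennreal (exp (- lam * h)) * vinf (path \<phi> (jumps \<omega>) (t + h))"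
        unfolding gaps_after_def path_shift[OF s t h, symmetric]
        using Yn_path[of Ge "shift_times t (jumps \<omega>)" h n vinf "path \<phi> (jumps \<omega>) t"] jump_times_shift[OF s t] h by auto
      then show "?H (?X \<omega>, gaps_after t \<omega>) \<le> indicator A \<omega> * (cost Ge (path \<phi> (jumps \<omega>) t) (shift_times t (jumps \<omega>)) h +
          ennreal (exp (- lam * h)) * vinf (path \<phi> (jumps \<omega>) (t + h)))"
        by (auto split: split_indicator)
    qed
    finally show ?thesis by (simp add: add_right_mono)
  qed
  then show "\<exists>N. \<forall>n\<ge>N. ?L \<le> ?R + ennreal (b * (\<mu> / k) ^ n)" by blast
qed

text \<open>The complement is the union of the events that \<open>\<tau>\<close> is at most
  \<open>q\<close> over rational \<open>q < t\<close>. As \<open>q\<close> lies strictly below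
  \<open>t\<close>, these are in \<open>aug t\<close> although they are only known right after
  \<open>q\<close>.\<close>

lemma stopping_time_ge_aug:
  assumes \<tau>: "\<tau> \<in> stopping_times M N" and t: "0 \<le> t"
  shows "{\<omega>\<in>space M. ennreal t \<le> \<tau> \<omega>} \<in> sets (aug t)"
proof -
  have "{\<omega>\<in>space M. \<tau> \<omega> < ennreal t} = (\<Union>q\<in>{q\<in>\<rat>. 0 \<le> q \<and> q < t}. {\<omega>\<in>space M. \<tau> \<omega> \<le> ennreal q})"
  proof (intro set_eqI iffI)
    fix \<omega> assume *: "\<omega> \<in> {\<omega>\<in>space M. \<tau> \<omega> < ennreal t}"
    then obtain x where x: "\<tau> \<omega> = ennreal x" "0 \<le> x" "x < t"
      by (cases "\<tau> \<omega>") (auto simp: ennreal_less_iff)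
    then obtain q where "q \<in> \<rat>" "x < q" "q < t" using Rats_dense_in_real by blast
    then show "\<omega> \<in> (\<Union>q\<in>{q\<in>\<rat>. 0 \<le> q \<and> q < t}. {\<omega>\<in>space M. \<tau> \<omega> \<le> ennreal q})"
      using * x by (auto intro!: exI[of _ q] ennreal_leI)
  qed (auto simp: ennreal_less_iff intro: le_less_trans)
  also have "\<dots> \<in> sets (aug t)"
    by (intro sets.countable_UN' countable_subset[OF _ countable_rat])
       (auto intro: stopping_time_measurable(2)[OF \<tau>])
  finally have "space M - {\<omega>\<in>space M. \<tau> \<omega> < ennreal t} \<in> sets (aug t)"
    using sets.compl_sets[of _ "aug t"] by simp
  also have "space M - {\<omega>\<in>space M. \<tau> \<omega> < ennreal t} = {\<omega>\<in>space M. ennreal t \<le> \<tau> \<omega>}"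
    by (auto simp: not_less)
  finally show ?thesis .
qed

section \<open>Grid approximation of a stopping time\<close>

text \<open>Running cost is charged up to \<open>\<tau> + h\<close> because stopping on the grid may
  come later than \<open>\<tau>\<close> by one mesh width; the cut at \<open>T\<close> provides
  integrability.\<close>

definition overshoot_cost :: "real \<times> real \<Rightarrow> ('a \<Rightarrow> ennreal) \<Rightarrow> real \<Rightarrow> real \<Rightarrow> 'a \<Rightarrow> ennreal" where
  "overshoot_cost \<phi> \<tau> h T \<omega> = (\<integral>\<^sup>+u\<in>{0..T}. (ennreal (exp (- lam * u)) * Ge (path \<phi> (jumps \<omega>) u) *
      (if ennreal u \<le> \<tau> \<omega> + ennreal h then 1 else 0)) \<partial>lborel)"

lemma overshoot_cost_measurable [measurable]:
  assumes [measurable]: "\<tau> \<in> borel_measurable M"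
  shows "overshoot_cost \<phi> \<tau> h T \<in> borel_measurable M"
proof -
  have "overshoot_cost \<phi> \<tau> h T = (\<lambda>\<omega>. \<integral>\<^sup>+u. ennreal (exp (- lam * u)) * Ge (path \<phi> (jumps \<omega>) u) *
      (if ennreal u \<le> \<tau> \<omega> + ennreal h then 1 else 0) * indicator {0..T} u \<partial>lborel)"
    unfolding overshoot_cost_def[abs_def] ..
  also have "\<dots> \<in> borel_measurable M"
    by (rule lborel.borel_measurable_nn_integral) (unfold split_beta', measurable)
  finally show ?thesis .
qed

text \<open>Stopping at the first multiple of \<open>h\<close> after \<open>\<tau>\<close>, at the latest at \<open>J * h\<close>.\<close>

lemma vinf_telescope:
  fixes J :: nat and h :: real
  assumes \<phi>: "\<phi> \<in> Q" and h: "0 < h" and \<tau>: "\<tau> \<in> stopping_times M N"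
  shows "vinf \<phi> \<le> (\<integral>\<^sup>+\<omega>. (overshoot_cost \<phi> \<tau> h (J * h) \<omega> +
      indicator {\<omega>. \<tau> \<omega> < ennreal (J * h)} \<omega> * ennreal (b * disc (\<tau> \<omega>))) +
      ennreal (exp (- lam * (J * h))) * (indicator {\<omega>\<in>space M. ennreal (J * h) \<le> \<tau> \<omega>} \<omega> * vinf (path \<phi> (jumps \<omega>) (J * h))) \<partial>M)"
proof (induction J)
  case 0
  have "path \<phi> (jumps \<omega>) 0 = \<phi>" if "\<omega> \<in> space M" for \<omega>
    using path_before_first[OF jump_times_sq[OF that], of 0 \<phi>] jump_timesD(1)[OF jump_times_sq[OF that]]
      jump_timesD(2)[OF jump_times_sq[OF that], of 0 1] by simp
  then have "(\<integral>\<^sup>+\<omega>. vinf \<phi> \<partial>M) \<le> (\<integral>\<^sup>+\<omega>. (overshoot_cost \<phi> \<tau> h (real 0 * h) \<omega> +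
      indicator {\<omega>. \<tau> \<omega> < ennreal (real 0 * h)} \<omega> * ennreal (b * disc (\<tau> \<omega>))) +
      ennreal (exp (- lam * (real 0 * h))) * (indicator {\<omega>\<in>space M. ennreal (real 0 * h) \<le> \<tau> \<omega>} \<omega> * vinf (path \<phi> (jumps \<omega>) (real 0 * h))) \<partial>M)"
    by (intro nn_integral_mono) (simp add: add_increasing)
  then show ?case by (simp add: emeasure_space_1)
next
  case (Suc J)
  note [measurable] = stopping_time_measurable(1)[OF \<tau>]
  let ?T = "real J * h" and ?T' = "real (Suc J) * h"
  have T: "0 \<le> ?T" "?T' = ?T + h" using h by (auto simp: algebra_simps)
  let ?A = "{\<omega>\<in>space M. ennreal ?T \<le> \<tau> \<omega>}" and ?A' = "{\<omega>\<in>space M. ennreal ?T' \<le> \<tau> \<omega>}"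
  let ?P = "\<lambda>\<omega>. overshoot_cost \<phi> \<tau> h ?T \<omega> + indicator {\<omega>. \<tau> \<omega> < ennreal ?T} \<omega> * ennreal (b * disc (\<tau> \<omega>))"
  let ?S = "\<lambda>\<omega>. cost Ge (path \<phi> (jumps \<omega>) ?T) (shift_times ?T (jumps \<omega>)) h + ennreal (exp (- lam * h)) * vinf (path \<phi> (jumps \<omega>) (?T + h))"
  let ?e = "ennreal (exp (- lam * ?T))"
  have A: "?A \<in> sets (aug ?T)" by (rule stopping_time_ge_aug[OF \<tau> T(1)])
  have [measurable]: "?A \<in> sets M" by measurable
  have P[measurable]: "?P \<in> borel_measurable M"
  proof -
    have "?P = (\<lambda>\<omega>. overshoot_cost \<phi> \<tau> h ?T \<omega> + (if \<tau> \<omega> < ennreal ?T then 1 else 0) * ennreal (b * disc (\<tau> \<omega>)))"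
      by (auto simp: fun_eq_iff)
    also have "\<dots> \<in> borel_measurable M" by measurable
    finally show ?thesis .
  qed
  have Sm: "?S \<in> borel_measurable M"
  proof -
    have [measurable]: "(\<lambda>p. path (path \<phi> (jumps (fst p)) ?T) (shift_times ?T (jumps (fst p))) (snd p)) \<in> borel_measurable (M \<Otimes>\<^sub>M borel)"
    proof (rule path_measurable)
      have "(\<lambda>\<omega>. shift_times ?T (jumps \<omega>) n) \<in> borel_measurable M" for n
        by (rule shift_times_measurable[where t = "\<lambda>_. ?T"]) (auto intro: jump_times_sq)
      then show "(\<lambda>p. shift_times ?T (jumps (fst p)) n) \<in> borel_measurable (M \<Otimes>\<^sub>M borel)" for n
        by (rule measurable_compose[OF measurable_fst])
    qed (auto intro!: jump_times_shift jump_times_sq T(1) simp: space_pair_measure measurable_compose[OF measurable_fst path_at_measurable])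
    have [measurable]: "(\<lambda>\<omega>. cost Ge (path \<phi> (jumps \<omega>) ?T) (shift_times ?T (jumps \<omega>)) h) \<in> borel_measurable M"
      unfolding cost_def by (rule nn_integral_Icc_measurable) measurable
    show ?thesis by measurable
  qed
  have split: "(\<integral>\<^sup>+\<omega>. ?P \<omega> + ?e * V \<omega> \<partial>M) = (\<integral>\<^sup>+\<omega>. ?P \<omega> \<partial>M) + ?e * (\<integral>\<^sup>+\<omega>. V \<omega> \<partial>M)"
    if V[measurable]: "V \<in> borel_measurable M" for V
  proof -
    have "(\<integral>\<^sup>+\<omega>. ?P \<omega> + ?e * V \<omega> \<partial>M) = (\<integral>\<^sup>+\<omega>. ?P \<omega> \<partial>M) + (\<integral>\<^sup>+\<omega>. ?e * V \<omega> \<partial>M)"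
      by (rule nn_integral_add[OF P]) measurable
    also have "(\<integral>\<^sup>+\<omega>. ?e * V \<omega> \<partial>M) = ?e * (\<integral>\<^sup>+\<omega>. V \<omega> \<partial>M)"
      by (rule nn_integral_cmult[OF V])
    finally show ?thesis .
  qed
  have "vinf \<phi> \<le> (\<integral>\<^sup>+\<omega>. ?P \<omega> + ?e * (indicator ?A \<omega> * vinf (path \<phi> (jumps \<omega>) ?T)) \<partial>M)" by (rule Suc.IH)
  also have "\<dots> = (\<integral>\<^sup>+\<omega>. ?P \<omega> \<partial>M) + ?e * (\<integral>\<^sup>+\<omega>. indicator ?A \<omega> * vinf (path \<phi> (jumps \<omega>) ?T) \<partial>M)"
    by (rule split) measurable
  also have "\<dots> \<le> (\<integral>\<^sup>+\<omega>. ?P \<omega> \<partial>M) + ?e * (\<integral>\<^sup>+\<omega>. indicator ?A \<omega> * ?S \<omega> \<partial>M)"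
    using h by (intro add_left_mono mult_left_mono vinf_step[OF \<phi> T(1) _ A]) auto
  also have "\<dots> = (\<integral>\<^sup>+\<omega>. ?P \<omega> + ?e * (indicator ?A \<omega> * ?S \<omega>) \<partial>M)"
    by (rule split[symmetric]) (intro borel_measurable_times_ennreal Sm, measurable)
  also have "\<dots> \<le> (\<integral>\<^sup>+\<omega>. (overshoot_cost \<phi> \<tau> h ?T' \<omega> + indicator {\<omega>. \<tau> \<omega> < ennreal ?T'} \<omega> * ennreal (b * disc (\<tau> \<omega>))) +
      ennreal (exp (- lam * ?T')) * (indicator ?A' \<omega> * vinf (path \<phi> (jumps \<omega>) ?T')) \<partial>M)"
  proof (rule nn_integral_mono)
    fix \<omega> assume \<omega>: "\<omega> \<in> space M"
    note s = jump_times_sq[OF \<omega>]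
    note path_measurable_time[OF s, measurable]
    let ?i = "\<lambda>u. if ennreal u \<le> \<tau> \<omega> + ennreal h then 1 else 0 :: ennreal"
    have O: "overshoot_cost \<phi> \<tau> h ?T' \<omega> = overshoot_cost \<phi> \<tau> h ?T \<omega> +
      (\<integral>\<^sup>+u\<in>{0..h}. (ennreal (exp (- lam * (?T + u))) * Ge (path \<phi> (jumps \<omega>) (?T + u)) * ?i (?T + u)) \<partial>lborel)"
      unfolding overshoot_cost_def T(2) using T(1) h by (intro nn_integral_Icc_split) auto
    have e: "ennreal (exp (- lam * ?T')) = ?e * ennreal (exp (- lam * h))"
      unfolding T(2) by (simp add: ennreal_mult'[symmetric] exp_add[symmetric] algebra_simps)
    show "?P \<omega> + ?e * (indicator ?A \<omega> * ?S \<omega>) \<le>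
      (overshoot_cost \<phi> \<tau> h ?T' \<omega> + indicator {\<omega>. \<tau> \<omega> < ennreal ?T'} \<omega> * ennreal (b * disc (\<tau> \<omega>))) +
      ennreal (exp (- lam * ?T')) * (indicator ?A' \<omega> * vinf (path \<phi> (jumps \<omega>) ?T'))"
    proof (cases "ennreal ?T \<le> \<tau> \<omega>")
      \<comment> \<open>Stopped before this step: the discounted stopping cost is already recorded
        in \<open>?P\<close>, and the running cost can only grow.\<close>
      case False
      have "ennreal ?T \<le> ennreal ?T'" using T h by (intro ennreal_leI) auto
      then have lt: "\<tau> \<omega> < ennreal ?T" "\<tau> \<omega> < ennreal ?T'" using False by auto
      then show ?thesis
        unfolding O by (simp add: add_right_mono add_increasing2 not_le[symmetric])
    next
      case True
      have "(\<integral>\<^sup>+u\<in>{0..h}. (ennreal (exp (- lam * (?T + u))) * Ge (path \<phi> (jumps \<omega>) (?T + u)) * ?i (?T + u)) \<partial>lborel) =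
        (\<integral>\<^sup>+u\<in>{0..h}. (ennreal (exp (- lam * (?T + u))) * Ge (path \<phi> (jumps \<omega>) (?T + u))) \<partial>lborel)"
      proof (rule nn_integral_cong)
        fix u
        have "ennreal (?T + u) \<le> \<tau> \<omega> + ennreal h" if "0 \<le> u" "u \<le> h"
        proof -
          have "ennreal (?T + u) = ennreal ?T + ennreal u" using T(1) that by (intro ennreal_plus)
          also have "\<dots> \<le> \<tau> \<omega> + ennreal h" using True that by (intro add_mono ennreal_leI)
          finally show ?thesis .
        qed
        then show "ennreal (exp (- lam * (?T + u))) * Ge (path \<phi> (jumps \<omega>) (?T + u)) * ?i (?T + u) * indicator {0..h} u =
          ennreal (exp (- lam * (?T + u))) * Ge (path \<phi> (jumps \<omega>) (?T + u)) * indicator {0..h} u"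
          by (auto split: split_indicator)
      qed
      also have "\<dots> = ?e * cost Ge (path \<phi> (jumps \<omega>) ?T) (shift_times ?T (jumps \<omega>)) h"
        by (rule cost_tail[OF _ s T(1)]) measurable
      finally have O': "overshoot_cost \<phi> \<tau> h ?T' \<omega> = overshoot_cost \<phi> \<tau> h ?T \<omega> + ?e * cost Ge (path \<phi> (jumps \<omega>) ?T) (shift_times ?T (jumps \<omega>)) h"
        unfolding O by simp
      have V: "ennreal (exp (- lam * ?T')) * vinf (path \<phi> (jumps \<omega>) ?T') \<le>
        indicator {\<omega>. \<tau> \<omega> < ennreal ?T'} \<omega> * ennreal (b * disc (\<tau> \<omega>)) +
        ennreal (exp (- lam * ?T')) * (indicator ?A' \<omega> * vinf (path \<phi> (jumps \<omega>) ?T'))"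
      proof (cases "\<tau> \<omega> < ennreal ?T'")
        \<comment> \<open>Stopped within this step: \<open>vinf\<close> at the grid point is at most
          \<open>b\<close>, and the discount there is at most the one at
          \<open>\<tau>\<close>.\<close>
        case True
        then obtain x where x: "\<tau> \<omega> = ennreal x" "0 \<le> x" "x < ?T'" by (cases "\<tau> \<omega>") (auto simp: ennreal_less_iff)
        have "ennreal (exp (- lam * ?T')) * vinf (path \<phi> (jumps \<omega>) ?T') \<le> ennreal (exp (- lam * x)) * ennreal b"
          using x lam by (intro mult_mono vinf_le_b ennreal_leI) auto
        also have "\<dots> = ennreal (b * disc (\<tau> \<omega>))"
          using x b_pos by (simp add: ennreal_mult'[symmetric] mult.commute)
        finally have "ennreal (exp (- lam * ?T')) * vinf (path \<phi> (jumps \<omega>) ?T') \<le>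
            indicator {\<omega>. \<tau> \<omega> < ennreal ?T'} \<omega> * ennreal (b * disc (\<tau> \<omega>))"
          using True by simp
        then show ?thesis by (rule order_trans) simp
      next
        case False
        then show ?thesis using \<omega> by (simp add: not_less)
      qed
      have "?P \<omega> + ?e * (indicator ?A \<omega> * ?S \<omega>) =
        overshoot_cost \<phi> \<tau> h ?T' \<omega> + ennreal (exp (- lam * ?T')) * vinf (path \<phi> (jumps \<omega>) ?T')"
        using True \<omega> unfolding O' T(2)[symmetric] e by (simp add: not_less distrib_left ac_simps)
      also have "\<dots> \<le> overshoot_cost \<phi> \<tau> h ?T' \<omega> + (indicator {\<omega>. \<tau> \<omega> < ennreal ?T'} \<omega> * ennreal (b * disc (\<tau> \<omega>)) +
        ennreal (exp (- lam * ?T')) * (indicator ?A' \<omega> * vinf (path \<phi> (jumps \<omega>) ?T')))"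
        by (intro add_left_mono V)
      finally show ?thesis by (simp only: add.assoc)
    qed
  qed
  finally show ?case .
qed

text \<open>By Fubini and \<open>U_moment\<close> each time in \<open>{0..T}\<close> contributes at
  most \<open>U \<phi>\<close>; this is why the horizon must be finite.\<close>

lemma path_cost_finite:
  assumes \<phi>: "\<phi> \<in> Q" and T: "0 \<le> T"
  shows "(\<integral>\<^sup>+\<omega>. (\<integral>\<^sup>+u\<in>{0..T}. (ennreal (exp (- lam * u)) * Ge (path \<phi> (jumps \<omega>) u)) \<partial>lborel) \<partial>M) < \<infinity>"
proof -
  interpret P: pair_sigma_finite lborel M by unfold_locales
  have [measurable]: "(\<lambda>p. path \<phi> (jumps (snd p)) (fst p)) \<in> borel_measurable (lborel \<Otimes>\<^sub>M M)"
    using measurable_compose[OF measurable_pair_swap' joint_path_measurable_lborel] by (simp add: case_prod_beta)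
  have "(\<integral>\<^sup>+\<omega>. (\<integral>\<^sup>+u\<in>{0..T}. (ennreal (exp (- lam * u)) * Ge (path \<phi> (jumps \<omega>) u)) \<partial>lborel) \<partial>M) =
    (\<integral>\<^sup>+u. (\<integral>\<^sup>+\<omega>. ennreal (exp (- lam * u)) * Ge (path \<phi> (jumps \<omega>) u) * indicator {0..T} u \<partial>M) \<partial>lborel)"
    by (rule P.Fubini') (unfold split_beta', measurable)
  also have "\<dots> \<le> (\<integral>\<^sup>+u. ennreal (U \<phi>) * indicator {0..T} u \<partial>lborel)"
  proof (rule nn_integral_mono)
    fix u :: real
    show "(\<integral>\<^sup>+\<omega>. ennreal (exp (- lam * u)) * Ge (path \<phi> (jumps \<omega>) u) * indicator {0..T} u \<partial>M) \<le> ennreal (U \<phi>) * indicator {0..T} u"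
    proof (cases "u \<in> {0..T}")
      case True
      have "(\<integral>\<^sup>+\<omega>. ennreal (exp (- lam * u)) * Ge (path \<phi> (jumps \<omega>) u) * indicator {0..T} u \<partial>M) \<le>
        (\<integral>\<^sup>+\<omega>. ennreal (exp (- lam * u)) * ennreal (U (path \<phi> (jumps \<omega>) u)) \<partial>M)"
        using True by (intro nn_integral_mono) (auto simp: U_def intro!: mult_left_mono ennreal_leI)
      also have "\<dots> \<le> ennreal (U \<phi>)" using True by (intro U_moment \<phi>) auto
      finally show ?thesis using True by simp
    qed simp
  qed
  also have "\<dots> = ennreal (U \<phi>) * ennreal T" using T by (simp add: nn_integral_cmult_indicator)
  also have "\<dots> < \<infinity>" by (simp add: ennreal_mult_less_top)
  finally show ?thesis .
qed

text \<open>Dominated convergence twice, over the paths and, for each path of finite cost, over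
  time: a time beyond \<open>\<tau>\<close> is eventually also beyond \<open>\<tau>\<close> plus the
  mesh.\<close>

lemma overshoot_tendsto:
  assumes \<phi>: "\<phi> \<in> Q" and T: "0 \<le> T" and [measurable]: "\<tau> \<in> borel_measurable M"
  shows "(\<lambda>j. \<integral>\<^sup>+\<omega>. overshoot_cost \<phi> \<tau> (1 / real (Suc j)) T \<omega> \<partial>M) \<longlonglongrightarrow> (\<integral>\<^sup>+\<omega>. overshoot_cost \<phi> \<tau> 0 T \<omega> \<partial>M)"
proof (rule nn_integral_dominated_convergence[where
      w = "\<lambda>\<omega>. \<integral>\<^sup>+u\<in>{0..T}. (ennreal (exp (- lam * u)) * Ge (path \<phi> (jumps \<omega>) u)) \<partial>lborel"])
  let ?g = "\<lambda>\<omega> u. ennreal (exp (- lam * u)) * Ge (path \<phi> (jumps \<omega>) u)"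
  show W: "(\<lambda>\<omega>. \<integral>\<^sup>+u\<in>{0..T}. ?g \<omega> u \<partial>lborel) \<in> borel_measurable M"
    by (rule lborel.borel_measurable_nn_integral) (unfold split_beta', measurable)
  show fin: "(\<integral>\<^sup>+\<omega>. (\<integral>\<^sup>+u\<in>{0..T}. ?g \<omega> u \<partial>lborel) \<partial>M) < \<infinity>" by (rule path_cost_finite[OF \<phi> T])
  show "AE \<omega> in M. overshoot_cost \<phi> \<tau> (1 / real (Suc j)) T \<omega> \<le> (\<integral>\<^sup>+u\<in>{0..T}. ?g \<omega> u \<partial>lborel)" for j
    unfolding overshoot_cost_def by (intro AE_I2 nn_integral_mono) (auto split: split_indicator)
  have "AE \<omega> in M. (\<integral>\<^sup>+u\<in>{0..T}. ?g \<omega> u \<partial>lborel) \<noteq> \<infinity>"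
    using fin by (intro nn_integral_PInf_AE W) auto
  then show "AE \<omega> in M. (\<lambda>j. overshoot_cost \<phi> \<tau> (1 / real (Suc j)) T \<omega>) \<longlonglongrightarrow> overshoot_cost \<phi> \<tau> 0 T \<omega>"
  proof (rule AE_mp, intro AE_I2 impI)
    fix \<omega> assume \<omega>: "\<omega> \<in> space M" and fin\<omega>: "(\<integral>\<^sup>+u\<in>{0..T}. ?g \<omega> u \<partial>lborel) \<noteq> \<infinity>"
    have [measurable]: "path \<phi> (jumps \<omega>) \<in> borel_measurable borel" by (rule path_measurable_time[OF jump_times_sq[OF \<omega>]])
    show "(\<lambda>j. overshoot_cost \<phi> \<tau> (1 / real (Suc j)) T \<omega>) \<longlonglongrightarrow> overshoot_cost \<phi> \<tau> 0 T \<omega>"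
      unfolding overshoot_cost_def
    proof (rule nn_integral_dominated_convergence[where w = "\<lambda>u. ?g \<omega> u * indicator {0..T} u"])
      show "(\<integral>\<^sup>+u\<in>{0..T}. ?g \<omega> u \<partial>lborel) < \<infinity>" using fin\<omega> by (simp add: less_top)
      show "AE u in lborel. (\<lambda>j. ?g \<omega> u * (if ennreal u \<le> \<tau> \<omega> + ennreal (1 / real (Suc j)) then 1 else 0) * indicator {0..T} u)
        \<longlonglongrightarrow> ?g \<omega> u * (if ennreal u \<le> \<tau> \<omega> + ennreal 0 then 1 else 0) * indicator {0..T} u"
      proof (rule AE_I2, rule tendsto_eventually)
        fix u
        show "\<forall>\<^sub>F j in sequentially. ?g \<omega> u * (if ennreal u \<le> \<tau> \<omega> + ennreal (1 / real (Suc j)) then 1 else 0) * indicator {0..T} u =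
          ?g \<omega> u * (if ennreal u \<le> \<tau> \<omega> + ennreal 0 then 1 else 0) * indicator {0..T} u"
        proof (cases "ennreal u \<le> \<tau> \<omega>")
          case True
          then have "ennreal u \<le> \<tau> \<omega> + ennreal (1 / real (Suc j))" for j by (simp add: add_increasing2)
          then show ?thesis using True by simp
        next
          case False
          have "(\<lambda>j. \<tau> \<omega> + ennreal (1 / real (Suc j))) \<longlonglongrightarrow> \<tau> \<omega> + ennreal 0"
            by (intro tendsto_add tendsto_const tendsto_ennrealI LIMSEQ_Suc[OF lim_1_over_n])
          then have "eventually (\<lambda>j. \<tau> \<omega> + ennreal (1 / real (Suc j)) < ennreal u) sequentially"
            using False by (intro order_tendstoD) (auto simp: not_le)
          then show ?thesis by eventually_elim (use False in \<open>auto simp: not_le\<close>)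
        qed
      qed
    qed (auto intro!: AE_I2 split: split_indicator)
  qed
qed measurable

text \<open>The two limits are taken in order: first the mesh tends to \<open>0\<close> at a fixed
  horizon \<open>T\<close>, where costs are integrable, then \<open>T\<close> tends to infinity,
  which removes the remainder \<open>b * exp (- lam * T)\<close>.\<close>

lemma vinf_le_total_cost:
  assumes \<phi>: "\<phi> \<in> Q" and \<tau>: "\<tau> \<in> stopping_times M N"
  shows "vinf \<phi> \<le> total_cost \<phi> \<tau>"
proof (rule LIMSEQ_le_const)
  note [measurable] = stopping_time_measurable(1)[OF \<tau>]
  let ?D = "\<integral>\<^sup>+\<omega>. ennreal (b * disc (\<tau> \<omega>)) \<partial>M"
  have "filterlim (\<lambda>i. - lam * real i) at_bot sequentially"
    using lam filterlim_real_sequentially by (intro filterlim_tendsto_neg_mult_at_bot[OF tendsto_const]) auto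
  then have "(\<lambda>i. exp (- lam * real i)) \<longlonglongrightarrow> 0" by (rule filterlim_compose[OF exp_at_bot])
  then have "(\<lambda>T. total_cost \<phi> \<tau> + ennreal (b * exp (- lam * real T))) \<longlonglongrightarrow> total_cost \<phi> \<tau> + ennreal (b * 0)"
    by (intro tendsto_add tendsto_const tendsto_ennrealI tendsto_mult)
  then show "(\<lambda>T. total_cost \<phi> \<tau> + ennreal (b * exp (- lam * real T))) \<longlonglongrightarrow> total_cost \<phi> \<tau>" by simp
  have "vinf \<phi> \<le> total_cost \<phi> \<tau> + ennreal (b * exp (- lam * real T))" for T :: nat
  proof -
    have *: "vinf \<phi> \<le> (\<integral>\<^sup>+\<omega>. overshoot_cost \<phi> \<tau> (1 / real (Suc j)) (real T) \<omega> \<partial>M) + (?D + ennreal (b * exp (- lam * real T)))" for j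
    proof -
      \<comment> \<open>\<open>T * Suc j\<close> steps of length \<open>1 / Suc j\<close> end
        exactly at \<open>T\<close> for every \<open>j\<close>.\<close>
      have T: "real (T * Suc j) * (1 / real (Suc j)) = real T" by (simp del: of_nat_Suc mult_Suc_right)
      have "vinf \<phi> \<le> (\<integral>\<^sup>+\<omega>. (overshoot_cost \<phi> \<tau> (1 / real (Suc j)) (real T) \<omega> +
        indicator {\<omega>. \<tau> \<omega> < ennreal (real T)} \<omega> * ennreal (b * disc (\<tau> \<omega>))) +
        ennreal (exp (- lam * real T)) * (indicator {\<omega>\<in>space M. ennreal (real T) \<le> \<tau> \<omega>} \<omega> * vinf (path \<phi> (jumps \<omega>) (real T))) \<partial>M)"
        using vinf_telescope[OF \<phi> _ \<tau>, of "1 / real (Suc j)" "T * Suc j"] unfolding T by simp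
      also have "\<dots> \<le> (\<integral>\<^sup>+\<omega>. overshoot_cost \<phi> \<tau> (1 / real (Suc j)) (real T) \<omega> + (ennreal (b * disc (\<tau> \<omega>)) + ennreal (b * exp (- lam * real T))) \<partial>M)"
      proof (rule nn_integral_mono)
        fix \<omega>
        have "ennreal (exp (- lam * real T)) * (indicator {\<omega>\<in>space M. ennreal (real T) \<le> \<tau> \<omega>} \<omega> * vinf (path \<phi> (jumps \<omega>) (real T))) \<le>
          ennreal (exp (- lam * real T)) * (1 * ennreal b)"
          by (intro mult_left_mono mult_mono vinf_le_b) (auto split: split_indicator)
        also have "\<dots> = ennreal (b * exp (- lam * real T))" using b_pos by (simp add: ennreal_mult'[symmetric] mult.commute)
        finally have "ennreal (exp (- lam * real T)) * (indicator {\<omega>\<in>space M. ennreal (real T) \<le> \<tau> \<omega>} \<omega> * vinf (path \<phi> (jumps \<omega>) (real T))) \<le> ennreal (b * exp (- lam * real T))" .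
        moreover have "indicator {\<omega>. \<tau> \<omega> < ennreal (real T)} \<omega> * ennreal (b * disc (\<tau> \<omega>)) \<le> ennreal (b * disc (\<tau> \<omega>))"
          by (auto split: split_indicator)
        ultimately show "(overshoot_cost \<phi> \<tau> (1 / real (Suc j)) (real T) \<omega> +
        indicator {\<omega>. \<tau> \<omega> < ennreal (real T)} \<omega> * ennreal (b * disc (\<tau> \<omega>))) +
        ennreal (exp (- lam * real T)) * (indicator {\<omega>\<in>space M. ennreal (real T) \<le> \<tau> \<omega>} \<omega> * vinf (path \<phi> (jumps \<omega>) (real T))) \<le>
          overshoot_cost \<phi> \<tau> (1 / real (Suc j)) (real T) \<omega> + (ennreal (b * disc (\<tau> \<omega>)) + ennreal (b * exp (- lam * real T)))"
          unfolding add.assoc by (intro add_left_mono add_mono)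
      qed
      also have "\<dots> = (\<integral>\<^sup>+\<omega>. overshoot_cost \<phi> \<tau> (1 / real (Suc j)) (real T) \<omega> \<partial>M) + (\<integral>\<^sup>+\<omega>. ennreal (b * disc (\<tau> \<omega>)) + ennreal (b * exp (- lam * real T)) \<partial>M)"
        by (rule nn_integral_add) measurable
      also have "(\<integral>\<^sup>+\<omega>. ennreal (b * disc (\<tau> \<omega>)) + ennreal (b * exp (- lam * real T)) \<partial>M) = ?D + (\<integral>\<^sup>+\<omega>. ennreal (b * exp (- lam * real T)) \<partial>M)"
        by (rule nn_integral_add) measurable
      also have "(\<integral>\<^sup>+\<omega>. ennreal (b * exp (- lam * real T)) \<partial>M) = ennreal (b * exp (- lam * real T))"
        by (simp add: emeasure_space_1)
      finally show ?thesis .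
    qed
    have "(\<lambda>j. (\<integral>\<^sup>+\<omega>. overshoot_cost \<phi> \<tau> (1 / real (Suc j)) (real T) \<omega> \<partial>M) + (?D + ennreal (b * exp (- lam * real T))))
      \<longlonglongrightarrow> (\<integral>\<^sup>+\<omega>. overshoot_cost \<phi> \<tau> 0 (real T) \<omega> \<partial>M) + (?D + ennreal (b * exp (- lam * real T)))"
      by (intro tendsto_add tendsto_const overshoot_tendsto[OF \<phi>]) auto
    then have "vinf \<phi> \<le> (\<integral>\<^sup>+\<omega>. overshoot_cost \<phi> \<tau> 0 (real T) \<omega> \<partial>M) + (?D + ennreal (b * exp (- lam * real T)))"
      using * by (intro LIMSEQ_le_const) auto
    also have "\<dots> \<le> (\<integral>\<^sup>+\<omega>. tcost \<phi> \<tau> \<omega> \<partial>M) + (?D + ennreal (b * exp (- lam * real T)))"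
      unfolding overshoot_cost_def tcost_def
      by (intro add_right_mono nn_integral_mono) (auto split: split_indicator)
    also have "\<dots> = total_cost \<phi> \<tau> + ennreal (b * exp (- lam * real T))"
      unfolding total_cost_def by (subst nn_integral_add) (auto simp: add.assoc)
    finally show ?thesis .
  qed
  then show "\<exists>T0. \<forall>T\<ge>T0. vinf \<phi> \<le> total_cost \<phi> \<tau> + ennreal (b * exp (- lam * real T))" by blast
qed

section \<open>Policies realised by stopping times\<close>

text \<open>By \<open>policy_time_agree\<close> the true gaps may be replaced by those visible at
  time \<open>t\<close>, which are measurable with respect to \<open>Ft t\<close>.\<close>

lemma policy_stopping_time:
  assumes R: "\<And>n. R n \<in> borel_measurable borel" "\<And>n \<phi>. 0 \<le> R n \<phi>"
  shows "(\<lambda>\<omega>. ennreal (policy_time R n \<phi> (gaps (jumps \<omega>)))) \<in> stopping_times M N"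
  unfolding stopping_times_def augmented_filtration_def
proof (intro CollectI allI impI INT_I)
  fix t u :: real assume t: "0 \<le> t" and u: "u \<in> {t<..}"
  \<comment> \<open>Gaps not completed by \<open>t\<close> are set to \<open>t + 1\<close>, which
    pushes the partial sums beyond \<open>t\<close> just as the true gaps do.\<close>
  define d where "d = (\<lambda>\<omega> i. if jumps \<omega> (Suc i) \<le> t then trunc t \<omega> (Suc i) - trunc t \<omega> i else t + 1)"
  have d_eq: "d \<omega> i = (if trunc t \<omega> (Suc i) \<le> t then trunc t \<omega> (Suc i) - trunc t \<omega> i else t + 1)" for \<omega> i
    by (simp add: d_def trunc_def)
  have agree: "ennreal (policy_time R n \<phi> (gaps (jumps \<omega>))) \<le> ennreal t \<longleftrightarrow> policy_time R n \<phi> (d \<omega>) \<le> t" if \<omega>: "\<omega> \<in> space M" for \<omega>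
  proof -
    note s = jump_times_sq[OF \<omega>]
    have g: "0 \<le> gaps (jumps \<omega>) i" for i by (rule less_imp_le[OF gaps_pos[OF s]])
    have d1: "d \<omega> i = gaps (jumps \<omega>) i" if "jumps \<omega> (Suc i) \<le> t" for i
    proof -
      have "jumps \<omega> i \<le> t" using that jump_timesD(2)[OF s, of i "Suc i"] by simp
      then show ?thesis using that by (simp add: d_def trunc_def gaps_def)
    qed
    have d0: "0 \<le> d \<omega> i" for i
      using d1[of i] g[of i] t by (cases "jumps \<omega> (Suc i) \<le> t") (auto simp: d_def)
    have "policy_time R n \<phi> (gaps (jumps \<omega>)) \<le> t \<longleftrightarrow> policy_time R n \<phi> (d \<omega>) \<le> t"
    proof (rule policy_time_agree[OF R(2) g d0])
      fix i
      show "(\<forall>j\<le>i. gaps (jumps \<omega>) j = d \<omega> j) \<or> (t < (\<Sum>j\<le>i. gaps (jumps \<omega>) j) \<and> t < (\<Sum>j\<le>i. d \<omega> j))"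
      proof (cases "jumps \<omega> (Suc i) \<le> t")
        case True
        have "gaps (jumps \<omega>) j = d \<omega> j" if "j \<le> i" for j
          using d1[of j] True jump_timesD(3)[OF s, of "Suc j" "Suc i"] that by simp
        then show ?thesis by blast
      next
        case False
        have "(\<Sum>j\<le>i. gaps (jumps \<omega>) j) = jumps \<omega> (Suc i) - jumps \<omega> 0"
          unfolding gaps_def lessThan_Suc_atMost[symmetric] by (rule sum_lessThan_telescope)
        moreover have "t < d \<omega> i" using False by (simp add: d_def)
        moreover have "d \<omega> i \<le> (\<Sum>j\<le>i. d \<omega> j)" using d0 by (intro member_le_sum) auto
        ultimately show ?thesis using False jump_timesD(1)[OF s] by simp
      qed
    qed
    then show ?thesis using t policy_time_nonneg[where R = R and n = n and \<phi> = \<phi> and d = "gaps (jumps \<omega>)", OF R(2) g] by (simp add: ennreal_le_iff)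
  qed
  have "(\<lambda>\<omega>. policy_time R n \<phi> (d \<omega>)) \<in> borel_measurable (Ft t)"
    by (rule policy_time_measurable[OF R(1)]) (simp_all add: d_eq)
  then have "{\<omega>\<in>space (Ft t). policy_time R n \<phi> (d \<omega>) \<le> t} \<in> sets (Ft t)" by measurable
  also have "{\<omega>\<in>space (Ft t). policy_time R n \<phi> (d \<omega>) \<le> t} = {\<omega>\<in>space M. ennreal (policy_time R n \<phi> (gaps (jumps \<omega>))) \<le> ennreal t}"
    using agree by auto
  finally show "{\<omega>\<in>space M. ennreal (policy_time R n \<phi> (gaps (jumps \<omega>))) \<le> ennreal t} \<in> sigma_sets (space M) (sets (natural_sigma M N u) \<union> null_sets M)"
    using Ft_mono[of t u] u by (auto simp: Ft_def intro: sigma_sets.Basic)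
qed

lemma exists_good_stopping_time:
  assumes \<phi>: "\<phi> \<in> Q" and less: "vinf \<phi> < ennreal b"
  shows "\<exists>\<tau>\<in>stopping_times M N. total_cost \<phi> \<tau> < ennreal b"
proof -
  obtain n where n: "vh n \<phi> < ennreal b" using less by (auto simp: vinf_def INF_less_iff)
  then obtain x where x: "vh n \<phi> = ennreal x" "0 \<le> x" "x < b" by (cases "vh n \<phi>") (auto simp: ennreal_less_iff)
  \<comment> \<open>Chosen so that the accumulated policy error \<open>n * e\<close> stays below the
    gap \<open>b - x\<close>.\<close>
  define e where "e = (b - x) / (real n + 1)"
  have e: "0 < e" using x by (simp add: e_def)
  have "x + n * e < b" using x by (simp add: e_def field_simps)
  obtain R where R: "\<And>n. R n \<in> borel_measurable borel" "\<And>n \<phi>. 0 \<le> R n \<phi>"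
    "(\<integral>\<^sup>+d. policy_cost R n \<phi> d \<partial>Sq) \<le> vh n \<phi> + ennreal (n * e)"
    using policy_exists[OF e] \<phi> by blast
  let ?\<tau> = "\<lambda>\<omega>. ennreal (policy_time R n \<phi> (gaps (jumps \<omega>)))"
  have "total_cost \<phi> ?\<tau> = (\<integral>\<^sup>+\<omega>. policy_cost R n \<phi> (gaps (jumps \<omega>)) \<partial>M)"
    unfolding total_cost_def
  proof (rule nn_integral_cong)
    fix \<omega> assume \<omega>: "\<omega> \<in> space M"
    note s = jump_times_sq[OF \<omega>]
    let ?p = "policy_time R n \<phi> (gaps (jumps \<omega>))"
    have p: "0 \<le> ?p" by (intro policy_time_nonneg R less_imp_le gaps_pos s)
    have "tcost \<phi> ?\<tau> \<omega> = cost Ge \<phi> (jumps \<omega>) ?p"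
      unfolding tcost_def cost_def using p
      by (intro nn_integral_cong) (auto split: split_indicator simp: ennreal_le_iff)
    then show "tcost \<phi> ?\<tau> \<omega> + ennreal (b * disc (?\<tau> \<omega>)) = policy_cost R n \<phi> (gaps (jumps \<omega>))"
      unfolding policy_cost_path[OF R(2) s] using p b_pos by (simp add: ennreal_mult'[symmetric] mult.commute)
  qed
  also have "\<dots> = (\<integral>\<^sup>+d. policy_cost R n \<phi> d \<partial>Sq)"
    by (rule nn_integral_gaps, rule policy_cost_measurable[OF R(1)]) measurable
  also have "\<dots> \<le> ennreal (x + n * e)" using R(3) x e by (simp add: ennreal_plus[symmetric] del: ennreal_plus)
  also have "\<dots> < ennreal b" using \<open>x + n * e < b\<close> b_pos by (rule ennreal_lessI[rotated])
  finally show ?thesis using policy_stopping_time[where R = R and n = n and \<phi> = \<phi>, OF R(1,2)] by blast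
qed

lemma zero_stopping_time: "(\<lambda>_. 0) \<in> stopping_times M N"
  unfolding stopping_times_def augmented_filtration_def by (auto intro: sigma_sets_top)

text \<open>If \<open>vinf \<phi> = b\<close>, no stopping time has negative cost and stopping at
  once attains \<open>0\<close>. Otherwise some policy has total cost below \<open>b\<close>, hence
  negative expected cost.\<close>

lemma stopping_region_eq: "stopping_region lam \<mu> c m M N \<sigma> = \<Gamma>inf"
proof -
  have "value_fun lam \<mu> c m M N \<sigma> \<phi> = 0 \<longleftrightarrow> vinf \<phi> = ennreal b" if \<phi>: "\<phi> \<in> Q" for \<phi>
  proof
    assume v: "vinf \<phi> = ennreal b"
    have "0 \<le> value_fun lam \<mu> c m M N \<sigma> \<phi>"
      unfolding value_fun_def
      using vinf_le_total_cost[OF \<phi>] expected_cost_sign(1)[OF _ \<phi>] unfolding v by (intro INF_greatest) auto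
    moreover have "value_fun lam \<mu> c m M N \<sigma> \<phi> \<le> expected_cost lam \<mu> c m M N \<sigma> (\<lambda>_. 0) \<phi>"
      unfolding value_fun_def by (rule INF_lower[OF zero_stopping_time])
    moreover have "expected_cost lam \<mu> c m M N \<sigma> (\<lambda>_. 0) \<phi> = 0"
    proof -
      have "tcost \<phi> (\<lambda>_. 0) = (\<lambda>_. 0)"
      proof
        fix \<omega>
        have "tcost \<phi> (\<lambda>_. 0) \<omega> = (\<integral>\<^sup>+u\<in>{0}. (ennreal (exp (- lam * u)) * Ge (path \<phi> (jumps \<omega>) u)) \<partial>lborel)"
          unfolding tcost_def by (intro nn_integral_cong) (auto split: split_indicator simp: ennreal_eq_0_iff)
        also have "\<dots> = 0" by (rule nn_integral_null_set) (simp add: null_sets_def)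
        finally show "tcost \<phi> (\<lambda>_. 0) \<omega> = 0" .
      qed
      moreover have "disc 0 = 1" by (simp add: disc_def)
      ultimately show ?thesis unfolding expected_cost_eq[OF zero_stopping_time \<phi>] by simp
    qed
    ultimately show "value_fun lam \<mu> c m M N \<sigma> \<phi> = 0" by simp
  next
    assume v: "value_fun lam \<mu> c m M N \<sigma> \<phi> = 0"
    show "vinf \<phi> = ennreal b"
    proof (rule ccontr)
      assume "vinf \<phi> \<noteq> ennreal b"
      then have "vinf \<phi> < ennreal b" using vinf_le_b[of \<phi>] by simp
      then obtain \<tau> where \<tau>: "\<tau> \<in> stopping_times M N" "total_cost \<phi> \<tau> < ennreal b"
        using exists_good_stopping_time[OF \<phi>] by blast
      have "value_fun lam \<mu> c m M N \<sigma> \<phi> \<le> expected_cost lam \<mu> c m M N \<sigma> \<tau> \<phi>"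
        unfolding value_fun_def by (rule INF_lower[OF \<tau>(1)])
      also have "\<dots> < 0" by (rule expected_cost_sign(2)[OF \<tau>(1) \<phi> \<tau>(2)])
      finally show False using v by simp
    qed
  qed
  then show ?thesis
    unfolding stopping_region_def \<Gamma>inf_def Q_def[symmetric] by (intro Collect_cong conj_cong refl)
qed

end

theorem proposition8p1:
  fixes lam \<mu> c m :: real
    and M :: "'a measure" and N :: "real \<Rightarrow> 'a \<Rightarrow> nat" and \<sigma> :: "nat \<Rightarrow> 'a \<Rightarrow> real"
  assumes "lam > 0" and "\<mu> > 1" and "c > 0" and "-1 < m" and "m < 1"
    and "poisson_process M \<mu> N \<sigma>"
  shows "\<exists>(\<gamma>n :: nat \<Rightarrow> real \<Rightarrow> real) (\<gamma> :: real \<Rightarrow> real) (\<xi>n :: nat \<Rightarrow> real) (\<xi> :: real).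
    (\<forall>n\<ge>1. (\<forall>x\<ge>0. \<gamma>n n x \<ge> 0) \<and> antimono_on {0..} (\<gamma>n n) \<and> convex_on {0..} (\<gamma>n n) \<and>
       continuous_on {0..} (\<gamma>n n) \<and>
       stopping_region_n lam \<mu> c m M N \<sigma> n = {(\<phi>0, \<phi>1). \<phi>0 \<ge> 0 \<and> \<phi>1 \<ge> 0 \<and> \<phi>1 \<ge> \<gamma>n n \<phi>0}) \<and>
    (\<forall>x\<ge>0. \<gamma> x \<ge> 0) \<and> antimono_on {0..} \<gamma> \<and> convex_on {0..} \<gamma> \<and> continuous_on {0..} \<gamma> \<and>
    stopping_region lam \<mu> c m M N \<sigma> = {(\<phi>0, \<phi>1). \<phi>0 \<ge> 0 \<and> \<phi>1 \<ge> 0 \<and> \<phi>1 \<ge> \<gamma> \<phi>0} \<and>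
    (\<forall>\<phi>0\<ge>0. mono_on {1..} (\<lambda>n. \<gamma>n n \<phi>0) \<and> (\<lambda>n. \<gamma>n n \<phi>0) \<longlonglongrightarrow> \<gamma> \<phi>0) \<and>
    lam / c * sqrt 2 \<le> \<xi>n 1 \<and> mono_on {1..} \<xi>n \<and> (\<forall>n\<ge>1. \<xi>n n \<le> \<xi>) \<and> \<xi> < xi_star lam \<mu> c m \<and>
    (\<forall>n\<ge>1. strict_antimono_on {0..\<xi>n n} (\<gamma>n n) \<and> (\<forall>x\<ge>\<xi>n n. \<gamma>n n x = 0)) \<and>
    strict_antimono_on {0..\<xi>} \<gamma> \<and> (\<forall>x\<ge>\<xi>. \<gamma> x = 0) \<and>
    lam / c * sqrt 2 \<le> \<gamma>n 1 0 \<and> mono_on {1..} (\<lambda>n. \<gamma>n n 0) \<and> (\<forall>n\<ge>1. \<gamma>n n 0 \<le> \<gamma> 0) \<and>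
    \<gamma> 0 < xi_star lam \<mu> c m"
proof -
  interpret poisson_disorder lam \<mu> c m M N \<sigma>
    using assms by unfold_locales
  note R = upper_region_\<Gamma>n upper_region_\<Gamma>inf
  have sub: "\<Gamma>inf \<subseteq> \<Gamma>n n" if "n \<ge> 1" for n using that by (auto simp: \<Gamma>inf_eq)
  have mono: "mono_on {1..} (\<lambda>n. lower_boundary (\<Gamma>n n) x)" if "0 \<le> x" for x
    by (rule monotone_onI) (auto intro!: lower_boundary_mono R \<Gamma>n_antimono that)
  have mono\<xi>: "mono_on {1..} (\<lambda>n. boundary_zero (\<Gamma>n n))"
    by (rule monotone_onI) (auto intro!: boundary_zero_mono R \<Gamma>n_antimono)
  have lim: "(\<lambda>n. lower_boundary (\<Gamma>n n) x) \<longlonglongrightarrow> lower_boundary \<Gamma>inf x" if "0 \<le> x" for x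
    by (rule lower_boundary_tendsto[OF R(1) R(2) \<Gamma>n_antimono \<Gamma>inf_eq that])
  have lb: "lam / c * sqrt 2 = lam * b" by (simp add: b_def)
  \<comment> \<open>The boundary points on the axes belong to \<open>\<Gamma>n 1\<close>, so
    \<open>G_\<Gamma>n\<close> applies to them, and there \<open>G\<close> equals the nonzero
    coordinate.\<close>
  have "lam * b \<le> boundary_zero (\<Gamma>n 1)"
    using boundary_zero_iff[OF R(1), of 1 "boundary_zero (\<Gamma>n 1)"] G_\<Gamma>n[of 1 "(boundary_zero (\<Gamma>n 1), 0)"]
    by (simp add: G_def)
  moreover have "lam * b \<le> lower_boundary (\<Gamma>n 1) 0"
    using lower_boundary_iff[OF R(1), of 1 0 "lower_boundary (\<Gamma>n 1) 0"] G_\<Gamma>n[of 1 "(0, lower_boundary (\<Gamma>n 1) 0)"]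
    by (simp add: G_def)
  \<comment> \<open>Strict because \<open>\<Gamma>inf_axes\<close> supplies points of the region on
    the axes strictly below \<open>xi_star\<close>.\<close>
  moreover have "boundary_zero \<Gamma>inf < xi_star lam \<mu> c m"
    using \<Gamma>inf_axes(2) boundary_zero_iff[OF R(2)] by (auto intro: le_less_trans)
  moreover have "lower_boundary \<Gamma>inf 0 < xi_star lam \<mu> c m"
    using \<Gamma>inf_axes(1) lower_boundary_iff[OF R(2), of 0] by (auto intro: le_less_trans)
  moreover have "\<forall>n\<ge>1. boundary_zero (\<Gamma>n n) \<le> boundary_zero \<Gamma>inf" "\<forall>n\<ge>1. lower_boundary (\<Gamma>n n) 0 \<le> lower_boundary \<Gamma>inf 0"
    using sub by (auto intro!: boundary_zero_mono lower_boundary_mono R)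
  moreover have "\<forall>n\<ge>1. (\<forall>x\<ge>0. lower_boundary (\<Gamma>n n) x \<ge> 0) \<and> antimono_on {0..} (lower_boundary (\<Gamma>n n)) \<and>
       convex_on {0..} (lower_boundary (\<Gamma>n n)) \<and> continuous_on {0..} (lower_boundary (\<Gamma>n n)) \<and>
       stopping_region_n lam \<mu> c m M N \<sigma> n = {(\<phi>0, \<phi>1). \<phi>0 \<ge> 0 \<and> \<phi>1 \<ge> 0 \<and> \<phi>1 \<ge> lower_boundary (\<Gamma>n n) \<phi>0}"
    using R(1) stopping_region_n_eq upper_region_eq[OF R(1)]
    by (simp add: lower_boundary_nonneg lower_boundary_antimono lower_boundary_convex lower_boundary_continuous)
  moreover have "stopping_region lam \<mu> c m M N \<sigma> = {(\<phi>0, \<phi>1). \<phi>0 \<ge> 0 \<and> \<phi>1 \<ge> 0 \<and> \<phi>1 \<ge> lower_boundary \<Gamma>inf \<phi>0}"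
    unfolding stopping_region_eq by (rule upper_region_eq[OF R(2)])
  moreover have "\<forall>n\<ge>1. strict_antimono_on {0..boundary_zero (\<Gamma>n n)} (lower_boundary (\<Gamma>n n)) \<and>
      (\<forall>x\<ge>boundary_zero (\<Gamma>n n). lower_boundary (\<Gamma>n n) x = 0)"
    using R(1) by (simp add: lower_boundary_strict_antimono lower_boundary_zero)
  ultimately show ?thesis
    unfolding lb
    by (intro exI[of _ "\<lambda>n. lower_boundary (\<Gamma>n n)"] exI[of _ "lower_boundary \<Gamma>inf"]
        exI[of _ "\<lambda>n. boundary_zero (\<Gamma>n n)"] exI[of _ "boundary_zero \<Gamma>inf"])
       (simp add: mono[unfolded One_nat_def] mono\<xi>[unfolded One_nat_def] lim lower_boundary_nonneg lower_boundary_antimono lower_boundary_convex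
        lower_boundary_continuous lower_boundary_strict_antimono lower_boundary_zero R(2))
qed

end
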